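(* Let $Z,T,Y,k_Y,(s_i)_{i\in\mathbb{N}}$ and the parametric model $\{k_{Y,\theta};\theta\in\Theta\}$, with $\Theta=[\sigma_{\inf}^2,\sigma_{\sup}^2]\times\mathcal{S}$ and $k_{Y,\theta}=\sigma^2c_{Y,\psi}$ for $\theta=(\sigma^2,\psi)$, be as in the framework described in the context, and assume that the model satisfies the regularity condition (A), the Fourier condition (B) and the well-specification condition (C) given there, with true parameter $\theta_0=(\sigma_0^2,\psi_0)$. Assume moreover that for all $\alpha>0$, \[ \liminf_{n\to\infty}\ \inf_{\psi\in\mathcal{S},\ \|\psi-\psi_0\|\ge\alpha}\ \frac1n\sum_{i,j=1}^n\bigl(c_{Y,\psi}(s_i-s_j)-c_{Y,\psi_0}(s_i-s_j)\bigr)^2>0 . \] For $n\in\mathbb{N}$ let $y=(Y(s_1),\ldots,Y(s_n))^\top$, $C_\psi=(c_{Y,\psi}(s_i-s_j))_{i,j=1,\ldots,n}$, and let \[ \hat\psi_{\mathrm{CV}}\in\operatorname*{argmin}_{\psi\in\mathcal{S}}CV_\psi,\qquad CV_\psi=\frac1n\,y^\top C_\psi^{-1}\operatorname{diag}(C_\psi^{-1})^{-2}C_\psi^{-1}y . \] Then, as $n\to\infty$, $\hat\psi_{\mathrm{CV}}\to\psi_0$ in probability.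
   Context: $\mathbb{N}$ is the set of positive integers; $|x|=\max_i|x_i|$ and $\|x\|$ is the Euclidean norm; $\operatorname{diag}(M)$ is the matrix obtained from a square matrix $M$ by setting its off-diagonal elements to zero. A function $k:\mathbb{R}^d\to\mathbb{R}$ is called a stationary covariance function if $(x_1,x_2)\mapsto k(x_1-x_2)$ is a covariance function; it is a stationary correlation function if moreover $k(0)=1$. The Fourier transform of $h:\mathbb{R}^d\to\mathbb{R}$ is $\hat h(f)=(2\pi)^{-d}\int_{\mathbb{R}^d}h(t)e^{-\mathrm{i}f^\top t}\,dt$. A sequence $(x_i)_{i\in\mathbb{N}}$ in $\mathbb{R}^d$ is asymptotically well-separated if $\inf_{i\neq j}|x_i-x_j|>0$. A stationary covariance function $k$ on $\mathbb{R}^d$ is sub-exponential and asymptotically positive if: (i) there are constants $C<\infty$, $c>0$ with $|k(s)|\le C\exp(-c|s|)$ for all $s\in\mathbb{R}^d$; (ii) for any asymptotically well-separated sequence $(x_i)$, the smallest eigenvalue of $(k(x_i-x_j))_{i,j=1,\ldots,n}$ is bounded below by a strictly positive constant uniformly in $n\in\mathbb{N}$. A function $F:\mathbb{R}\to\mathbb{R}$ is sub-exponential and non-decreasing if it is non-constant, continuously differentiable, non-decreasing, and there is $C<\infty$ with $|F(t)|\le C\exp(C|t|)$ and $|F'(t)|\le C\exp(C|t|)$ for all $t\in\mathbb{R}$. Framework: $d\in\mathbb{N}$; $Z$ is a zero-mean Gaussian process on $\mathbb{R}^d$ with stationary covariance function $k_Z$ that is sub-exponential and asymptotically positive; $T:\mathbb{R}\to\mathbb{R}$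 is a fixed sub-exponential and non-decreasing function; $Y(s)=T(Z(s))$ is assumed to have zero mean, and $k_Y$ is its stationary covariance function; $(s_i)_{i\in\mathbb{N}}$ is an asymptotically well-separated sequence in $\mathbb{R}^d$; $\{k_{Y,\theta};\theta\in\Theta\}$ is a family of stationary covariance functions on $\mathbb{R}^d$, where $\Theta=[\sigma_{\inf}^2,\sigma_{\sup}^2]\times\mathcal{S}\subset\mathbb{R}^p$ with $0<\sigma_{\inf}^2<\sigma_{\sup}^2<\infty$ fixed and $\mathcal{S}\subset\mathbb{R}^{p-1}$ compact, and for $\theta=(\sigma^2,\psi)\in\Theta$, $k_{Y,\theta}=\sigma^2c_{Y,\psi}$ with $c_{Y,\psi}$ a stationary correlation function. (A) For all $s\in\mathbb{R}^d$, $k_{Y,\theta}(s)$ is three times continuously differentiable with respect to $\theta$, and there are constants $C<\infty$, $c>0$ such that for all $s\in\mathbb{R}^d$: $\sup_{\theta\in\Theta}|k_{Y,\theta}(s)|\le C\exp(-c|s|)$ and \[ \sup_{\theta\in\Theta,\ \ell\in\{1,2,3\},\ i_1,\ldots,i_\ell\in\{1,\ldots,p\}}\left|\frac{\partial^\ell k_{Y,\theta}(s)}{\partial\theta_{i_1}\cdots\partial\theta_{i_\ell}}\right|\le\frac{C}{1+|s|^{d+c}} . \] (B) The Fourier transform $\hat k_{Y,\theta}(f)$ of $k_{Y,\theta}$ is jointly continuous in $(\theta,f)$ and strictly positive on $\Theta\times\mathbb{R}^d$. (C) There exists $\theta_0=(\sigma_0^2,\psi_0)$ in the interior of $\Theta$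 such that $k_Y=k_{Y,\theta_0}$.
   Formalization: In (A), derivatives on the compact Θ, undefined in general off its interior, are read through a C³ extension of θ ↦ k_{Y,θ}(s) to a convex or open set containing Θ, with the derivative bounds holding on that set; for convex Θ this set may be Θ itself. *)

theory Defs
  imports
    "HOL-Probability.Probability"
    "Jordan_Normal_Form.Char_Poly"
    "Jordan_Normal_Form.Gauss_Jordan_Elimination"
begin

text \<open>Conventions: the max-norm is \<^const>\<open>infnorm\<close>, and sequences and matrices are indexed from
  0, so that the sample of size \<open>n\<close> consists of the sites \<open>s 0, \<dots>, s (n - 1)\<close>.\<close>

subsection \<open>Covariance functions\<close>

definition covariance_function :: "('a \<Rightarrow> 'a \<Rightarrow> real) \<Rightarrow> bool" where
  "covariance_function K \<longleftrightarrow>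
     (\<forall>x y. K x y = K y x) \<and>
     (\<forall>(n::nat) x a. 0 \<le> (\<Sum>i<n. \<Sum>j<n. a i * a j * K (x i) (x j)))"

definition stationary_covariance :: "(real ^ 'd \<Rightarrow> real) \<Rightarrow> bool" where
  "stationary_covariance k \<longleftrightarrow> covariance_function (\<lambda>x y. k (x - y))"

definition stationary_correlation :: "(real ^ 'd \<Rightarrow> real) \<Rightarrow> bool" where
  "stationary_correlation k \<longleftrightarrow> stationary_covariance k \<and> k 0 = 1"

definition well_separated :: "(nat \<Rightarrow> real ^ 'd) \<Rightarrow> bool" where
  "well_separated x \<longleftrightarrow> 0 < (INF (i, j)\<in>{(i, j). i \<noteq> j}. infnorm (x i - x j))"

definition kernel_mat :: "(real ^ 'd \<Rightarrow> real) \<Rightarrow> (nat \<Rightarrow> real ^ 'd) \<Rightarrow> nat \<Rightarrow> real mat" where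
  "kernel_mat k x n = Matrix.mat n n (\<lambda>(i, j). k (x i - x j))"

text \<open>Only meaningful for matrices having a real eigenvalue, such as non-empty symmetric ones.\<close>
definition smallest_eigenvalue :: "real mat \<Rightarrow> real" where
  "smallest_eigenvalue A = Min {e. eigenvalue A e}"

definition subexp_asymp_positive :: "(real ^ 'd \<Rightarrow> real) \<Rightarrow> bool" where
  "subexp_asymp_positive k \<longleftrightarrow>
     stationary_covariance k \<and>
     (\<exists>C c. 0 < c \<and> (\<forall>s. \<bar>k s\<bar> \<le> C * exp (- c * infnorm s))) \<and>
     (\<forall>x. well_separated x \<longrightarrow>
        (\<exists>\<delta>>0. \<forall>n\<ge>1. \<delta> \<le> smallest_eigenvalue (kernel_mat k x n)))"

definition subexp_nondecreasing :: "(real \<Rightarrow> real) \<Rightarrow> bool" where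
  "subexp_nondecreasing F \<longleftrightarrow>
     \<not> F constant_on UNIV \<and>
     F differentiable_on UNIV \<and> continuous_on UNIV (deriv F) \<and>
     mono F \<and>
     (\<exists>C. \<forall>t. \<bar>F t\<bar> \<le> C * exp (C * \<bar>t\<bar>) \<and> \<bar>deriv F t\<bar> \<le> C * exp (C * \<bar>t\<bar>))"

subsection \<open>Random fields\<close>

text \<open>Degenerate (almost surely constant) variables count as Gaussian.\<close>
definition gaussian_variable :: "'w measure \<Rightarrow> ('w \<Rightarrow> real) \<Rightarrow> bool" where
  "gaussian_variable M X \<longleftrightarrow>
     X \<in> borel_measurable M \<and>
     (\<exists>\<mu> \<sigma>. (\<sigma> = 0 \<and> (AE \<omega> in M. X \<omega> = \<mu>)) \<or>
            (0 < \<sigma> \<and> distributed M lborel X (normal_density \<mu> \<sigma>)))"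

definition gaussian_process :: "'w measure \<Rightarrow> ('a \<Rightarrow> 'w \<Rightarrow> real) \<Rightarrow> bool" where
  "gaussian_process M Z \<longleftrightarrow>
     (\<forall>F a. finite F \<longrightarrow> gaussian_variable M (\<lambda>\<omega>. \<Sum>x\<in>F. a x * Z x \<omega>))"

definition zero_mean :: "'w measure \<Rightarrow> ('a \<Rightarrow> 'w \<Rightarrow> real) \<Rightarrow> bool" where
  "zero_mean M X \<longleftrightarrow> (\<forall>x. integrable M (X x) \<and> integral\<^sup>L M (X x) = 0)"

definition has_stationary_covariance ::
    "'w measure \<Rightarrow> (real ^ 'd \<Rightarrow> 'w \<Rightarrow> real) \<Rightarrow> (real ^ 'd \<Rightarrow> real) \<Rightarrow> bool" where
  "has_stationary_covariance M X k \<longleftrightarrow>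
     (\<forall>x y. integrable M (\<lambda>\<omega>. (X x \<omega> - integral\<^sup>L M (X x)) * (X y \<omega> - integral\<^sup>L M (X y))) \<and>
            k (x - y) = (\<integral>\<omega>. (X x \<omega> - integral\<^sup>L M (X x)) * (X y \<omega> - integral\<^sup>L M (X y)) \<partial>M))"

definition converges_in_probability ::
    "'w measure \<Rightarrow> (nat \<Rightarrow> 'w \<Rightarrow> 'b::euclidean_space) \<Rightarrow> 'b \<Rightarrow> bool" where
  "converges_in_probability M X x \<longleftrightarrow>
     (\<forall>\<epsilon>>0. (\<lambda>n. measure M {\<omega> \<in> space M. \<epsilon> < dist (X n \<omega>) x}) \<longlonglongrightarrow> 0)"

subsection \<open>The parametric model\<close>

text \<open>A parameter \<open>\<theta> = (\<sigma>\<^sup>2, \<psi>)\<close> is a pair, whose first component is the variance itself.\<close>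

definition param_space :: "real \<Rightarrow> real \<Rightarrow> (real ^ 'q) set \<Rightarrow> (real \<times> (real ^ 'q)) set" where
  "param_space vinf vsup S = {vinf..vsup} \<times> S"

definition model_cov ::
    "(real ^ 'q \<Rightarrow> real ^ 'd \<Rightarrow> real) \<Rightarrow> real \<times> (real ^ 'q) \<Rightarrow> real ^ 'd \<Rightarrow> real" where
  "model_cov c \<theta> s = fst \<theta> * c (snd \<theta>) s"

definition pderiv_within ::
    "('a::euclidean_space) set \<Rightarrow> 'a \<Rightarrow> ('a \<Rightarrow> real) \<Rightarrow> 'a \<Rightarrow> real" where
  "pderiv_within U b g x = frechet_derivative g (at x within U) b"

fun iterated_pderiv_within ::
    "('a::euclidean_space) set \<Rightarrow> 'a list \<Rightarrow> ('a \<Rightarrow> real) \<Rightarrow> 'a \<Rightarrow> real" where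
  "iterated_pderiv_within U [] g = g"
| "iterated_pderiv_within U (b # bs) g = pderiv_within U b (iterated_pderiv_within U bs g)"

fun continuously_differentiable_on ::
    "nat \<Rightarrow> ('a::euclidean_space \<Rightarrow> real) \<Rightarrow> 'a set \<Rightarrow> bool" where
  "continuously_differentiable_on 0 g U \<longleftrightarrow> continuous_on U g"
| "continuously_differentiable_on (Suc m) g U \<longleftrightarrow>
     g differentiable_on U \<and>
     (\<forall>b\<in>Basis. continuously_differentiable_on m (pderiv_within U b g) U)"

text \<open>
  The parameter set \<open>\<Theta>\<close> is merely compact, so differentiability in \<open>\<theta>\<close> at its boundary needs an
  interpretation. If \<open>\<Theta>\<close> is convex one may take \<open>U = \<Theta>\<close> below, with one-sided derivatives at
  the boundary. Otherwise the derivatives are those of an extension to a neighbourhood \<open>U\<close> of \<open>\<Theta>\<close>,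
  which must obey the same bounds: on a general compact set, bounds for the derivatives on the
  set alone do not control increments. Derivatives within a convex \<open>U\<close> are unique as soon as
  \<open>\<Theta>\<close> has an interior point.
\<close>
definition regular_model ::
    "('a::euclidean_space) set \<Rightarrow> ('a \<Rightarrow> real ^ 'd \<Rightarrow> real) \<Rightarrow> bool" where
  "regular_model \<Theta> k \<longleftrightarrow>
     (\<exists>U K C c. \<Theta> \<subseteq> U \<and> (convex U \<or> open U) \<and> 0 < c \<and>
        (\<forall>\<theta>\<in>\<Theta>. \<forall>s. K \<theta> s = k \<theta> s) \<and>
        (\<forall>s. continuously_differentiable_on 3 (\<lambda>\<theta>. K \<theta> s) U) \<and>
        (\<forall>\<theta>\<in>\<Theta>. \<forall>s. \<bar>k \<theta> s\<bar> \<le> C * exp (- c * infnorm s)) \<and>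
        (\<forall>\<theta>\<in>U. \<forall>s. \<forall>bs. set bs \<subseteq> Basis \<and> length bs \<in> {1, 2, 3} \<longrightarrow>
           \<bar>iterated_pderiv_within U bs (\<lambda>\<theta>. K \<theta> s) \<theta>\<bar>
             \<le> C / (1 + infnorm s powr (real CARD('d) + c))))"

definition fourier :: "(real ^ 'd \<Rightarrow> real) \<Rightarrow> real ^ 'd \<Rightarrow> complex" where
  "fourier h f =
     complex_of_real ((2 * pi) powr (- real CARD('d))) *
     (\<integral>t. complex_of_real (h t) * exp (- \<i> * complex_of_real (f \<bullet> t)) \<partial>lebesgue)"

definition positive_continuous_fourier ::
    "('a::euclidean_space) set \<Rightarrow> ('a \<Rightarrow> real ^ 'd \<Rightarrow> real) \<Rightarrow> bool" where
  "positive_continuous_fourier \<Theta> k \<longleftrightarrow>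
     continuous_on (\<Theta> \<times> UNIV) (\<lambda>(\<theta>, f). fourier (k \<theta>) f) \<and>
     (\<forall>\<theta>\<in>\<Theta>. \<forall>f. Im (fourier (k \<theta>) f) = 0 \<and> 0 < Re (fourier (k \<theta>) f))"

subsection \<open>Cross validation\<close>

text \<open>\<^const>\<open>mat_inverse\<close> returns \<^const>\<open>None\<close> exactly on non-invertible matrices.\<close>
definition inv_mat :: "real mat \<Rightarrow> real mat" where
  "inv_mat A = the (mat_inverse A)"

definition diag_part :: "real mat \<Rightarrow> real mat" where
  "diag_part A = Matrix.mat (dim_row A) (dim_col A) (\<lambda>(i, j). if i = j then A $$ (i, j) else 0)"

definition cv_criterion ::
    "(real ^ 'd \<Rightarrow> real) \<Rightarrow> (nat \<Rightarrow> real ^ 'd) \<Rightarrow> nat \<Rightarrow> real Matrix.vec \<Rightarrow> real" where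
  "cv_criterion c s n y =
     (let R = inv_mat (kernel_mat c s n)
      in 1 / real n *
         scalar_prod y ((R * (inv_mat (diag_part R) ^\<^sub>m 2) * R) *\<^sub>v y))"

definition observations :: "(real ^ 'd \<Rightarrow> 'w \<Rightarrow> real) \<Rightarrow> (nat \<Rightarrow> real ^ 'd) \<Rightarrow> nat \<Rightarrow> 'w \<Rightarrow> real Matrix.vec"
  where "observations Y s n \<omega> = Matrix.vec n (\<lambda>i. Y (s i) \<omega>)"

end

theory Submission
  imports Defs
begin

text \<open>
  Let \<open>C\<close> be the correlation matrix of the sites under a candidate \<open>\<psi>\<close>, \<open>R = C\<^sup>-\<^sup>1\<close> and
  \<open>D = diag R\<close>. The vector \<open>D\<^sup>-\<^sup>1 R y\<close> consists of the leave-one-out prediction errors, and the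
  criterion is \<open>\<parallel>D\<^sup>-\<^sup>1 R y\<parallel>\<^sup>2 / n\<close>. Consistency of its minimiser rests on four facts.

  \<^item> \<^emph>\<open>Uniform ellipticity.\<close> All eigenvalues of all \<open>C\<close> lie in a fixed interval \<open>[l, L]\<close> with
    \<open>l > 0\<close>. The upper bound is Schur's test, since well-separated sites make exponentially decaying
    kernels summable. For the lower bound, a quadratic form of a kernel \<open>k\<close> does not increase when \<open>k\<close> is
    averaged over shifts; averaging with a Gaussian density turns it into a
    Gaussian-weighted integral of \<open>\<bar>\<Sum>\<^sub>i a\<^sub>i exp (\<i> u \<bullet> x\<^sub>i)\<bar>\<^sup>2\<close> times the Fourier transform of \<open>k\<close> at \<open>u\<close>, and for a
    wide weight the exponentials at separated sites are almost orthogonal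
    (\<open>positive_spectrum_coercive\<close>). Only averages of \<open>k\<close> enter because \<open>k\<close> may jump at the origin (a nugget effect).

  \<^item> \<^emph>\<open>Identifiability.\<close> The matrix \<open>B = D\<^sup>-\<^sup>1 R\<close> (\<open>loo\<close>) has unit diagonal, so the difference \<open>E\<close> of two such
    matrices has zero diagonal, whereas \<open>C\<^sub>0 B\<^sub>0\<^sup>T = D\<^sub>0\<^sup>-\<^sup>1\<close> is diagonal. Hence the mixed terms in the
    expected criterion cancel, and its excess over the value at the truth is
    \<open>\<sigma>\<^sub>0\<^sup>2 tr (E C\<^sub>0 E\<^sup>T) / n\<close>, which is at least \<open>\<sigma>\<^sub>0\<^sup>2 l \<parallel>E\<parallel>\<^sup>2 / n\<close> (\<open>excess\<close>). Conversely \<open>B\<close> determines \<open>C\<close>: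
    the inverse of \<open>B\<close> is \<open>C D\<close>, whose diagonal is that of \<open>D\<close> because \<open>C\<close> has unit diagonal. This
    bounds \<open>\<parallel>C - C\<^sub>0\<parallel>\<close> by a multiple of \<open>\<parallel>E\<parallel>\<close> in Frobenius norm (\<open>frob_sq_C_diff\<close>).

  \<^item> \<^emph>\<open>Concentration.\<close> For fixed \<open>\<psi>\<close> the variance of the criterion is \<open>O(n\<^sup>-\<^sup>1\<^sup>/\<^sup>2)\<close>. This follows from
    the Gaussian Poincare inequality, proved by rotating \<open>Z\<close> into an independent copy
    (\<open>poincare\<close>). The gradient is bounded through operator norms, so the decay of the
    entries of \<open>R\<close> away from the diagonal does not have to be analysed (\<open>quadratic_form_variance\<close>).

  \<^item> \<^emph>\<open>Equicontinuity.\<close> The derivative bounds of the model make \<open>\<psi> \<mapsto> C\<close> Lipschitz in operator norm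
    uniformly in \<open>n\<close>, so the criterion is Lipschitz in \<open>\<psi>\<close> up to the factor \<open>\<parallel>y\<parallel>\<^sup>2 / n\<close>, which concentrates
    as well. A finite net of the compact parameter set then suffices (\<open>argmin_consistent\<close>).
\<close>

section \<open>Operator norms of matrices indexed by initial segments\<close>

abbreviation nrm :: "nat \<Rightarrow> (nat \<Rightarrow> real) \<Rightarrow> real" where
  "nrm n x \<equiv> L2_set x {..<n}"

text \<open>
  Matrices are functions on pairs of indices, of which only those below \<open>n\<close> count, so that the
  size may vary inside a statement and no carrier conditions arise.
\<close>
definition matvec :: "nat \<Rightarrow> (nat \<Rightarrow> nat \<Rightarrow> real) \<Rightarrow> (nat \<Rightarrow> real) \<Rightarrow> nat \<Rightarrow> real" where
  "matvec n A x i = (\<Sum>j<n. A i j * x j)"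

definition frob_sq :: "nat \<Rightarrow> (nat \<Rightarrow> nat \<Rightarrow> real) \<Rightarrow> real" where
  "frob_sq n A = (\<Sum>i<n. \<Sum>j<n. (A i j)\<^sup>2)"

definition op_norm_le :: "nat \<Rightarrow> (nat \<Rightarrow> nat \<Rightarrow> real) \<Rightarrow> real \<Rightarrow> bool" where
  "op_norm_le n A K \<longleftrightarrow> (\<forall>x. nrm n (matvec n A x) \<le> K * nrm n x)"

lemma nrm_sq: "(nrm n x)\<^sup>2 = (\<Sum>i<n. (x i)\<^sup>2)"
  unfolding L2_set_def by (simp add: sum_nonneg)

lemma dot_le_nrm: "\<bar>\<Sum>i<n. x i * y i\<bar> \<le> nrm n x * nrm n y"
proof -
  have "\<bar>\<Sum>i<n. x i * y i\<bar> \<le> (\<Sum>i<n. \<bar>x i\<bar> * \<bar>y i\<bar>)"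
    using sum_abs[of "\<lambda>i. x i * y i" "{..<n}"] by (simp add: abs_mult)
  also have "\<dots> \<le> nrm n x * nrm n y" by (rule L2_set_mult_ineq)
  finally show ?thesis .
qed

lemma nrm_mono_abs:
  assumes "\<And>i. i < n \<Longrightarrow> \<bar>x i\<bar> \<le> k * \<bar>y i\<bar>" "0 \<le> k"
  shows "nrm n x \<le> k * nrm n y"
proof -
  have "nrm n x = nrm n (\<lambda>i. \<bar>x i\<bar>)" unfolding L2_set_def by simp
  also have "\<dots> \<le> nrm n (\<lambda>i. k * \<bar>y i\<bar>)"
    by (rule L2_set_mono) (use assms in auto)
  also have "\<dots> = k * nrm n (\<lambda>i. \<bar>y i\<bar>)"
    using L2_set_right_distrib[OF assms(2)] by metis
  also have "\<dots> = k * nrm n y" unfolding L2_set_def by simp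
  finally show ?thesis .
qed

lemma op_norm_leD: "op_norm_le n A K \<Longrightarrow> nrm n (matvec n A x) \<le> K * nrm n x"
  by (simp add: op_norm_le_def)

lemma op_norm_le_sq:
  assumes "op_norm_le n A K"
  shows "(\<Sum>i<n. (matvec n A x i)\<^sup>2) \<le> K\<^sup>2 * (\<Sum>i<n. (x i)\<^sup>2)"
proof -
  have "(nrm n (matvec n A x))\<^sup>2 \<le> (K * nrm n x)\<^sup>2"
    by (rule power_mono[OF op_norm_leD[OF assms]]) simp
  then show ?thesis by (simp add: nrm_sq power_mult_distrib)
qed

text \<open>Schur's test.\<close>
lemma op_norm_le_row_sums:
  assumes row: "\<And>i. i < n \<Longrightarrow> (\<Sum>j<n. \<bar>A i j\<bar>) \<le> K"
    and col: "\<And>j. j < n \<Longrightarrow> (\<Sum>i<n. \<bar>A i j\<bar>) \<le> K"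
    and K: "0 \<le> K"
  shows "op_norm_le n A K"
  unfolding op_norm_le_def
proof
  fix x :: "nat \<Rightarrow> real"
  have *: "(matvec n A x i)\<^sup>2 \<le> K * (\<Sum>j<n. \<bar>A i j\<bar> * (x j)\<^sup>2)" if i: "i < n" for i
  proof -
    have "\<bar>matvec n A x i\<bar> \<le> (\<Sum>j<n. \<bar>A i j\<bar> * \<bar>x j\<bar>)"
      unfolding matvec_def using sum_abs[of "\<lambda>j. A i j * x j" "{..<n}"] by (simp add: abs_mult)
    also have "\<dots> = (\<Sum>j<n. sqrt \<bar>A i j\<bar> * (sqrt \<bar>A i j\<bar> * \<bar>x j\<bar>))"
      by (simp add: mult.assoc[symmetric])
    finally have "(matvec n A x i)\<^sup>2 \<le> (\<Sum>j<n. sqrt \<bar>A i j\<bar> * (sqrt \<bar>A i j\<bar> * \<bar>x j\<bar>))\<^sup>2"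
      by (rule abs_le_square_iff[THEN iffD1, OF order_trans]) simp
    also have "\<dots> \<le> (\<Sum>j<n. (sqrt \<bar>A i j\<bar>)\<^sup>2) * (\<Sum>j<n. (sqrt \<bar>A i j\<bar> * \<bar>x j\<bar>)\<^sup>2)"
      by (rule Cauchy_Schwarz_ineq_sum)
    also have "\<dots> = (\<Sum>j<n. \<bar>A i j\<bar>) * (\<Sum>j<n. \<bar>A i j\<bar> * (x j)\<^sup>2)"
      by (simp add: power_mult_distrib)
    also have "\<dots> \<le> K * (\<Sum>j<n. \<bar>A i j\<bar> * (x j)\<^sup>2)"
      by (rule mult_right_mono[OF row[OF i]]) (simp add: sum_nonneg)
    finally show ?thesis .
  qed
  have "(nrm n (matvec n A x))\<^sup>2 \<le> (\<Sum>i<n. K * (\<Sum>j<n. \<bar>A i j\<bar> * (x j)\<^sup>2))"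
    unfolding nrm_sq by (rule sum_mono) (use * in auto)
  also have "\<dots> = K * (\<Sum>j<n. (\<Sum>i<n. \<bar>A i j\<bar>) * (x j)\<^sup>2)"
    by (subst sum_distrib_left[symmetric], subst sum.swap) (simp add: sum_distrib_right)
  also have "\<dots> \<le> K * (\<Sum>j<n. K * (x j)\<^sup>2)"
    by (intro mult_left_mono sum_mono mult_right_mono col K) auto
  also have "\<dots> = (K * nrm n x)\<^sup>2"
    by (simp add: power_mult_distrib nrm_sq sum_distrib_left[symmetric] power2_eq_square[of K])
  finally show "nrm n (matvec n A x) \<le> K * nrm n x"
    by (rule power2_le_imp_le) (simp add: K)
qed

lemma op_norm_le_transpose:
  assumes B: "op_norm_le n B b" and b: "0 \<le> b"
  shows "op_norm_le n (\<lambda>i j. B j i) b"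
  unfolding op_norm_le_def
proof
  fix w
  let ?v = "matvec n (\<lambda>i j. B j i) w"
  have "(nrm n ?v)\<^sup>2 = (\<Sum>i<n. ?v i * ?v i)" unfolding nrm_sq by (simp add: power2_eq_square)
  also have "\<dots> = (\<Sum>i<n. \<Sum>k<n. w k * (B k i * ?v i))"
    unfolding matvec_def[of n "\<lambda>i j. B j i" w] sum_distrib_right by (simp add: mult_ac)
  also have "\<dots> = (\<Sum>k<n. w k * matvec n B ?v k)"
    by (subst sum.swap) (simp only: matvec_def[of n B] sum_distrib_left)
  also have "\<dots> \<le> nrm n w * nrm n (matvec n B ?v)" using dot_le_nrm[of w "matvec n B ?v" n] by linarith
  also have "\<dots> \<le> nrm n w * (b * nrm n ?v)" by (intro mult_left_mono op_norm_leD[OF B]) auto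
  finally have le: "nrm n ?v * nrm n ?v \<le> (b * nrm n w) * nrm n ?v" by (simp add: power2_eq_square mult_ac)
  show "nrm n ?v \<le> b * nrm n w"
  proof (cases "nrm n ?v = 0")
    case True
    then show ?thesis using b by simp
  next
    case False
    then have "0 < nrm n ?v" using L2_set_nonneg[of ?v "{..<n}"] by linarith
    with le show ?thesis by simp
  qed
qed

lemma quadratic_form_le:
  assumes "op_norm_le n A K"
  shows "(\<Sum>i<n. \<Sum>j<n. g i * g j * A i j) \<le> K * (\<Sum>i<n. (g i)\<^sup>2)"
proof -
  have "(\<Sum>i<n. \<Sum>j<n. g i * g j * A i j) = (\<Sum>i<n. g i * matvec n A g i)"
    unfolding matvec_def sum_distrib_left by (simp add: mult_ac)
  also have "\<dots> \<le> nrm n g * nrm n (matvec n A g)" using dot_le_nrm[of g "matvec n A g" n] by linarith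
  also have "\<dots> \<le> nrm n g * (K * nrm n g)" by (intro mult_left_mono op_norm_leD[OF assms]) auto
  also have "\<dots> = K * (\<Sum>i<n. (g i)\<^sup>2)" unfolding nrm_sq[symmetric] by (simp add: power2_eq_square)
  finally show ?thesis .
qed

text \<open>
  A product with a matrix of bounded operator norm acts on the columns, respectively the rows, of
  the other factor separately.
\<close>
lemma frob_sq_mult_left:
  assumes "op_norm_le n P K"
  shows "frob_sq n (\<lambda>i j. \<Sum>k<n. P i k * E k j) \<le> K\<^sup>2 * frob_sq n E"
proof -
  have "frob_sq n (\<lambda>i j. \<Sum>k<n. P i k * E k j) = (\<Sum>j<n. \<Sum>i<n. (matvec n P (\<lambda>k. E k j) i)\<^sup>2)"
    unfolding frob_sq_def matvec_def by (rule sum.swap)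
  also have "\<dots> \<le> (\<Sum>j<n. K\<^sup>2 * (\<Sum>k<n. (E k j)\<^sup>2))"
    by (intro sum_mono op_norm_le_sq assms)
  also have "\<dots> = K\<^sup>2 * frob_sq n E"
    unfolding frob_sq_def by (subst sum_distrib_left[symmetric], subst sum.swap) simp
  finally show ?thesis .
qed

lemma frob_sq_mult_right:
  assumes "op_norm_le n (\<lambda>i j. Q j i) K"
  shows "frob_sq n (\<lambda>i j. \<Sum>k<n. E i k * Q k j) \<le> K\<^sup>2 * frob_sq n E"
proof -
  have "frob_sq n (\<lambda>i j. \<Sum>k<n. E i k * Q k j) = (\<Sum>i<n. \<Sum>j<n. (matvec n (\<lambda>i j. Q j i) (E i) j)\<^sup>2)"
    unfolding frob_sq_def matvec_def by (simp add: mult.commute)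
  also have "\<dots> \<le> (\<Sum>i<n. K\<^sup>2 * (\<Sum>k<n. (E i k)\<^sup>2))"
    by (intro sum_mono op_norm_le_sq assms)
  also have "\<dots> = K\<^sup>2 * frob_sq n E"
    unfolding frob_sq_def by (simp add: sum_distrib_left)
  finally show ?thesis .
qed

lemma matvec_matvec: "matvec n A (matvec n A' x) i = (\<Sum>j<n. (\<Sum>k<n. A i k * A' k j) * x j)"
  unfolding matvec_def sum_distrib_left sum_distrib_right
  by (subst sum.swap) (simp add: mult.assoc)

section \<open>Leave-one-out matrices\<close>

text \<open>
  A symmetric matrix \<open>C\<close> with unit diagonal and spectrum in \<open>[l, L]\<close>, with inverse \<open>R\<close>. A one-sided
  inverse is assumed because the other side follows by symmetry.
\<close>
locale correlation_matrix =
  fixes n :: nat and C R :: "nat \<Rightarrow> nat \<Rightarrow> real" and l L :: real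
  assumes sym: "\<And>i j. i < n \<Longrightarrow> j < n \<Longrightarrow> C i j = C j i"
    and diag: "\<And>i. i < n \<Longrightarrow> C i i = 1"
    and l: "0 < l" and L: "0 < L"
    and coercive: "\<And>x. l * (\<Sum>i<n. (x i)\<^sup>2) \<le> (\<Sum>i<n. x i * matvec n C x i)"
    and bounded: "op_norm_le n C L"
    and CR: "\<And>i j. i < n \<Longrightarrow> j < n \<Longrightarrow> (\<Sum>k<n. C i k * R k j) = (if i = j then 1 else 0)"
begin

lemma R_sym: assumes "i < n" "j < n" shows "R i j = R j i"
proof -
  have "(\<Sum>k<n. \<Sum>m<n. R k i * C k m * R m j) = (\<Sum>k<n. R k i * (\<Sum>m<n. C k m * R m j))"
    by (simp add: sum_distrib_left mult.assoc)
  also have "\<dots> = (\<Sum>k<n. R k i * (if k = j then 1 else 0))"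
    by (intro sum.cong) (auto simp: CR assms)
  also have "\<dots> = R j i" using assms by (simp add: sum.delta if_distrib cong: if_cong)
  finally have 1: "(\<Sum>k<n. \<Sum>m<n. R k i * C k m * R m j) = R j i" .
  have "(\<Sum>k<n. \<Sum>m<n. R k i * C k m * R m j) = (\<Sum>m<n. (\<Sum>k<n. R k i * C m k) * R m j)"
    by (subst sum.swap) (auto simp: sum_distrib_right sum_distrib_left sym mult_ac intro!: sum.cong)
  also have "\<dots> = (\<Sum>m<n. (if m = i then 1 else 0) * R m j)"
    using CR[OF _ assms(1)] by (intro sum.cong) (auto simp: mult.commute)
  also have "\<dots> = R i j" using assms by (simp add: sum.delta if_distrib if_distribR cong: if_cong)
  finally show ?thesis using 1 by simp
qed

lemma RC: assumes "i < n" "j < n" shows "(\<Sum>k<n. R i k * C k j) = (if i = j then 1 else 0)"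
proof -
  have "(\<Sum>k<n. R i k * C k j) = (\<Sum>k<n. C j k * R k i)"
    by (intro sum.cong) (auto simp: sym R_sym assms)
  then show ?thesis using CR[OF assms(2,1)] by auto
qed

lemma matvec_C_R: "i < n \<Longrightarrow> matvec n C (matvec n R x) i = x i"
  unfolding matvec_matvec by (simp add: CR mult_delta_left)

lemma nrm_C_R: "nrm n (matvec n C (matvec n R x)) = nrm n x"
  by (rule L2_set_cong) (auto simp: matvec_C_R)

lemma l_nrm: "l * nrm n x \<le> nrm n (matvec n C x)"
proof (cases "nrm n x = 0")
  case False
  then have p: "nrm n x > 0" using L2_set_nonneg[of x "{..<n}"] by linarith
  have "l * (nrm n x)\<^sup>2 \<le> (\<Sum>i<n. x i * matvec n C x i)" using coercive[of x] by (simp add: nrm_sq)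
  also have "\<dots> \<le> nrm n x * nrm n (matvec n C x)" using dot_le_nrm[where n=n and x=x and y="matvec n C x"] by linarith
  finally have "(l * nrm n x) * nrm n x \<le> nrm n (matvec n C x) * nrm n x"
    by (simp add: power2_eq_square mult_ac)
  then show ?thesis using p by simp
qed simp

lemma R_bound: "nrm n (matvec n R x) \<le> 1 / l * nrm n x"
  using l_nrm[of "matvec n R x"] l unfolding nrm_C_R by (simp add: field_simps)

lemma nrm_unit: "i < n \<Longrightarrow> nrm n (\<lambda>j. if j = i then 1 else 0) = 1"
  unfolding L2_set_def by (simp add: if_distrib[of "\<lambda>x. x\<^sup>2"] cong: if_cong)

lemma matvec_unit: "i < n \<Longrightarrow> matvec n A (\<lambda>j. if j = i then 1 else 0) k = A k i"
  unfolding matvec_def by (simp add: if_distrib sum.delta cong: if_cong)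

lemma R_diag_upper: assumes i: "i < n" shows "R i i \<le> 1 / l"
proof -
  let ?e = "\<lambda>j. if j = i then 1 else (0::real)"
  have "R i i = (\<Sum>k<n. ?e k * matvec n R ?e k)"
    using i by (simp add: matvec_unit if_distribR if_distrib sum.delta cong: if_cong)
  also have "\<dots> \<le> nrm n ?e * nrm n (matvec n R ?e)" using dot_le_nrm[where n=n and x="?e" and y="matvec n R ?e"] by linarith
  also have "\<dots> \<le> 1 / l" using R_bound[of ?e] nrm_unit[OF i] by simp
  finally show ?thesis .
qed

text \<open>
  With \<open>y = R e\<^sub>i\<close>, the entry \<open>R\<^sub>i\<^sub>i = y \<bullet> C y\<close> is at least \<open>l \<parallel>y\<parallel>\<^sup>2\<close>, and \<open>1 = \<parallel>C y\<parallel> \<le> L \<parallel>y\<parallel>\<close>.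
\<close>
lemma R_diag_lower: assumes i: "i < n" shows "l / L\<^sup>2 \<le> R i i"
proof -
  let ?e = "\<lambda>j. if j = i then 1 else (0::real)"
  let ?y = "matvec n R ?e"
  have "R i i = (\<Sum>k<n. ?y k * ?e k)"
    using i by (simp add: matvec_unit if_distribR if_distrib sum.delta cong: if_cong)
  also have "\<dots> = (\<Sum>k<n. ?y k * matvec n C ?y k)"
    by (intro sum.cong) (auto simp: matvec_C_R)
  finally have 1: "R i i \<ge> l * (nrm n ?y)\<^sup>2" using coercive[of ?y] by (simp add: nrm_sq)
  have "1 \<le> L * nrm n ?y"
    using op_norm_leD[OF bounded, of ?y] unfolding nrm_C_R nrm_unit[OF i] .
  then have "1 / L \<le> nrm n ?y" using L by (simp add: field_simps)
  then have "(1 / L)\<^sup>2 \<le> (nrm n ?y)\<^sup>2" by (rule power_mono) (use L in auto)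
  then have "l * (1 / L)\<^sup>2 \<le> l * (nrm n ?y)\<^sup>2" using l by (intro mult_left_mono) auto
  with 1 show ?thesis by (simp add: power_divide)
qed

lemma R_diag_pos: "i < n \<Longrightarrow> 0 < R i i"
  using R_diag_lower[of i] l L by (smt (verit) divide_pos_pos zero_less_power)

lemma inverse_R_diag: assumes "i < n" shows "1 / R i i \<le> L\<^sup>2 / l"
  using R_diag_lower[OF assms] R_diag_pos[OF assms] l L by (simp add: field_simps)

text \<open>
  Row \<open>i\<close> applied to the observations gives the error of predicting observation \<open>i\<close> from the others.
\<close>
definition loo :: "nat \<Rightarrow> nat \<Rightarrow> real" where "loo i j = R i j / R i i"

lemma matvec_loo: "matvec n loo x i = matvec n R x i / R i i"
  unfolding matvec_def loo_def by (simp add: sum_divide_distrib)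

lemma loo_bound: "op_norm_le n loo (L\<^sup>2 / l\<^sup>2)"
  unfolding op_norm_le_def
proof
  fix x
  have "nrm n (matvec n loo x) \<le> L\<^sup>2 / l * nrm n (matvec n R x)"
  proof (rule nrm_mono_abs)
    fix i assume i: "i < n"
    have "\<bar>matvec n loo x i\<bar> = (1 / R i i) * \<bar>matvec n R x i\<bar>"
      using R_diag_pos[OF i] by (simp add: matvec_loo)
    also have "\<dots> \<le> L\<^sup>2 / l * \<bar>matvec n R x i\<bar>" by (intro mult_right_mono inverse_R_diag i) auto
    finally show "\<bar>matvec n loo x i\<bar> \<le> L\<^sup>2 / l * \<bar>matvec n R x i\<bar>" .
  qed (use l in auto)
  also have "\<dots> \<le> L\<^sup>2 / l * (1 / l * nrm n x)"
    using l by (intro mult_left_mono R_bound) auto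
  finally show "nrm n (matvec n loo x) \<le> L\<^sup>2 / l\<^sup>2 * nrm n x" by (simp add: power2_eq_square)
qed

lemma CD_bound: "op_norm_le n (\<lambda>i j. C i j * R j j) (L / l)"
  unfolding op_norm_le_def
proof
  fix x
  have "matvec n (\<lambda>i j. C i j * R j j) x = matvec n C (\<lambda>j. R j j * x j)"
    unfolding matvec_def by (auto simp: mult_ac)
  then have "nrm n (matvec n (\<lambda>i j. C i j * R j j) x) \<le> L * nrm n (\<lambda>j. R j j * x j)"
    using op_norm_leD[OF bounded] by simp
  also have "nrm n (\<lambda>j. R j j * x j) \<le> 1 / l * nrm n x"
    by (rule nrm_mono_abs) (use l R_diag_pos[THEN less_imp_le] mult_right_mono[OF R_diag_upper abs_ge_zero] in \<open>auto simp: abs_mult\<close>)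
  finally show "nrm n (matvec n (\<lambda>i j. C i j * R j j) x) \<le> L / l * nrm n x"
    using L by (simp add: mult_left_mono field_simps)
qed

lemma DC_bound: "op_norm_le n (\<lambda>i j. C j i * R i i) (L / l)"
  unfolding op_norm_le_def
proof
  fix x
  have "nrm n (matvec n (\<lambda>i j. C j i * R i i) x) \<le> 1 / l * nrm n (matvec n C x)"
  proof (rule nrm_mono_abs)
    fix i assume i: "i < n"
    have "matvec n (\<lambda>i j. C j i * R i i) x i = R i i * matvec n C x i"
      unfolding matvec_def sum_distrib_left by (rule sum.cong) (auto simp: sym i mult_ac)
    then show "\<bar>matvec n (\<lambda>i j. C j i * R i i) x i\<bar> \<le> 1 / l * \<bar>matvec n C x i\<bar>"
      using R_diag_pos[OF i] mult_right_mono[OF R_diag_upper[OF i], of "\<bar>matvec n C x i\<bar>"] by (simp add: abs_mult)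
  qed (use l in auto)
  also have "\<dots> \<le> 1 / l * (L * nrm n x)"
    using l by (intro mult_left_mono op_norm_leD[OF bounded]) auto
  finally show "nrm n (matvec n (\<lambda>i j. C j i * R i i) x) \<le> L / l * nrm n x" by simp
qed

lemma col_sq: assumes j: "j < n" shows "(\<Sum>i<n. (C i j)\<^sup>2) \<le> L\<^sup>2"
  using op_norm_le_sq[OF bounded, of "\<lambda>k. if k = j then 1 else 0"] j
  by (simp add: matvec_unit if_distrib[of "\<lambda>x. x\<^sup>2"] cong: if_cong)

lemma CD_loo: assumes "i < n" "j < n"
  shows "(\<Sum>k<n. C i k * R k k * loo k j) = (if i = j then 1 else 0)"
proof -
  have "(\<Sum>k<n. C i k * R k k * loo k j) = (\<Sum>k<n. C i k * R k j)"
    by (intro sum.cong) (use R_diag_pos in \<open>force simp: loo_def\<close>)+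
  then show ?thesis using CR[OF assms] by simp
qed

lemma loo_CD: assumes "i < n" "j < n"
  shows "(\<Sum>k<n. loo i k * (C k j * R j j)) = (if i = j then 1 else 0)"
proof -
  have "(\<Sum>k<n. loo i k * (C k j * R j j)) = (\<Sum>k<n. R i k * C k j) * R j j / R i i"
    by (simp add: loo_def sum_distrib_right sum_divide_distrib mult.assoc)
  then show ?thesis using RC[OF assms] R_diag_pos[OF assms(1)] by auto
qed

lemma C_loo: assumes "i < n" "j < n"
  shows "(\<Sum>k<n. C i k * loo j k) = (if i = j then 1 / R j j else 0)"
proof -
  have "(\<Sum>k<n. C i k * loo j k) = (\<Sum>k<n. C i k * R k j) / R j j"
    unfolding sum_divide_distrib by (intro sum.cong) (auto simp: loo_def R_sym assms)
  then show ?thesis using CR[OF assms] by simp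
qed

lemma loo_diag: "i < n \<Longrightarrow> loo i i = 1"
  using R_diag_pos[of i] by (simp add: loo_def)

end

text \<open>
  In identifiability arguments the index 0 refers to the truth and 1 to a candidate; in continuity
  arguments the two are interchangeable.
\<close>
locale two_correlation_matrices =
  c0: correlation_matrix n C0 R0 l L + c1: correlation_matrix n C1 R1 l L
  for n C0 R0 C1 R1 l L
begin

definition loo_diff where "loo_diff i j = c1.loo i j - c0.loo i j"

lemma loo_diff_diag: "i < n \<Longrightarrow> loo_diff i i = 0"
  by (simp add: loo_diff_def c0.loo_diag c1.loo_diag)

text \<open>
  The quadratic form of \<open>C0\<close> at row \<open>i\<close> of the candidate matrix is expanded around row \<open>i\<close> of the true
  one. The mixed term pairs the row difference, which vanishes at \<open>i\<close>, with a multiple of the \<open>i\<close>-th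
  unit vector. Probabilistically, the best linear predictor has error orthogonal to all the
  other observations.
\<close>
lemma excess_row:
  assumes i: "i < n"
  shows "(\<Sum>j<n. c0.loo i j * matvec n C0 (c0.loo i) j) + l * (\<Sum>j<n. (loo_diff i j)\<^sup>2)
       \<le> (\<Sum>j<n. c1.loo i j * matvec n C0 (c1.loo i) j)"
proof -
  \<comment> \<open>Row \<open>i\<close> of \<open>C0\<close> times the transposed true matrix is a multiple of the unit vector, so \<open>z\<close> below kills the mixed terms.\<close>
  have mvloo: "matvec n C0 (c0.loo i) j = (if j = i then 1 / R0 i i else 0)" if "j < n" for j
    unfolding matvec_def using c0.C_loo[OF that i] by simp
  have loo1: "c1.loo i = (\<lambda>j. c0.loo i j + loo_diff i j)" by (auto simp: loo_diff_def)
  have lin: "matvec n C0 (c1.loo i) j = matvec n C0 (c0.loo i) j + matvec n C0 (loo_diff i) j" for j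
    unfolding loo1 by (simp add: matvec_def algebra_simps sum.distrib)
  have swap: "(\<Sum>j<n. c0.loo i j * matvec n C0 (loo_diff i) j) = (\<Sum>j<n. loo_diff i j * matvec n C0 (c0.loo i) j)"
    unfolding matvec_def sum_distrib_left
    by (subst sum.swap) (auto intro!: sum.cong simp: c0.sym mult_ac)
  have z: "(\<Sum>j<n. loo_diff i j * matvec n C0 (c0.loo i) j) = 0"
    by (rule sum.neutral) (auto simp: mvloo loo_diff_diag i)
  have "(\<Sum>j<n. c1.loo i j * matvec n C0 (c1.loo i) j)
      = (\<Sum>j<n. c0.loo i j * matvec n C0 (c0.loo i) j) + (\<Sum>j<n. loo_diff i j * matvec n C0 (c0.loo i) j)
        + ((\<Sum>j<n. c0.loo i j * matvec n C0 (loo_diff i) j) + (\<Sum>j<n. loo_diff i j * matvec n C0 (loo_diff i) j))"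
    unfolding lin by (subst loo1) (simp add: algebra_simps sum.distrib)
  also have "\<dots> = (\<Sum>j<n. c0.loo i j * matvec n C0 (c0.loo i) j) + (\<Sum>j<n. loo_diff i j * matvec n C0 (loo_diff i) j)"
    using swap z by simp
  finally show ?thesis using c0.coercive[of "loo_diff i"] by simp
qed

lemma excess:
  "(\<Sum>i<n. \<Sum>j<n. c0.loo i j * matvec n C0 (c0.loo i) j) + l * frob_sq n loo_diff
    \<le> (\<Sum>i<n. \<Sum>j<n. c1.loo i j * matvec n C0 (c1.loo i) j)"
proof -
  have "(\<Sum>i<n. (\<Sum>j<n. c0.loo i j * matvec n C0 (c0.loo i) j) + l * (\<Sum>j<n. (loo_diff i j)\<^sup>2))
      \<le> (\<Sum>i<n. \<Sum>j<n. c1.loo i j * matvec n C0 (c1.loo i) j)"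
    using excess_row by (intro sum_mono) auto
  then show ?thesis unfolding frob_sq_def by (simp add: sum.distrib sum_distrib_left)
qed

text \<open>
  This is \<open>X - Y = - X (X\<^sup>-\<^sup>1 - Y\<^sup>-\<^sup>1) Y\<close> for the inverses \<open>X = C1 D1\<close> and \<open>Y = C0 D0\<close> of the two
  leave-one-out matrices.
\<close>
lemma CD_diff:
  assumes "i < n" "j < n"
  shows "C1 i j * R1 j j - C0 i j * R0 j j
       = - (\<Sum>m<n. (\<Sum>k<n. (C1 i k * R1 k k) * loo_diff k m) * (C0 m j * R0 j j))"
proof -
  have a: "(\<Sum>k<n. (C1 i k * R1 k k) * loo_diff k m)
       = (if i = m then 1 else 0) - (\<Sum>k<n. (C1 i k * R1 k k) * c0.loo k m)" if "m < n" for m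
    unfolding loo_diff_def by (simp add: right_diff_distrib sum_subtractf c1.CD_loo assms that)
  have "(\<Sum>m<n. (\<Sum>k<n. (C1 i k * R1 k k) * loo_diff k m) * (C0 m j * R0 j j))
      = (\<Sum>m<n. (if i = m then 1 else 0) * (C0 m j * R0 j j))
        - (\<Sum>m<n. (\<Sum>k<n. (C1 i k * R1 k k) * c0.loo k m) * (C0 m j * R0 j j))"
    by (simp add: a left_diff_distrib sum_subtractf)
  also have "(\<Sum>m<n. (if i = m then 1 else 0) * (C0 m j * R0 j j)) = C0 i j * R0 j j"
    using assms by (simp add: mult_delta_left)
  also have "(\<Sum>m<n. (\<Sum>k<n. (C1 i k * R1 k k) * c0.loo k m) * (C0 m j * R0 j j))
     = (\<Sum>k<n. (C1 i k * R1 k k) * (\<Sum>m<n. c0.loo k m * (C0 m j * R0 j j)))"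
    unfolding sum_distrib_left sum_distrib_right
    by (subst sum.swap) (simp add: mult.assoc)
  also have "\<dots> = (\<Sum>k<n. (C1 i k * R1 k k) * (if k = j then 1 else 0))"
    by (intro sum.cong) (auto simp: c0.loo_CD assms)
  also have "\<dots> = C1 i j * R1 j j"
    using assms by (simp add: if_distrib sum.delta cong: if_cong)
  finally show ?thesis by simp
qed

lemma frob_sq_CD_diff: "frob_sq n (\<lambda>i j. C1 i j * R1 j j - C0 i j * R0 j j) \<le> (L / l) ^ 4 * frob_sq n loo_diff"
proof -
  have "frob_sq n (\<lambda>i j. C1 i j * R1 j j - C0 i j * R0 j j)
      = frob_sq n (\<lambda>i j. \<Sum>m<n. (\<Sum>k<n. (C1 i k * R1 k k) * loo_diff k m) * (C0 m j * R0 j j))"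
    unfolding frob_sq_def by (intro sum.cong refl) (auto simp: CD_diff)
  also have "\<dots> \<le> (L / l)\<^sup>2 * frob_sq n (\<lambda>i m. \<Sum>k<n. (C1 i k * R1 k k) * loo_diff k m)"
    by (rule frob_sq_mult_right) (rule c0.DC_bound)
  also have "\<dots> \<le> (L / l)\<^sup>2 * ((L / l)\<^sup>2 * frob_sq n loo_diff)"
    by (intro mult_left_mono frob_sq_mult_left c1.CD_bound) auto
  finally show ?thesis by (simp add: power2_eq_square power4_eq_xxxx mult.assoc)
qed

text \<open>
  The diagonal of \<open>F = C1 D1 - C0 D0\<close> is \<open>D1 - D0\<close>, since both correlation matrices have unit diagonal.
  So \<open>F\<close> controls the difference of the scalings, and after dividing by \<open>D1\<close> also \<open>C1 - C0\<close>.
\<close>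
lemma frob_sq_C_diff:
  "frob_sq n (\<lambda>i j. C1 i j - C0 i j) \<le> 2 * (L\<^sup>2 / l)\<^sup>2 * (1 + L\<^sup>2) * (L / l) ^ 4 * frob_sq n loo_diff"
proof -
  define F where "F i j = C1 i j * R1 j j - C0 i j * R0 j j" for i j
  have pt: "(C1 i j - C0 i j)\<^sup>2 \<le> 2 * (L\<^sup>2 / l)\<^sup>2 * ((F i j)\<^sup>2 + (C0 i j)\<^sup>2 * (F j j)\<^sup>2)"
    if "i < n" "j < n" for i j
  proof -
    have p: "R1 j j > 0" using c1.R_diag_pos that by auto
    have d: "F j j = R1 j j - R0 j j" by (simp add: F_def c0.diag c1.diag that)
    have "C1 i j - C0 i j = (1 / R1 j j) * (F i j - C0 i j * F j j)"
      unfolding d using p by (simp add: F_def field_simps)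
    then have "(C1 i j - C0 i j)\<^sup>2 = (1 / R1 j j)\<^sup>2 * (F i j - C0 i j * F j j)\<^sup>2"
      by (simp add: power_mult_distrib power_divide)
    also have "\<dots> \<le> (L\<^sup>2 / l)\<^sup>2 * (2 * ((F i j)\<^sup>2 + (C0 i j)\<^sup>2 * (F j j)\<^sup>2))"
    proof (rule mult_mono)
      show "(1 / R1 j j)\<^sup>2 \<le> (L\<^sup>2 / l)\<^sup>2"
        using c1.inverse_R_diag[OF that(2)] p by (intro power_mono) auto
      have "0 \<le> (F i j + C0 i j * F j j)\<^sup>2" by simp
      then show "(F i j - C0 i j * F j j)\<^sup>2 \<le> 2 * ((F i j)\<^sup>2 + (C0 i j)\<^sup>2 * (F j j)\<^sup>2)"
        by (simp add: power2_sum power2_diff power_mult_distrib)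
    qed auto
    finally show ?thesis by (simp only: mult.assoc mult.left_commute[of 2])
  qed
  have "frob_sq n (\<lambda>i j. C1 i j - C0 i j)
     \<le> (\<Sum>i<n. \<Sum>j<n. 2 * (L\<^sup>2 / l)\<^sup>2 * ((F i j)\<^sup>2 + (C0 i j)\<^sup>2 * (F j j)\<^sup>2))"
    unfolding frob_sq_def by (intro sum_mono) (auto intro!: pt)
  also have "\<dots> = 2 * (L\<^sup>2 / l)\<^sup>2 * (frob_sq n F + (\<Sum>j<n. (\<Sum>i<n. (C0 i j)\<^sup>2) * (F j j)\<^sup>2))"
  proof -
    have "(\<Sum>i<n. \<Sum>j<n. (C0 i j)\<^sup>2 * (F j j)\<^sup>2) = (\<Sum>j<n. (\<Sum>i<n. (C0 i j)\<^sup>2) * (F j j)\<^sup>2)"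
      by (subst sum.swap) (simp add: sum_distrib_right)
    then show ?thesis
      unfolding frob_sq_def by (simp add: sum_distrib_left[symmetric] sum.distrib)
  qed
  also have "\<dots> \<le> 2 * (L\<^sup>2 / l)\<^sup>2 * (frob_sq n F + L\<^sup>2 * frob_sq n F)"
  proof -
    have "(\<Sum>j<n. (\<Sum>i<n. (C0 i j)\<^sup>2) * (F j j)\<^sup>2) \<le> (\<Sum>j<n. L\<^sup>2 * (F j j)\<^sup>2)"
      by (intro sum_mono mult_right_mono c0.col_sq) auto
    also have "\<dots> \<le> (\<Sum>j<n. L\<^sup>2 * (\<Sum>k<n. (F j k)\<^sup>2))"
      by (intro sum_mono mult_left_mono member_le_sum[where f="\<lambda>k. (F _ k)\<^sup>2"]) auto
    also have "\<dots> = L\<^sup>2 * frob_sq n F" unfolding frob_sq_def by (simp add: sum_distrib_left)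
    finally show ?thesis by (intro mult_left_mono) auto
  qed
  also have "\<dots> = 2 * (L\<^sup>2 / l)\<^sup>2 * (1 + L\<^sup>2) * frob_sq n F" by (simp add: algebra_simps)
  also have "\<dots> \<le> 2 * (L\<^sup>2 / l)\<^sup>2 * (1 + L\<^sup>2) * ((L / l) ^ 4 * frob_sq n loo_diff)"
    using frob_sq_CD_diff unfolding F_def by (intro mult_left_mono) auto
  finally show ?thesis by simp
qed

text \<open>
  The resolvent identity \<open>C1 (R1 - R0) = - (C1 - C0) R0\<close>.
\<close>
lemma R_diff_bound:
  assumes d: "op_norm_le n (\<lambda>i j. C1 i j - C0 i j) \<delta>" and "0 \<le> \<delta>"
  shows "nrm n (\<lambda>i. matvec n R1 x i - matvec n R0 x i) \<le> \<delta> / l\<^sup>2 * nrm n x"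
proof -
  define u where "u i = matvec n R1 x i - matvec n R0 x i" for i
  have "matvec n C1 u i = - matvec n (\<lambda>i j. C1 i j - C0 i j) (matvec n R0 x) i" if i: "i < n" for i
  proof -
    have "matvec n C1 u i = matvec n C1 (matvec n R1 x) i - matvec n C1 (matvec n R0 x) i"
      unfolding u_def matvec_def[of n C1] by (simp add: right_diff_distrib sum_subtractf)
    also have "\<dots> = matvec n C0 (matvec n R0 x) i - matvec n C1 (matvec n R0 x) i"
      using c0.matvec_C_R[OF i] c1.matvec_C_R[OF i] by simp
    also have "\<dots> = - matvec n (\<lambda>i j. C1 i j - C0 i j) (matvec n R0 x) i"
      unfolding matvec_def[of n C0] matvec_def[of n C1] matvec_def[of n "\<lambda>i j. C1 i j - C0 i j"]
      by (simp add: left_diff_distrib sum_subtractf)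
    finally show ?thesis .
  qed
  then have "nrm n (matvec n C1 u) \<le> 1 * nrm n (matvec n (\<lambda>i j. C1 i j - C0 i j) (matvec n R0 x))"
    by (intro nrm_mono_abs) auto
  also have "\<dots> \<le> \<delta> * nrm n (matvec n R0 x)" using op_norm_leD[OF d] by simp
  also have "\<dots> \<le> \<delta> * (1 / l * nrm n x)" by (intro mult_left_mono c0.R_bound assms)
  finally have "l * nrm n u \<le> \<delta> * (1 / l * nrm n x)" using c1.l_nrm[of u] by linarith
  then show ?thesis using c0.l unfolding u_def by (simp add: field_simps power2_eq_square)
qed

lemma R_diag_diff:
  assumes d: "op_norm_le n (\<lambda>i j. C1 i j - C0 i j) \<delta>" and "0 \<le> \<delta>" and i: "i < n"
  shows "\<bar>R1 i i - R0 i i\<bar> \<le> \<delta> / l\<^sup>2"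
proof -
  let ?e = "\<lambda>j. if j = i then 1 else (0::real)"
  have "\<bar>R1 i i - R0 i i\<bar> = \<bar>matvec n R1 ?e i - matvec n R0 ?e i\<bar>"
    by (simp add: c0.matvec_unit i)
  also have "\<dots> \<le> nrm n (\<lambda>i. matvec n R1 ?e i - matvec n R0 ?e i)"
    using member_le_L2_set[of "{..<n}" i "\<lambda>i. \<bar>matvec n R1 ?e i - matvec n R0 ?e i\<bar>"] i
    unfolding L2_set_def by simp
  also have "\<dots> \<le> \<delta> / l\<^sup>2" using R_diff_bound[OF assms(1,2), of ?e] c0.nrm_unit[OF i] by simp
  finally show ?thesis .
qed

definition cv_lipschitz :: real where "cv_lipschitz = (L\<^sup>2 / l + L ^ 4 / l ^ 3) / l\<^sup>2 * (2 * (L\<^sup>2 / l\<^sup>2))"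

lemma loo_diff_bound:
  assumes d: "op_norm_le n (\<lambda>i j. C1 i j - C0 i j) \<delta>" and "0 \<le> \<delta>"
  shows "nrm n (\<lambda>i. matvec n c1.loo x i - matvec n c0.loo x i) \<le> (L\<^sup>2 / l + L ^ 4 / l ^ 3) / l\<^sup>2 * \<delta> * nrm n x"
proof -
  define a where "a i = (1 / R1 i i) * (matvec n R1 x i - matvec n R0 x i)" for i
  define b where "b i = (R0 i i - R1 i i) * (1 / R1 i i) * (1 / R0 i i) * matvec n R0 x i" for i
  have eq: "matvec n c1.loo x i - matvec n c0.loo x i = a i + b i" if "i < n" for i
    unfolding c0.matvec_loo c1.matvec_loo a_def b_def
    using c0.R_diag_pos[OF that] c1.R_diag_pos[OF that] by (simp add: field_simps)
  have "nrm n (\<lambda>i. matvec n c1.loo x i - matvec n c0.loo x i) = nrm n (\<lambda>i. a i + b i)"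
    by (rule L2_set_cong) (auto simp: eq)
  also have "\<dots> \<le> nrm n a + nrm n b" by (rule L2_set_triangle_ineq)
  also have "nrm n a \<le> L\<^sup>2 / l * nrm n (\<lambda>i. matvec n R1 x i - matvec n R0 x i)"
  proof (rule nrm_mono_abs)
    fix i assume i: "i < n"
    show "\<bar>a i\<bar> \<le> L\<^sup>2 / l * \<bar>matvec n R1 x i - matvec n R0 x i\<bar>"
      using c1.inverse_R_diag[OF i] c1.R_diag_pos[OF i] unfolding a_def abs_mult
      by (intro mult_right_mono) auto
  qed (use c0.l in auto)
  also have "\<dots> \<le> L\<^sup>2 / l * (\<delta> / l\<^sup>2 * nrm n x)"
    using c0.l by (intro mult_left_mono R_diff_bound assms) auto
  also have "nrm n b \<le> (\<delta> / l\<^sup>2 * (L\<^sup>2 / l) * (L\<^sup>2 / l)) * nrm n (matvec n R0 x)"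
  proof (rule nrm_mono_abs)
    fix i assume i: "i < n"
    show "\<bar>b i\<bar> \<le> (\<delta> / l\<^sup>2 * (L\<^sup>2 / l) * (L\<^sup>2 / l)) * \<bar>matvec n R0 x i\<bar>"
      unfolding b_def abs_mult
      using c1.inverse_R_diag[OF i] c1.R_diag_pos[OF i] c0.inverse_R_diag[OF i] c0.R_diag_pos[OF i]
        R_diag_diff[OF assms i] c0.l assms
      by (intro mult_right_mono mult_mono) auto
  qed (use c0.l assms in auto)
  also have "\<dots> \<le> (\<delta> / l\<^sup>2 * (L\<^sup>2 / l) * (L\<^sup>2 / l)) * (1 / l * nrm n x)"
    using c0.l assms by (intro mult_left_mono c0.R_bound) auto
  also have "L\<^sup>2 / l * (\<delta> / l\<^sup>2 * nrm n x) + (\<delta> / l\<^sup>2 * (L\<^sup>2 / l) * (L\<^sup>2 / l)) * (1 / l * nrm n x)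
     = (L\<^sup>2 / l + L ^ 4 / l ^ 3) / l\<^sup>2 * \<delta> * nrm n x"
    using c0.l by (simp add: field_simps eval_nat_numeral)
  finally show ?thesis by linarith
qed

lemma cv_diff_bound:
  assumes d: "op_norm_le n (\<lambda>i j. C1 i j - C0 i j) \<delta>" and "0 \<le> \<delta>"
  shows "\<bar>(\<Sum>i<n. (matvec n c1.loo x i)\<^sup>2) - (\<Sum>i<n. (matvec n c0.loo x i)\<^sup>2)\<bar> \<le> cv_lipschitz * \<delta> * (\<Sum>i<n. (x i)\<^sup>2)"
proof -
  let ?u = "matvec n c1.loo x" and ?v = "matvec n c0.loo x"
  have "(\<Sum>i<n. (?u i)\<^sup>2) - (\<Sum>i<n. (?v i)\<^sup>2) = (\<Sum>i<n. (?u i - ?v i) * (?u i + ?v i))"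
    by (simp add: sum_subtractf[symmetric] power2_eq_square algebra_simps)
  then have "\<bar>(\<Sum>i<n. (?u i)\<^sup>2) - (\<Sum>i<n. (?v i)\<^sup>2)\<bar> \<le> nrm n (\<lambda>i. ?u i - ?v i) * nrm n (\<lambda>i. ?u i + ?v i)"
    using dot_le_nrm by metis
  also have "\<dots> \<le> ((L\<^sup>2 / l + L ^ 4 / l ^ 3) / l\<^sup>2 * \<delta> * nrm n x) * (2 * (L\<^sup>2 / l\<^sup>2) * nrm n x)"
  proof (rule mult_mono)
    have "nrm n (\<lambda>i. ?u i + ?v i) \<le> nrm n ?u + nrm n ?v" by (rule L2_set_triangle_ineq)
    also have "\<dots> \<le> 2 * (L\<^sup>2 / l\<^sup>2) * nrm n x"
      using op_norm_leD[OF c0.loo_bound, of x] op_norm_leD[OF c1.loo_bound, of x] by simp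
    finally show "nrm n (\<lambda>i. ?u i + ?v i) \<le> 2 * (L\<^sup>2 / l\<^sup>2) * nrm n x" .
  qed (use loo_diff_bound[OF assms] c0.l assms c0.L in auto)
  also have "\<dots> = cv_lipschitz * \<delta> * (nrm n x)\<^sup>2" unfolding cv_lipschitz_def by (simp add: power2_eq_square mult_ac)
  finally show ?thesis by (simp add: nrm_sq)
qed

end

section \<open>The criterion as the squared norm of the leave-one-out errors\<close>

lemma inv_mat_eqI:
  assumes A: "A \<in> carrier_mat n n" and B: "B \<in> carrier_mat n n" and AB: "A * B = 1\<^sub>m n"
  shows "inv_mat A = B"
proof -
  have "det A * det B = 1" using det_mult[OF A B] AB by simp
  then have "det A \<noteq> 0" by auto
  then have "A \<in> Units (ring_mat TYPE(real) n ())" by (rule det_non_zero_imp_unit[OF A])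
  then obtain X where X: "mat_inverse A = Some X" using mat_inverse(1)[OF A] by fastforce
  then have XA: "X * A = 1\<^sub>m n" "X \<in> carrier_mat n n" using mat_inverse(2)[OF A] by auto
  have "X = X * (A * B)" using XA(2) AB by simp
  also have "\<dots> = X * A * B" using A B XA(2) by (metis assoc_mult_mat)
  also have "\<dots> = B" using XA B by simp
  finally show ?thesis by (simp add: inv_mat_def X)
qed

lemma mat_mult_vec_eq: "Matrix.mat n n (\<lambda>(i, j). f i j) *\<^sub>v Matrix.vec n x = Matrix.vec n (matvec n f x)"
  by (rule eq_vecI) (auto simp: scalar_prod_def matvec_def lessThan_atLeast0)

text \<open>
  Coercivity makes the matrix injective, so its determinant is nonzero and Gaussian elimination
  produces an inverse.
\<close>
lemma coercive_right_inverse: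
  assumes l: "0 < l" and coercive: "\<And>x. l * (\<Sum>i<n. (x i)\<^sup>2) \<le> (\<Sum>i<n. x i * matvec n C x i)"
  obtains R where "\<And>i j. i < n \<Longrightarrow> j < n \<Longrightarrow> (\<Sum>k<n. C i k * R k j) = (if i = j then 1 else 0)"
proof -
  let ?A = "Matrix.mat n n (\<lambda>(i, j). C i j)"
  have A: "?A \<in> carrier_mat n n" by simp
  have "det ?A \<noteq> 0"
  proof
    assume "det ?A = 0"
    then obtain v where v: "v \<in> carrier_vec n" "v \<noteq> 0\<^sub>v n" "?A *\<^sub>v v = 0\<^sub>v n"
      using det_0_iff_vec_prod_zero_field[OF A] by auto
    define x where "x i = v $ i" for i
    have vx: "v = Matrix.vec n x" using v(1) by (auto simp: x_def)
    have "Matrix.vec n (matvec n C x) = 0\<^sub>v n" using v(3) unfolding vx mat_mult_vec_eq .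
    then have "matvec n C x i = 0" if "i < n" for i using that by (metis index_vec index_zero_vec(1))
    then have "l * (\<Sum>i<n. (x i)\<^sup>2) \<le> 0" using coercive[of x] by simp
    then have "(\<Sum>i<n. (x i)\<^sup>2) \<le> 0" using l by (simp add: mult_le_0_iff)
    then have "(\<Sum>i<n. (x i)\<^sup>2) = 0" by (intro antisym sum_nonneg) auto
    then have "\<forall>i<n. x i = 0" by (simp add: sum_nonneg_eq_0_iff)
    then have "v = 0\<^sub>v n" unfolding vx by (intro eq_vecI) auto
    with v(2) show False by simp
  qed
  then have "?A \<in> Units (ring_mat TYPE(real) n ())" by (rule det_non_zero_imp_unit[OF A])
  then obtain X where "mat_inverse ?A = Some X" using mat_inverse(1)[OF A] by fastforce
  then have X: "?A * X = 1\<^sub>m n" "X \<in> carrier_mat n n" using mat_inverse(2)[OF A] by auto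
  show thesis
  proof (rule that)
    fix i j assume ij: "i < n" "j < n"
    have "(?A * X) $$ (i, j) = (\<Sum>k<n. C i k * X $$ (k, j))"
      using ij X(2) by (auto simp: scalar_prod_def lessThan_atLeast0 intro!: sum.cong)
    then show "(\<Sum>k<n. C i k * (\<lambda>k j. X $$ (k, j)) k j) = (if i = j then 1 else 0)"
      unfolding X(1) using ij by simp
  qed
qed

lemma (in correlation_matrix) cv_criterion_eq:
  assumes c: "\<And>i j. i < n \<Longrightarrow> j < n \<Longrightarrow> c (s i - s j) = C i j"
  shows "cv_criterion c s n (Matrix.vec n y) = (\<Sum>i<n. (matvec n loo y i)\<^sup>2) / real n"
proof -
  define Rm where "Rm = Matrix.mat n n (\<lambda>(i, j). R i j)"
  define d where "d i j = (if i = j then 1 / R i i else 0)" for i j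
  define Dm where "Dm = Matrix.mat n n (\<lambda>(i, j). d i j)"
  have car: "Rm \<in> carrier_mat n n" "Dm \<in> carrier_mat n n" by (auto simp: Rm_def Dm_def)
  have inv: "inv_mat (kernel_mat c s n) = Rm"
  proof (rule inv_mat_eqI)
    show "kernel_mat c s n * Rm = 1\<^sub>m n"
      by (rule eq_matI) (auto simp: kernel_mat_def Rm_def scalar_prod_def c CR lessThan_atLeast0[symmetric] cong: sum.cong_simp)
  qed (auto simp: kernel_mat_def car)
  have invD: "inv_mat (diag_part Rm) = Dm"
  proof (rule inv_mat_eqI)
    show "diag_part Rm * Dm = 1\<^sub>m n"
    proof (rule eq_matI)
      fix i j assume "i < dim_row (1\<^sub>m n)" "j < dim_col (1\<^sub>m n)"
      then have ij: "i < n" "j < n" by auto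
      have "(diag_part Rm * Dm) $$ (i, j) = (\<Sum>k<n. (if i = k then R i k else 0) * d k j)"
        using ij by (auto simp: diag_part_def Dm_def Rm_def scalar_prod_def lessThan_atLeast0 intro!: sum.cong)
      also have "\<dots> = R i i * d i j" using ij by (simp add: mult_delta_left)
      also have "\<dots> = (if i = j then 1 else 0)" using R_diag_pos[OF ij(1)] by (auto simp: d_def)
      finally show "(diag_part Rm * Dm) $$ (i, j) = 1\<^sub>m n $$ (i, j)" using ij by simp
    qed (auto simp: diag_part_def Dm_def Rm_def)
  qed (auto simp: diag_part_def Rm_def car)
  define v where "v = Matrix.vec n y"
  have v: "v \<in> carrier_vec n" by (simp add: v_def)
  have mvd: "matvec n d z i = z i / R i i" if "i < n" for z i
    using that unfolding matvec_def d_def by (simp add: mult_delta_left)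
  have pow: "Dm ^\<^sub>m 2 = Dm * Dm" using car by (simp add: numeral_2_eq_2)
  have "(Rm * (Dm ^\<^sub>m 2) * Rm) *\<^sub>v v = Rm *\<^sub>v (Dm *\<^sub>v (Dm *\<^sub>v (Rm *\<^sub>v v)))"
    unfolding pow using car v by (simp add: assoc_mult_mat_vec[of _ n n _ n])
  also have "\<dots> = Matrix.vec n (matvec n R (matvec n d (matvec n d (matvec n R y))))"
    unfolding v_def Rm_def Dm_def mat_mult_vec_eq ..
  finally have q: "(Rm * (Dm ^\<^sub>m 2) * Rm) *\<^sub>v v = Matrix.vec n (matvec n R (matvec n d (matvec n d (matvec n R y))))" .
  define w where "w = matvec n d (matvec n d (matvec n R y))"
  have "scalar_prod v ((Rm * (Dm ^\<^sub>m 2) * Rm) *\<^sub>v v) = (\<Sum>i<n. y i * matvec n R w i)"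
    unfolding q unfolding v_def w_def by (auto simp: scalar_prod_def lessThan_atLeast0 intro!: sum.cong)
  also have "\<dots> = (\<Sum>i<n. matvec n R y i * w i)"
    unfolding matvec_def[of n R] sum_distrib_left sum_distrib_right
    by (subst sum.swap) (auto simp: R_sym mult_ac intro!: sum.cong)
  also have "\<dots> = (\<Sum>i<n. (matvec n loo y i)\<^sup>2)"
    by (intro sum.cong) (auto simp: w_def mvd matvec_loo power2_eq_square)
  finally show ?thesis unfolding cv_criterion_def inv Let_def invD v_def by simp
qed

section \<open>Sums over well-separated points\<close>

lemma well_separated_gap:
  fixes x :: "nat \<Rightarrow> real ^ 'd"
  assumes "well_separated x"
  obtains \<Delta> where "0 < \<Delta>" "\<And>i j. i \<noteq> j \<Longrightarrow> \<Delta> \<le> infnorm (x i - x j)"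
proof
  let ?I = "INF (i, j)\<in>{(i, j). i \<noteq> j}. infnorm (x i - x j)"
  show "0 < ?I" using assms by (simp add: well_separated_def)
  fix i j :: nat assume "i \<noteq> j"
  then have "?I \<le> (case (i, j) of (i, j) \<Rightarrow> infnorm (x i - x j))"
    by (intro cINF_lower) (auto intro!: bdd_belowI[of _ 0] simp: infnorm_pos_le)
  then show "?I \<le> infnorm (x i - x j)" by simp
qed

lemma infnorm_vec_less:
  fixes v :: "real ^ 'd"
  assumes "\<And>k. \<bar>v $ k\<bar> < b"
  shows "infnorm v < b"
proof -
  have "infnorm v \<in> (\<lambda>i. \<bar>v \<bullet> i\<bar>) ` Basis"
    unfolding infnorm_Max by (rule Max_in) auto
  then show ?thesis using assms by (auto simp: Basis_vec_def inner_axis)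
qed

text \<open>
  Decomposition into dyadic shells. Shells of width one would not do: bounding each of them by
  the number of sites in the enclosing ball loses a factor \<open>r\<close> in the summation.
\<close>
lemma dyadic_bound:
  assumes p: "0 < p" and r: "0 \<le> r" and M: "r < 2 ^ M"
  shows "1 / (1 + r powr p) \<le> (\<Sum>m\<le>M. 2 powr p * 2 powr (- real m * p) * (if r < 2 ^ m then 1 else 0))"
proof -
  define k where "k = (LEAST m. r < 2 ^ m)"
  have k: "r < 2 ^ k" unfolding k_def using M by (rule LeastI)
  have kM: "k \<le> M" unfolding k_def using M by (rule Least_le)
  have "1 / (1 + r powr p) \<le> 2 powr p * 2 powr (- real k * p)"
  proof (cases k)
    case 0
    have "1 / (1 + r powr p) \<le> 1" using add_pos_nonneg[of "1::real" "r powr p"]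
      by (simp add: divide_le_eq_1_pos)
    also have "1 \<le> 2 powr p" using p by (simp add: ge_one_powr_ge_zero)
    finally show ?thesis using 0 by simp
  next
    case (Suc k')
    then have "\<not> r < 2 ^ k'" using not_less_Least[of k' "\<lambda>m. r < 2 ^ m"] unfolding k_def[symmetric] by simp
    then have "(2 ^ k') powr p \<le> r powr p" using p by (intro powr_mono2) auto
    then have "2 powr (real k' * p) \<le> 1 + r powr p" by (simp add: powr_powr[symmetric] powr_realpow)
    then have "1 / (1 + r powr p) \<le> 1 / 2 powr (real k' * p)"
      by (intro divide_left_mono) (auto intro!: mult_pos_pos add_pos_nonneg)
    also have "\<dots> = 2 powr (- (real k' * p))" by (simp add: powr_minus_divide)
    also have "\<dots> = 2 powr p * 2 powr (- real k * p)"
      unfolding powr_add[symmetric] by (simp add: Suc algebra_simps)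
    finally show ?thesis .
  qed
  also have "\<dots> = (\<Sum>m\<in>{k}. 2 powr p * 2 powr (- real m * p) * (if r < 2 ^ m then 1 else 0))"
    using k by simp
  also have "\<dots> \<le> (\<Sum>m\<le>M. 2 powr p * 2 powr (- real m * p) * (if r < 2 ^ m then 1 else 0))"
    by (rule sum_mono2) (use kM in auto)
  finally show ?thesis .
qed

lemma exp_le_polynomial:
  fixes a p :: real
  assumes a: "0 < a" and p: "0 < p"
  obtains C where "0 < C" "\<And>r. 0 \<le> r \<Longrightarrow> exp (- a * r) \<le> C * (1 / (1 + r powr p))"
proof -
  obtain N :: nat where N: "p \<le> real N" using real_arch_simple by blast
  define C where "C = 2 + fact N / a ^ N"
  have C: "0 < C" unfolding C_def using a by (intro add_pos_pos) auto
  moreover have "exp (- a * r) \<le> C * (1 / (1 + r powr p))" if r: "0 \<le> r" for r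
  proof -
    have e1: "(a * r) ^ N / fact N \<le> exp (a * r)"
    proof -
      have "(a * r) ^ N /\<^sub>R fact N \<le> (\<Sum>k. (a * r) ^ k /\<^sub>R fact k)"
        using sum_le_suminf[OF summable_exp_generic[of "a * r"], of "{N}"] a r by simp
      then show ?thesis by (simp add: exp_def divide_inverse mult.commute)
    qed
    have "1 + r powr p \<le> 2 + r ^ N"
    proof (cases "r \<le> 1")
      case True
      then have "r powr p \<le> 1" using r p powr_le1 by simp
      then show ?thesis using r by (smt (verit) zero_le_power)
    next
      case False
      then have "r powr p \<le> r powr real N" using N by (intro powr_mono) auto
      then show ?thesis using False by (simp add: powr_realpow)
    qed
    also have "r ^ N \<le> fact N / a ^ N * exp (a * r)"
      using e1 a by (simp add: power_mult_distrib field_simps)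
    also have "2 \<le> 2 * exp (a * r)" using a r by simp
    finally have "1 + r powr p \<le> C * exp (a * r)" by (simp add: C_def algebra_simps)
    moreover have "0 < 1 + r powr p" by (simp add: add_pos_nonneg)
    ultimately show ?thesis by (simp add: field_simps exp_minus)
  qed
  ultimately show thesis by (rule that)
qed

text \<open>
  A quantitative form of \<^const>\<open>well_separated\<close>.
\<close>
locale separated =
  fixes x :: "nat \<Rightarrow> real ^ 'd" and \<Delta> :: real
  assumes gap_pos: "0 < \<Delta>" and gap: "\<And>i j. i \<noteq> j \<Longrightarrow> \<Delta> \<le> infnorm (x i - x j)"
begin

text \<open>
  Two sites in the same half-open grid cube of side \<open>\<Delta>\<close> are closer than \<open>\<Delta>\<close>, so rounding to the grid is
  injective, and it suffices to count the grid cubes that meet a cube of radius \<open>r\<close>.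
\<close>
lemma card_near:
  assumes r: "1 \<le> r"
  shows "real (card {j. j < n \<and> infnorm (z - x j) < r}) \<le> ((2 / \<Delta> + 2) * r) ^ CARD('d)"
proof -
  let ?J = "{j. j < n \<and> infnorm (z - x j) < r}"
  define h where "h j = (\<lambda>k::'d. \<lfloor>(x j - z) $ k / \<Delta>\<rfloor>)" for j
  let ?A = "{\<lfloor>- r / \<Delta>\<rfloor>..\<lfloor>r / \<Delta>\<rfloor>}"
  have inj: "inj_on h ?J"
  proof (rule inj_onI, rule ccontr)
    fix i j assume "h i = h j" "i \<noteq> j"
    have "\<bar>(x i - x j) $ k\<bar> < \<Delta>" for k
    proof -
      have "\<lfloor>(x i - z) $ k / \<Delta>\<rfloor> = \<lfloor>(x j - z) $ k / \<Delta>\<rfloor>"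
        using \<open>h i = h j\<close> unfolding h_def by metis
      then have "\<bar>(x i - z) $ k / \<Delta> - (x j - z) $ k / \<Delta>\<bar> < 1" by linarith
      also have "(x i - z) $ k / \<Delta> - (x j - z) $ k / \<Delta> = (x i - x j) $ k / \<Delta>"
        by (simp add: diff_divide_distrib)
      finally show ?thesis using gap_pos by (simp add: field_simps)
    qed
    then have "infnorm (x i - x j) < \<Delta>" by (rule infnorm_vec_less)
    with gap[OF \<open>i \<noteq> j\<close>] show False by simp
  qed
  have sub: "h ` ?J \<subseteq> PiE UNIV (\<lambda>_. ?A)"
  proof (clarsimp simp: h_def PiE_iff)
    fix j k assume "infnorm (z - x j) < r"
    moreover have "\<bar>(z - x j) $ k\<bar> \<le> infnorm (z - x j)"
      using Basis_le_infnorm[of "axis k 1" "z - x j"] by (simp add: inner_axis)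
    ultimately have "\<bar>(x j - z) $ k\<bar> \<le> r" by auto
    then have "- r / \<Delta> \<le> (x j $ k - z $ k) / \<Delta>" "(x j $ k - z $ k) / \<Delta> \<le> r / \<Delta>"
      using gap_pos by (intro divide_right_mono; auto)+
    then show "\<lfloor>- (r / \<Delta>)\<rfloor> \<le> \<lfloor>(x j $ k - z $ k) / \<Delta>\<rfloor> \<and> \<lfloor>(x j $ k - z $ k) / \<Delta>\<rfloor> \<le> \<lfloor>r / \<Delta>\<rfloor>"
      by (simp add: floor_mono)
  qed
  have "card ?J = card (h ` ?J)" by (rule card_image[OF inj, symmetric])
  also have "\<dots> \<le> card (PiE (UNIV :: 'd set) (\<lambda>_. ?A))"
    by (rule card_mono[OF _ sub]) (auto intro!: finite_PiE)
  also have "\<dots> = card ?A ^ CARD('d)" by (simp add: card_PiE)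
  finally have "real (card ?J) \<le> real (card ?A) ^ CARD('d)"
    by (metis of_nat_le_iff of_nat_power)
  also have "\<dots> \<le> ((2 / \<Delta> + 2) * r) ^ CARD('d)"
  proof (rule power_mono)
    have "0 < r / \<Delta>" using r gap_pos by simp
    then have "real (card ?A) \<le> 2 * (r / \<Delta>) + 2"
      unfolding card_atLeastAtMost_int minus_divide_left by linarith
    also have "\<dots> \<le> (2 / \<Delta> + 2) * r" using r by (simp add: algebra_simps)
    finally show "real (card ?A) \<le> (2 / \<Delta> + 2) * r" .
  qed simp
  finally show ?thesis .
qed

lemma polynomial_row_sums:
  assumes e: "0 < e"
  obtains K where "0 < K" "\<And>n z. (\<Sum>j<n. 1 / (1 + infnorm (z - x j) powr (real CARD('d) + e))) \<le> K"
proof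
  define p where "p = real CARD('d) + e"
  define c where "c = (2 / \<Delta> + 2) ^ CARD('d)"
  have c: "0 < c" unfolding c_def using gap_pos by (intro zero_less_power add_pos_pos) auto
  have q: "norm (2 powr (- e)) < 1" using e by (simp add: powr_less_one)
  define K where "K = 2 powr p * c * (1 / (1 - 2 powr (- e)))"
  show "0 < K" unfolding K_def using q c by simp
  fix n :: nat and z :: "real ^ 'd"
  obtain b where b: "\<And>j. j < n \<Longrightarrow> infnorm (z - x j) < b"
  proof
    fix j assume "j < n"
    then have "infnorm (z - x j) \<le> (\<Sum>j<n. infnorm (z - x j))"
      by (intro member_le_sum) (auto simp: infnorm_pos_le)
    then show "infnorm (z - x j) < (\<Sum>j<n. infnorm (z - x j)) + 1" by simp
  qed
  obtain M where "b < 2 ^ M" using real_arch_pow[of 2 b] by auto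
  with b have M: "infnorm (z - x j) < 2 ^ M" if "j < n" for j using that less_trans by blast
  have "(\<Sum>j<n. 1 / (1 + infnorm (z - x j) powr p))
    \<le> (\<Sum>j<n. \<Sum>m\<le>M. 2 powr p * 2 powr (- real m * p) * (if infnorm (z - x j) < 2 ^ m then 1 else 0))"
    by (intro sum_mono dyadic_bound) (use M e in \<open>auto simp: p_def infnorm_pos_le\<close>)
  also have "\<dots> = (\<Sum>m\<le>M. 2 powr p * 2 powr (- real m * p) * real (card {j. j < n \<and> infnorm (z - x j) < 2 ^ m}))"
    by (subst sum.swap) (simp add: sum_distrib_left[symmetric] sum.If_cases lessThan_def Collect_conj_eq)
  also have "\<dots> \<le> (\<Sum>m\<le>M. 2 powr p * 2 powr (- real m * p) * ((2 / \<Delta> + 2) * 2 ^ m) ^ CARD('d))"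
    by (intro sum_mono mult_left_mono card_near) auto
  also have "\<dots> = (\<Sum>m\<le>M. 2 powr p * c * (2 powr (- e)) ^ m)"
  proof (rule sum.cong[OF refl])
    fix m :: nat
    have "((2::real) ^ m) ^ CARD('d) = 2 powr (real m * real CARD('d))"
      by (simp add: powr_realpow[symmetric] powr_powr)
    then have "2 powr (- real m * p) * ((2::real) ^ m) ^ CARD('d) = 2 powr (- real m * p + real m * real CARD('d))"
      by (simp only: powr_add)
    also have "- real m * p + real m * real CARD('d) = (- e) * real m" by (simp add: p_def algebra_simps)
    also have "2 powr (- e * real m) = (2 powr (- e)) ^ m" by (simp add: powr_powr flip: powr_realpow)
    finally show "2 powr p * 2 powr (- real m * p) * ((2 / \<Delta> + 2) * 2 ^ m) ^ CARD('d) = 2 powr p * c * (2 powr (- e)) ^ m"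
      by (simp add: power_mult_distrib c_def mult_ac)
  qed
  also have "\<dots> = 2 powr p * c * (\<Sum>m\<le>M. (2 powr (- e)) ^ m)" by (simp add: sum_distrib_left)
  also have "\<dots> \<le> K"
    unfolding K_def
  proof (intro mult_left_mono)
    have "(\<Sum>m\<le>M. (2 powr (- e)) ^ m) \<le> (\<Sum>m. (2 powr (- e)) ^ m)"
      by (rule sum_le_suminf) (use q in \<open>auto intro: summable_geometric\<close>)
    then show "(\<Sum>m\<le>M. (2 powr (- e)) ^ m) \<le> 1 / (1 - 2 powr (- e))"
      using suminf_geometric[OF q] by simp
  qed (use c in auto)
  finally show "(\<Sum>j<n. 1 / (1 + infnorm (z - x j) powr (real CARD('d) + e))) \<le> K"
    unfolding p_def .
qed

lemma exponential_row_sums: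
  assumes a: "0 < a"
  obtains K where "0 < K" "\<And>n z. (\<Sum>j<n. exp (- a * infnorm (z - x j))) \<le> K"
proof -
  obtain K where K: "0 < K" "\<And>n z. (\<Sum>j<n. 1 / (1 + infnorm (z - x j) powr (real CARD('d) + 1))) \<le> K"
    using polynomial_row_sums[of 1] by auto
  obtain C where C: "0 < C" "\<And>r. 0 \<le> r \<Longrightarrow> exp (- a * r) \<le> C * (1 / (1 + r powr (real CARD('d) + 1)))"
    using exp_le_polynomial[OF a, of "real CARD('d) + 1"] by auto
  show thesis
  proof
    show "0 < C * K" using C K by simp
    fix n z
    have "(\<Sum>j<n. exp (- a * infnorm (z - x j))) \<le> (\<Sum>j<n. C * (1 / (1 + infnorm (z - x j) powr (real CARD('d) + 1))))"
      by (intro sum_mono C) (simp add: infnorm_pos_le)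
    also have "\<dots> \<le> C * K" unfolding sum_distrib_left[symmetric] by (intro mult_left_mono K) (use C in auto)
    finally show "(\<Sum>j<n. exp (- a * infnorm (z - x j))) \<le> C * K" .
  qed
qed

end

section \<open>Gaussian weights and quadratic forms of stationary kernels\<close>

text \<open>
  Lebesgue measure on a Euclidean space is the product of its coordinate measures.
\<close>
lemma lborel_integral_prod:
  fixes f :: "'a::euclidean_space \<Rightarrow> real \<Rightarrow> complex"
  assumes f: "\<And>b. b \<in> Basis \<Longrightarrow> integrable lborel (f b)"
  shows "integrable lborel (\<lambda>x::'a. \<Prod>b\<in>Basis. f b (x \<bullet> b))" (is ?I)
    and "(\<integral>x. (\<Prod>b\<in>Basis. f b ((x::'a) \<bullet> b)) \<partial>lborel) = (\<Prod>b\<in>Basis. (\<integral>x. f b x \<partial>lborel))" (is ?E)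
proof -
  interpret product_sigma_finite "\<lambda>_::'a. lborel :: real measure" ..
  have fm[measurable]: "f b \<in> borel_measurable borel" if "b \<in> Basis" for b
    using borel_measurable_integrable[OF f[OF that]] by simp
  have pm: "(\<lambda>x::'a. \<Prod>b\<in>Basis. f b (x \<bullet> b)) \<in> borel_measurable borel"
    by (intro borel_measurable_prod) measurable
  have eq: "(\<Prod>b\<in>Basis. f b ((\<Sum>c\<in>Basis. g c *\<^sub>R c) \<bullet> b)) = (\<Prod>b\<in>Basis. f b (g b))" for g :: "'a \<Rightarrow> real"
    by (intro prod.cong) (simp_all add: inner_sum_left_Basis)
  have mm: "(\<lambda>g. \<Sum>b\<in>Basis. g b *\<^sub>R b) \<in> measurable (\<Pi>\<^sub>M b\<in>(Basis::'a set). lborel) borel"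
    by measurable
  show ?I
    by (subst lborel_eq, subst integrable_distr_eq[OF mm pm]) (simp add: eq product_integrable_prod f)
  show ?E
    by (subst lborel_eq, subst integral_distr[OF mm pm]) (simp add: eq product_integral_prod f)
qed

text \<open>
  The density of the centred normal law with covariance \<open>r\<^sup>2\<close> times the identity.
\<close>
definition gauss_weight :: "real \<Rightarrow> 'a::euclidean_space \<Rightarrow> real" where
  "gauss_weight r u = (1 / sqrt (2 * pi * r\<^sup>2)) ^ DIM('a) * exp (- (norm u)\<^sup>2 / (2 * r\<^sup>2))"

lemma gauss_weight_eq_prod: "gauss_weight r u = (\<Prod>b\<in>Basis. normal_density 0 r (u \<bullet> b))"
proof -
  have "(\<Prod>b\<in>Basis. normal_density 0 r (u \<bullet> b))
     = (1 / sqrt (2 * pi * r\<^sup>2)) ^ DIM('a) * (\<Prod>b\<in>Basis. exp (- (u \<bullet> b)\<^sup>2 / (2 * r\<^sup>2)))"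
    by (simp add: normal_density_def prod_dividef power_divide)
  also have "(\<Prod>b\<in>Basis. exp (- (u \<bullet> b)\<^sup>2 / (2 * r\<^sup>2))) = exp (\<Sum>b\<in>Basis. - (u \<bullet> b)\<^sup>2 / (2 * r\<^sup>2))"
    by (simp add: exp_sum)
  also have "(\<Sum>b\<in>Basis. - (u \<bullet> b)\<^sup>2 / (2 * r\<^sup>2)) = - (norm u)\<^sup>2 / (2 * r\<^sup>2)"
    unfolding power2_norm_eq_inner euclidean_inner[of u u]
    by (simp add: sum_divide_distrib sum_negf power2_eq_square)
  finally show ?thesis by (simp add: gauss_weight_def)
qed

lemma gauss_weight_pos: "r > 0 \<Longrightarrow> 0 < gauss_weight r u"
  unfolding gauss_weight_def by simp

lemma gauss_weight_measurable[measurable]: "gauss_weight r \<in> borel_measurable borel"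
  unfolding gauss_weight_def[abs_def] by measurable

lemma normal_char:
  assumes r: "0 < r"
  shows "integrable lborel (\<lambda>x. complex_of_real (normal_density 0 r x) * iexp (t * x))"
    and "(\<integral>x. complex_of_real (normal_density 0 r x) * iexp (t * x) \<partial>lborel) = complex_of_real (exp (- (r * t)\<^sup>2 / 2))"
proof -
  have i1: "integrable lborel (\<lambda>x. complex_of_real (normal_density 0 r x) * iexp (t * x))" for r t :: real
  proof (cases "r = 0")
    case False
    have "integrable lborel (\<lambda>x. normal_density 0 \<bar>r\<bar> x)" by (rule integrable_normal_density) (use False in auto)
    moreover have "normal_density 0 \<bar>r\<bar> = normal_density 0 r" by (auto simp: normal_density_def fun_eq_iff)
    ultimately show ?thesis
      by (elim Bochner_Integration.integrable_bound) (auto simp: norm_mult normal_density_nonneg)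
  qed (simp add: normal_density_def)
  show "integrable lborel (\<lambda>x. complex_of_real (normal_density 0 r x) * iexp (t * x))" by (rule i1)
  have "(\<integral>x. complex_of_real (normal_density 0 r x) * iexp (t * x) \<partial>lborel)
     = \<bar>r\<bar> *\<^sub>R (\<integral>x. complex_of_real (normal_density 0 r (0 + r * x)) * iexp (t * (0 + r * x)) \<partial>lborel)"
    by (rule lborel_integral_real_affine) (use r in simp)
  also have "\<dots> = (\<integral>x. \<bar>r\<bar> *\<^sub>R (complex_of_real (normal_density 0 r (0 + r * x)) * iexp (t * (0 + r * x))) \<partial>lborel)"
    by (simp only: integral_scaleR_right)
  also have "\<dots> = (\<integral>x. std_normal_density x *\<^sub>R iexp ((r * t) * x) \<partial>lborel)"
  proof (intro Bochner_Integration.integral_cong refl)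
    fix x
    have "\<bar>r\<bar> * normal_density 0 r (r * x) = std_normal_density x"
    proof -
      have e: "- (r * x)\<^sup>2 / (2 * r\<^sup>2) = - x\<^sup>2 / 2" using r by (simp add: power_mult_distrib)
      have "sqrt (2 * pi * r\<^sup>2) = sqrt (2 * pi) * r" using r by (simp only: real_sqrt_mult) simp
      then have h: "\<bar>r\<bar> * (1 / sqrt (2 * pi * r\<^sup>2)) = 1 / sqrt (2 * pi)" using r by simp
      have "normal_density 0 r (r * x) = 1 / sqrt (2 * pi * r\<^sup>2) * exp (- (r * x)\<^sup>2 / (2 * r\<^sup>2))"
        by (simp add: normal_density_def)
      then show ?thesis by (simp only: e mult.assoc[symmetric] h std_normal_density_def)
    qed
    then have *: "complex_of_real \<bar>r\<bar> * complex_of_real (normal_density 0 r (r * x)) = complex_of_real (std_normal_density x)"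
      by (simp only: of_real_mult[symmetric])
    have "t * (r * x) = (r * t) * x" by simp
    then show "\<bar>r\<bar> *\<^sub>R (complex_of_real (normal_density 0 r (0 + r * x)) * iexp (t * (0 + r * x)))
       = std_normal_density x *\<^sub>R iexp ((r * t) * x)"
      unfolding scaleR_conv_of_real add_0 by (simp only: mult.assoc[symmetric] *)
  qed
  also have "\<dots> = char std_normal_distribution (r * t)"
    unfolding char_def by (rule integral_density[symmetric]) (auto simp: normal_density_nonneg)
  finally show "(\<integral>x. complex_of_real (normal_density 0 r x) * iexp (t * x) \<partial>lborel) = complex_of_real (exp (- (r * t)\<^sup>2 / 2))"
    by (simp add: char_std_normal_distribution)
qed

lemma gauss_weight_char:
  fixes z :: "'a::euclidean_space"
  assumes r: "0 < r"
  shows "integrable lborel (\<lambda>u. complex_of_real (gauss_weight r u) * iexp (u \<bullet> z))"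
    and "(\<integral>u. complex_of_real (gauss_weight r u) * iexp (u \<bullet> z) \<partial>lborel) = complex_of_real (exp (- r\<^sup>2 * (norm z)\<^sup>2 / 2))"
proof -
  have eq: "complex_of_real (gauss_weight r u) * iexp (u \<bullet> z)
    = (\<Prod>b\<in>Basis. complex_of_real (normal_density 0 r (u \<bullet> b)) * iexp ((z \<bullet> b) * (u \<bullet> b)))" for u
  proof -
    have "(\<Prod>b\<in>Basis. iexp ((z \<bullet> b) * (u \<bullet> b))) = iexp (u \<bullet> z)"
      unfolding euclidean_inner[of u z] exp_sum[OF finite_Basis, symmetric]
      by (simp add: sum_distrib_left mult_ac)
    then show ?thesis by (simp add: prod.distrib gauss_weight_eq_prod)
  qed
  show "integrable lborel (\<lambda>u. complex_of_real (gauss_weight r u) * iexp (u \<bullet> z))"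
    unfolding eq by (rule lborel_integral_prod) (rule normal_char[OF r])
  have "(\<integral>u. complex_of_real (gauss_weight r u) * iexp (u \<bullet> z) \<partial>lborel)
     = (\<Prod>b\<in>Basis. (\<integral>x. complex_of_real (normal_density 0 r x) * iexp ((z \<bullet> b) * x) \<partial>lborel))"
    unfolding eq by (rule lborel_integral_prod) (rule normal_char[OF r])
  also have "\<dots> = (\<Prod>b\<in>Basis. complex_of_real (exp (- (r * (z \<bullet> b))\<^sup>2 / 2)))"
    by (intro prod.cong refl normal_char(2)[OF r])
  also have "\<dots> = complex_of_real (exp (\<Sum>b\<in>Basis. - (r * (z \<bullet> b))\<^sup>2 / 2))"
    by (simp add: exp_sum flip: of_real_prod)
  also have "(\<Sum>b\<in>Basis. - (r * (z \<bullet> b))\<^sup>2 / 2) = (\<Sum>b\<in>Basis. (- r\<^sup>2 / 2) * ((z \<bullet> b) * (z \<bullet> b)))"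
    by (intro sum.cong refl) (simp add: power_mult_distrib power2_eq_square)
  also have "\<dots> = (- r\<^sup>2 / 2) * (norm z)\<^sup>2"
    by (simp only: sum_distrib_left[symmetric] power2_norm_eq_inner euclidean_inner[of z z, symmetric])
  also have "\<dots> = - r\<^sup>2 * (norm z)\<^sup>2 / 2" by simp
  finally show "(\<integral>u. complex_of_real (gauss_weight r u) * iexp (u \<bullet> z) \<partial>lborel) = complex_of_real (exp (- r\<^sup>2 * (norm z)\<^sup>2 / 2))" .
qed

lemma gauss_weight_integrable: "0 < r \<Longrightarrow> integrable lborel (gauss_weight r :: 'a::euclidean_space \<Rightarrow> real)"
  using gauss_weight_char(1)[of r "0::'a"] by (simp add: complex_of_real_integrable_eq)

lemma gauss_weight_cos:
  fixes z :: "'a::euclidean_space"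
  assumes r: "0 < r"
  shows "(\<integral>u. gauss_weight r u * cos (u \<bullet> z) \<partial>lborel) = exp (- r\<^sup>2 * (norm z)\<^sup>2 / 2)"
proof -
  have "(\<integral>u. gauss_weight r u * cos (u \<bullet> z) \<partial>lborel) = (\<integral>u. Re (complex_of_real (gauss_weight r u) * iexp (u \<bullet> z)) \<partial>lborel)"
    by (simp add: Re_exp)
  also have "\<dots> = Re (exp (- r\<^sup>2 * (norm z)\<^sup>2 / 2))"
    by (subst integral_Re[OF gauss_weight_char(1)[OF r]]) (simp add: gauss_weight_char(2)[OF r])
  finally show ?thesis by simp
qed

text \<open>
  Far from the origin the weight is negligible relative to the weight of twice the width. This
  allows a Gaussian integral to be truncated without a pointwise bound on the integrand.
\<close>
lemma gauss_weight_tail: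
  fixes u :: "'a::euclidean_space"
  assumes r: "0 < r" and u: "\<rho> \<le> norm u" and rho: "0 \<le> \<rho>"
  shows "gauss_weight r u \<le> 2 ^ DIM('a) * exp (- 3 * \<rho>\<^sup>2 / (8 * r\<^sup>2)) * gauss_weight (2 * r) u"
proof -
  have s: "1 / sqrt (2 * pi * r\<^sup>2) = 2 * (1 / sqrt (2 * pi * (2 * r)\<^sup>2))"
  proof -
    have "2 * pi * (2 * r)\<^sup>2 = 2\<^sup>2 * (2 * pi * r\<^sup>2)" by (simp add: power_mult_distrib)
    then have "sqrt (2 * pi * (2 * r)\<^sup>2) = 2 * sqrt (2 * pi * r\<^sup>2)"
      by (simp only: real_sqrt_mult[of "2\<^sup>2"]) simp
    then show ?thesis by simp
  qed
  have e: "exp (- (norm u)\<^sup>2 / (2 * r\<^sup>2)) = exp (- 3 * (norm u)\<^sup>2 / (8 * r\<^sup>2)) * exp (- (norm u)\<^sup>2 / (2 * (2 * r)\<^sup>2))"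
    unfolding exp_add[symmetric] using r by (simp add: field_simps power2_eq_square)
  have "gauss_weight r u = 2 ^ DIM('a) * exp (- 3 * (norm u)\<^sup>2 / (8 * r\<^sup>2)) * gauss_weight (2 * r) u"
    unfolding gauss_weight_def s e power_mult_distrib[of 2] by simp
  also have "\<dots> \<le> 2 ^ DIM('a) * exp (- 3 * \<rho>\<^sup>2 / (8 * r\<^sup>2)) * gauss_weight (2 * r) u"
  proof (intro mult_right_mono mult_left_mono)
    have "\<rho>\<^sup>2 \<le> (norm u)\<^sup>2" using u rho by (rule power_mono)
    then show "exp (- 3 * (norm u)\<^sup>2 / (8 * r\<^sup>2)) \<le> exp (- 3 * \<rho>\<^sup>2 / (8 * r\<^sup>2))"
      using r by (simp add: divide_right_mono)
  qed (use gauss_weight_pos[of "2 * r" u] r in auto)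
  finally show ?thesis .
qed

lemma covariance_even:
  assumes "stationary_covariance k"
  shows "k (- v) = k v"
proof -
  have "k (0 - v) = k (v - 0)"
    using assms unfolding stationary_covariance_def covariance_function_def by blast
  then show ?thesis by simp
qed

text \<open>
  Positive definiteness at the \<open>2 n\<close> points \<open>x\<^sub>i\<close> and \<open>x\<^sub>i + z\<close>, with weights \<open>a\<^sub>i\<close> and \<open>- a\<^sub>i\<close>. It compares the
  kernel with its averages over shifts, and thereby replaces Bochner's theorem, which would
  need a continuous kernel.
\<close>
lemma stationary_shift_le:
  fixes k :: "real ^ 'd \<Rightarrow> real" and x :: "nat \<Rightarrow> real ^ 'd" and a :: "nat \<Rightarrow> real"
  assumes "stationary_covariance k"
  shows "(\<Sum>i<n. \<Sum>j<n. a i * a j * k (x i - x j + z)) \<le> (\<Sum>i<n. \<Sum>j<n. a i * a j * k (x i - x j))"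
proof -
  note ev = covariance_even[OF assms]
  define y where "y i = (if i < n then x i else x (i - n) + z)" for i
  define b where "b i = (if i < n then a i else - a (i - n))" for i
  have split: "(\<Sum>i<2*n. g i) = (\<Sum>i<n. g i) + (\<Sum>i<n. g (i + n))" for g :: "nat \<Rightarrow> real"
  proof -
    have "(\<Sum>i<2*n. g i) = (\<Sum>i<n. g i) + (\<Sum>i\<in>{n..<n+n}. g i)"
      using sum.atLeastLessThan_concat[of 0 n "n+n" g] by (simp add: lessThan_atLeast0 mult_2)
    also have "(\<Sum>i\<in>{n..<n+n}. g i) = (\<Sum>i<n. g (i + n))"
      using sum.shift_bounds_nat_ivl[of g 0 n n] by (simp add: lessThan_atLeast0)
    finally show ?thesis .
  qed
  have "0 \<le> (\<Sum>i<2*n. \<Sum>j<2*n. b i * b j * k (y i - y j))"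
    using assms unfolding stationary_covariance_def covariance_function_def by blast
  also have "\<dots> = (\<Sum>i<n. \<Sum>j<n. a i * a j * k (x i - x j)) - (\<Sum>i<n. \<Sum>j<n. a i * a j * k (x i - x j - z))
     - (\<Sum>i<n. \<Sum>j<n. a i * a j * k (x i - x j + z)) + (\<Sum>i<n. \<Sum>j<n. a i * a j * k (x i - x j))"
    unfolding split sum.distrib
    by (simp add: b_def y_def sum_negf algebra_simps)
  also have "(\<Sum>i<n. \<Sum>j<n. a i * a j * k (x i - x j - z)) = (\<Sum>i<n. \<Sum>j<n. a i * a j * k (x i - x j + z))"
  proof (subst sum.swap, intro sum.cong refl)
    fix i j
    show "a j * a i * k (x j - x i - z) = a i * a j * k (x i - x j + z)"
      using ev[of "x i - x j + z"] by (simp add: algebra_simps)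
  qed
  finally show ?thesis by simp
qed

text \<open>The squared modulus of the exponential sum \<open>\<Sum>\<^sub>i a\<^sub>i exp (\<i> u \<bullet> x\<^sub>i)\<close>.\<close>
definition exp_sum_sq :: "nat \<Rightarrow> (nat \<Rightarrow> real) \<Rightarrow> (nat \<Rightarrow> real ^ 'd) \<Rightarrow> real ^ 'd \<Rightarrow> real" where
  "exp_sum_sq n a x u = (\<Sum>i<n. \<Sum>j<n. a i * a j * cos (u \<bullet> (x i - x j)))"

lemma exp_sum_sq_nonneg: "0 \<le> exp_sum_sq n a x u"
proof -
  have "exp_sum_sq n a x u = (\<Sum>i<n. a i * cos (u \<bullet> x i))\<^sup>2 + (\<Sum>i<n. a i * sin (u \<bullet> x i))\<^sup>2"
    unfolding exp_sum_sq_def power2_eq_square sum_product sum.distrib[symmetric]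
    by (intro sum.cong refl) (simp add: inner_diff_right cos_diff algebra_simps)
  then show ?thesis by simp
qed

lemma exp_sum_sq_measurable[measurable]: "exp_sum_sq n a x \<in> borel_measurable borel"
  unfolding exp_sum_sq_def[abs_def] by measurable

lemma gauss_weight_cos_integrable:
  fixes z :: "'a::euclidean_space"
  assumes r: "0 < r"
  shows "integrable lborel (\<lambda>u. gauss_weight r u * cos (u \<bullet> z))"
proof (rule Bochner_Integration.integrable_bound[OF gauss_weight_integrable[OF r]])
  show "AE u in lborel. norm (gauss_weight r u * cos (u \<bullet> z)) \<le> norm (gauss_weight r u)"
    by (rule AE_I2) (simp add: abs_mult mult_left_le)
qed measurable

lemma gauss_weight_exp_sum_sq:
  assumes r: "0 < r"
  shows "integrable lborel (\<lambda>u. gauss_weight r u * exp_sum_sq n a x u)"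
    and "(\<integral>u. gauss_weight r u * exp_sum_sq n a x u \<partial>lborel)
      = (\<Sum>i<n. \<Sum>j<n. a i * a j * exp (- r\<^sup>2 * (norm (x i - x j))\<^sup>2 / 2))"
proof -
  have eq: "gauss_weight r u * exp_sum_sq n a x u = (\<Sum>i<n. \<Sum>j<n. a i * a j * (gauss_weight r u * cos (u \<bullet> (x i - x j))))" for u
    unfolding exp_sum_sq_def sum_distrib_left by (simp add: mult_ac)
  show "integrable lborel (\<lambda>u. gauss_weight r u * exp_sum_sq n a x u)"
    unfolding eq by (intro Bochner_Integration.integrable_sum integrable_mult_right gauss_weight_cos_integrable r)
  show "(\<integral>u. gauss_weight r u * exp_sum_sq n a x u \<partial>lborel)
      = (\<Sum>i<n. \<Sum>j<n. a i * a j * exp (- r\<^sup>2 * (norm (x i - x j))\<^sup>2 / 2))"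
    unfolding eq
    by (simp add: Bochner_Integration.integral_sum Bochner_Integration.integrable_sum
        gauss_weight_cos_integrable[OF r] gauss_weight_cos[OF r])
qed

lemma lborel_integral_shift:
  fixes f :: "'a::euclidean_space \<Rightarrow> real"
  assumes [measurable]: "f \<in> borel_measurable borel"
  shows "(\<integral>y. f y \<partial>lborel) = (\<integral>z. f (v + z) \<partial>lborel)"
    and "integrable lborel f \<longleftrightarrow> integrable lborel (\<lambda>z. f (v + z))"
proof -
  have "(\<integral>y. f y \<partial>lborel) = (\<integral>y. f y \<partial>distr lborel borel ((+) v))" by (simp only: lborel_distr_plus)
  also have "\<dots> = (\<integral>z. f (v + z) \<partial>lborel)" by (rule integral_distr) measurable
  finally show "(\<integral>y. f y \<partial>lborel) = (\<integral>z. f (v + z) \<partial>lborel)" .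
  have "integrable lborel f \<longleftrightarrow> integrable (distr lborel borel ((+) v)) f" by (simp only: lborel_distr_plus)
  also have "\<dots> \<longleftrightarrow> integrable lborel (\<lambda>z. f (v + z))" by (rule integrable_distr_eq) measurable
  finally show "integrable lborel f \<longleftrightarrow> integrable lborel (\<lambda>z. f (v + z))" .
qed

lemma AE_lborel_shift:
  fixes v :: "'a::euclidean_space"
  assumes "AE y in lborel. P y"
  shows "AE z in lborel. P (v + z)"
proof -
  obtain N where N: "N \<in> null_sets lborel" "{y. \<not> P y} \<subseteq> N"
    using assms unfolding eventually_ae_filter by auto
  have "AE y in lborel. y \<notin> N" by (rule AE_not_in[OF N(1)])
  then have "AE y in distr lborel borel ((+) v). y \<notin> N" by (simp only: lborel_distr_plus)
  then have "AE z in lborel. v + z \<notin> N"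
    by (subst (asm) AE_distr_iff) (use N in auto)
  then show ?thesis by eventually_elim (use N in auto)
qed

definition gauss_mass :: "real \<Rightarrow> 'a::euclidean_space itself \<Rightarrow> real" where
  "gauss_mass r TYPE('a) = (\<integral>z. exp (- r\<^sup>2 * (norm (z::'a))\<^sup>2 / 2) \<partial>lborel)"

lemma gauss_eq_gauss_weight:
  fixes z :: "'a::euclidean_space"
  assumes r: "0 < r"
  shows "exp (- r\<^sup>2 * (norm z)\<^sup>2 / 2) = (sqrt (2 * pi * (1 / r)\<^sup>2)) ^ DIM('a) * gauss_weight (1 / r) z"
proof -
  define c where "c = sqrt (2 * pi * (1 / r)\<^sup>2)"
  have c: "c \<noteq> 0" unfolding c_def using r by simp
  have e: "- (norm z)\<^sup>2 / (2 * (1 / r)\<^sup>2) = - r\<^sup>2 * (norm z)\<^sup>2 / 2"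
    using r by (simp add: power_divide)
  show ?thesis unfolding gauss_weight_def e c_def[symmetric] using c by (simp add: power_divide)
qed

lemma gauss_integrable:
  assumes r: "0 < r"
  shows "integrable lborel (\<lambda>z. exp (- r\<^sup>2 * (norm (z::'a::euclidean_space))\<^sup>2 / 2))"
  unfolding gauss_eq_gauss_weight[OF r] using gauss_weight_integrable[of "1 / r", where 'a='a] r by simp

lemma gauss_mass_pos:
  assumes r: "0 < r"
  shows "0 < gauss_mass r TYPE('a::euclidean_space)"
proof -
  have "(\<integral>z. gauss_weight (1 / r) (z::'a) \<partial>lborel) = 1"
    using gauss_weight_cos[of "1 / r" "0::'a"] r by simp
  then show ?thesis
    unfolding gauss_mass_def gauss_eq_gauss_weight[OF r] using r by simp
qed

text \<open>
  A Lebesgue measurable kernel agrees almost everywhere with a Borel one, to which Fubini's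
  theorem on the Borel product space applies.
\<close>
lemma fourier_borel:
  fixes k :: "real ^ 'd \<Rightarrow> real"
  assumes k: "integrable lebesgue k"
    and k'[measurable]: "k' \<in> borel_measurable borel" and ae: "AE y in lborel. k y = k' y"
  shows "integrable lborel k'"
    and "Re (fourier k u) = (2 * pi) powr (- real CARD('d)) * (\<integral>y. k' y * cos (u \<bullet> y) \<partial>lborel)"
proof -
  have aeL: "AE y in lebesgue. k y = k' y" using ae by (rule AE_completion)
  have km: "k \<in> borel_measurable lebesgue" using k by simp
  have k'm: "k' \<in> borel_measurable lebesgue" by (rule measurable_completion) (use k' in simp)
  have "integrable lebesgue k'" using integrable_cong_AE[OF km k'm aeL] k by simp
  then show int: "integrable lborel k'" by (subst (asm) integrable_completion) auto
  let ?e = "\<lambda>t. exp (- \<i> * complex_of_real (u \<bullet> t))"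
  have em: "?e \<in> borel_measurable borel" by measurable
  have emL: "?e \<in> borel_measurable lebesgue"
    by (rule measurable_completion) (use em in simp)
  have ne: "norm (?e t) = 1" for t by (simp add: norm_exp_eq_Re)
  have "(\<integral>t. complex_of_real (k t) * ?e t \<partial>lebesgue) = (\<integral>t. complex_of_real (k' t) * ?e t \<partial>lebesgue)"
  proof (rule integral_cong_AE)
    show "AE t in lebesgue. complex_of_real (k t) * ?e t = complex_of_real (k' t) * ?e t"
      using aeL by eventually_elim simp
  qed (use km k'm emL in \<open>auto intro!: borel_measurable_times borel_measurable_of_real\<close>)
  also have "\<dots> = (\<integral>t. complex_of_real (k' t) * ?e t \<partial>lborel)"
    by (rule integral_completion) (use em in measurable)
  finally have 1: "(\<integral>t. complex_of_real (k t) * ?e t \<partial>lebesgue) = (\<integral>t. complex_of_real (k' t) * ?e t \<partial>lborel)" .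
  have i: "integrable lborel (\<lambda>t. complex_of_real (k' t) * ?e t)"
    by (rule Bochner_Integration.integrable_bound[OF int]) (use em in \<open>auto simp: norm_mult ne\<close>)
  have re_mult: "Re (complex_of_real b * z) = b * Re z" for b z by simp
  have "Re (\<integral>t. complex_of_real (k' t) * ?e t \<partial>lborel) = (\<integral>t. Re (complex_of_real (k' t) * ?e t) \<partial>lborel)"
    by (rule integral_Re[OF i, symmetric])
  also have "\<dots> = (\<integral>y. k' y * cos (u \<bullet> y) \<partial>lborel)" by (simp add: Re_exp)
  finally show "Re (fourier k u) = (2 * pi) powr (- real CARD('d)) * (\<integral>y. k' y * cos (u \<bullet> y) \<partial>lborel)"
    unfolding fourier_def 1 re_mult by simp
qed

text \<open>
  The quadratic form is at least its average over shifts with density proportional to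
  \<open>exp (- r\<^sup>2 \<parallel>z\<parallel>\<^sup>2 / 2)\<close>. Writing that function as the Fourier transform of \<^term>\<open>gauss_weight r\<close> and
  exchanging the integrals yields the spectral side. The sine parts cancel by antisymmetry in
  the two summation indices.
\<close>
lemma spectral_inequality:
  fixes k :: "real ^ 'd \<Rightarrow> real" and x :: "nat \<Rightarrow> real ^ 'd" and a :: "nat \<Rightarrow> real"
  assumes st: "stationary_covariance k" and k: "integrable lebesgue k" and r: "0 < r"
  shows "integrable lborel (\<lambda>u. gauss_weight r u * exp_sum_sq n a x u * Re (fourier k u))"
    and "(2 * pi) powr real CARD('d) * (\<integral>u. gauss_weight r u * exp_sum_sq n a x u * Re (fourier k u) \<partial>lborel)
       \<le> gauss_mass r TYPE(real ^ 'd) * (\<Sum>i<n. \<Sum>j<n. a i * a j * k (x i - x j))"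
proof -
  have "k \<in> borel_measurable lebesgue" using k by simp
  then obtain k' where k'[measurable]: "k' \<in> borel_measurable borel" and ae: "AE y in lborel. k y = k' y"
    using completion_ex_borel_measurable_real[of k lborel] by auto
  note int = fourier_borel(1)[OF k k' ae] and four = fourier_borel(2)[OF k k' ae]
  define g where "g z = exp (- r\<^sup>2 * (norm z)\<^sup>2 / 2)" for z :: "real ^ 'd"
  have gm[measurable]: "g \<in> borel_measurable borel" unfolding g_def[abs_def] by measurable
  have g01: "0 \<le> g z" "g z \<le> 1" for z unfolding g_def by auto
  have gint: "integrable lborel g" using gauss_integrable[OF r, where 'a="real ^ 'd"] by (simp add: g_def[abs_def])
  define Q where "Q = (\<Sum>i<n. \<Sum>j<n. a i * a j * k (x i - x j))"
  define v where "v i j = x i - x j" for i j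
  define Hc where "Hc u = (\<integral>y. k' y * cos (u \<bullet> y) \<partial>lborel)" for u
  define Hs where "Hs u = (\<integral>y. k' y * sin (u \<bullet> y) \<partial>lborel)" for u
  have ic: "integrable lborel (\<lambda>y. k' y * cos (u \<bullet> y))" for u
    by (rule Bochner_Integration.integrable_bound[OF int]) (auto simp: abs_mult intro!: mult_left_le)
  have isn: "integrable lborel (\<lambda>y. k' y * sin (u \<bullet> y))" for u
    by (rule Bochner_Integration.integrable_bound[OF int]) (auto simp: abs_mult intro!: mult_left_le)
  define F where "F w y u = k' y * (gauss_weight r u * cos (u \<bullet> (y - w)))" for w y u
  have Fm[measurable]: "case_prod (F w) \<in> borel_measurable (lborel \<Otimes>\<^sub>M lborel)" for w
    unfolding F_def by measurable
  have Fint: "integrable (lborel \<Otimes>\<^sub>M lborel) (case_prod (F w))" for w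
  proof (rule Bochner_Integration.integrable_bound)
    show "integrable (lborel \<Otimes>\<^sub>M lborel) (\<lambda>(y, u::real ^ 'd). k' y * gauss_weight r u)"
    proof (rule lborel_pair.Fubini_integrable)
      show "integrable lborel (\<lambda>y. \<integral>u. norm (case (y, u) of (y, u::real ^ 'd) \<Rightarrow> k' y * gauss_weight r u) \<partial>lborel)"
        using int by (simp add: abs_mult)
      show "AE y in lborel. integrable lborel (\<lambda>u. case (y, u) of (y, u::real ^ 'd) \<Rightarrow> k' y * gauss_weight r u)"
        using gauss_weight_integrable[OF r, where 'a="real ^ 'd"] by simp
    qed measurable
    show "AE p in lborel \<Otimes>\<^sub>M lborel. norm (case_prod (F w) p) \<le> norm (case p of (y, u::real ^ 'd) \<Rightarrow> k' y * gauss_weight r u)"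
      by (rule AE_I2) (auto simp: F_def abs_mult intro!: mult_left_mono mult_left_le split: prod.split)
  qed measurable
  define G where "G w u = (\<integral>y. F w y u \<partial>lborel)" for w u
  have Gint: "integrable lborel (G w)" for w
    unfolding G_def[abs_def] by (rule lborel_pair.integrable_snd[OF Fint])
  have G: "G w u = gauss_weight r u * (cos (u \<bullet> w) * Hc u + sin (u \<bullet> w) * Hs u)" for w u
  proof -
    have "F w y u = gauss_weight r u * (cos (u \<bullet> w) * (k' y * cos (u \<bullet> y)) + sin (u \<bullet> w) * (k' y * sin (u \<bullet> y)))" for y
      unfolding F_def by (simp add: inner_diff_right cos_diff algebra_simps)
    then show ?thesis unfolding G_def Hc_def Hs_def using ic isn by simp
  qed
  have Fub: "(\<integral>u. G w u \<partial>lborel) = (\<integral>z. k' (w + z) * g z \<partial>lborel)" for w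
  proof -
    have "(\<integral>u. G w u \<partial>lborel) = (\<integral>y. (\<integral>u. F w y u \<partial>lborel) \<partial>lborel)"
      unfolding G_def by (rule lborel_pair.Fubini_integral[OF Fint])
    also have "\<dots> = (\<integral>y. k' y * g (y - w) \<partial>lborel)"
      unfolding F_def g_def by (simp add: gauss_weight_cos[OF r])
    also have "\<dots> = (\<integral>z. k' (w + z) * g (w + z - w) \<partial>lborel)"
      by (rule lborel_integral_shift) measurable
    finally show ?thesis by simp
  qed
  have pt: "(\<Sum>i<n. \<Sum>j<n. a i * a j * G (v i j) u) = gauss_weight r u * exp_sum_sq n a x u * Hc u" for u
  proof -
    have "(\<Sum>i<n. \<Sum>j<n. a i * a j * sin (u \<bullet> v i j)) = (\<Sum>i<n. \<Sum>j<n. a i * a j * sin (u \<bullet> v j i))"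
      by (subst sum.swap) (simp add: mult_ac)
    also have "\<dots> = (\<Sum>i<n. \<Sum>j<n. - (a i * a j * sin (u \<bullet> v i j)))"
    proof (intro sum.cong refl)
      fix i j
      have "u \<bullet> v j i = - (u \<bullet> v i j)" by (simp add: v_def inner_diff_right)
      then show "a i * a j * sin (u \<bullet> v j i) = - (a i * a j * sin (u \<bullet> v i j))" by simp
    qed
    also have "\<dots> = - (\<Sum>i<n. \<Sum>j<n. a i * a j * sin (u \<bullet> v i j))"
      by (simp add: sum_negf)
    finally have s0: "(\<Sum>i<n. \<Sum>j<n. a i * a j * sin (u \<bullet> v i j)) = 0" by simp
    have "(\<Sum>i<n. \<Sum>j<n. a i * a j * G (v i j) u)
       = gauss_weight r u * Hc u * (\<Sum>i<n. \<Sum>j<n. a i * a j * cos (u \<bullet> v i j))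
       + gauss_weight r u * Hs u * (\<Sum>i<n. \<Sum>j<n. a i * a j * sin (u \<bullet> v i j))"
      unfolding G sum_distrib_left sum.distrib[symmetric] by (intro sum.cong refl) (simp add: algebra_simps)
    then show ?thesis using s0 unfolding exp_sum_sq_def v_def by simp
  qed
  have Hc: "Hc u = (2 * pi) powr real CARD('d) * Re (fourier k u)" for u
    unfolding four Hc_def by (simp add: powr_minus)
  have sumint: "integrable lborel (\<lambda>u. \<Sum>i<n. \<Sum>j<n. a i * a j * G (v i j) u)"
    by (intro Bochner_Integration.integrable_sum integrable_mult_right Gint)
  have "integrable lborel (\<lambda>u. (2 * pi) powr real CARD('d) * (gauss_weight r u * exp_sum_sq n a x u * Re (fourier k u)))"
    using sumint unfolding pt Hc by (simp add: mult_ac)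
  then have "integrable lborel (\<lambda>u. (2 * pi) powr - real CARD('d) * ((2 * pi) powr real CARD('d) * (gauss_weight r u * exp_sum_sq n a x u * Re (fourier k u))))"
    by (rule integrable_mult_right)
  then show "integrable lborel (\<lambda>u. gauss_weight r u * exp_sum_sq n a x u * Re (fourier k u))"
    unfolding mult.assoc[symmetric, of "(2 * pi) powr - real CARD('d)"] by (simp add: powr_minus)
  have kgint: "integrable lborel (\<lambda>z. k' (w + z) * g z)" for w
    by (rule Bochner_Integration.integrable_bound[OF lborel_integral_shift(2)[OF k', THEN iffD1, OF int, of w]])
       (use g01 in \<open>auto simp: abs_mult intro!: mult_left_le\<close>)
  have "(2 * pi) powr real CARD('d) * (\<integral>u. gauss_weight r u * exp_sum_sq n a x u * Re (fourier k u) \<partial>lborel)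
     = (\<integral>u. (\<Sum>i<n. \<Sum>j<n. a i * a j * G (v i j) u) \<partial>lborel)"
    unfolding pt Hc by (simp add: mult_ac flip: integral_mult_right_zero)
  also have "\<dots> = (\<Sum>i<n. \<Sum>j<n. a i * a j * (\<integral>u. G (v i j) u \<partial>lborel))"
    by (simp add: Bochner_Integration.integral_sum Bochner_Integration.integrable_sum Gint)
  also have "\<dots> = (\<integral>z. (\<Sum>i<n. \<Sum>j<n. a i * a j * (k' (v i j + z) * g z)) \<partial>lborel)"
    unfolding Fub by (simp add: Bochner_Integration.integral_sum Bochner_Integration.integrable_sum kgint)
  also have "\<dots> \<le> (\<integral>z. Q * g z \<partial>lborel)"
  proof (rule integral_mono_AE)
    show "integrable lborel (\<lambda>z. \<Sum>i<n. \<Sum>j<n. a i * a j * (k' (v i j + z) * g z))"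
      by (intro Bochner_Integration.integrable_sum integrable_mult_right kgint)
    show "integrable lborel (\<lambda>z. Q * g z)" using gint by simp
    have "AE z in lborel. \<forall>i\<in>{..<n}. \<forall>j\<in>{..<n}. k (v i j + z) = k' (v i j + z)"
      by (intro AE_finite_allI finite_lessThan AE_lborel_shift[OF ae])
    then show "AE z in lborel. (\<Sum>i<n. \<Sum>j<n. a i * a j * (k' (v i j + z) * g z)) \<le> Q * g z"
    proof eventually_elim
      case (elim z)
      have "(\<Sum>i<n. \<Sum>j<n. a i * a j * (k' (v i j + z) * g z)) = (\<Sum>i<n. \<Sum>j<n. a i * a j * k (x i - x j + z)) * g z"
        unfolding sum_distrib_right using elim by (intro sum.cong refl) (auto simp: v_def)
      also have "\<dots> \<le> Q * g z"
        unfolding Q_def by (intro mult_right_mono stationary_shift_le st g01)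
      finally show ?case .
    qed
  qed
  also have "\<dots> = gauss_mass r TYPE(real ^ 'd) * Q" unfolding gauss_mass_def g_def by simp
  finally show "(2 * pi) powr real CARD('d) * (\<integral>u. gauss_weight r u * exp_sum_sq n a x u * Re (fourier k u) \<partial>lborel)
       \<le> gauss_mass r TYPE(real ^ 'd) * (\<Sum>i<n. \<Sum>j<n. a i * a j * k (x i - x j))" unfolding Q_def .
qed

context separated
begin

text \<open>
  Off-diagonal Gaussian entries carry the factor \<open>exp (- r\<^sup>2 \<Delta>\<^sup>2 / 4)\<close>, while what remains of them is
  still summable, so that the Gram matrix tends to the identity as \<open>r\<close> grows.
\<close>
lemma gaussian_gram_nearly_orthogonal:
  obtains r0 where "0 < r0"
    "\<And>r n a. r0 \<le> r \<Longrightarrow>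
      \<bar>(\<Sum>i<n. \<Sum>j<n. a i * a j * exp (- r\<^sup>2 * (norm (x i - x j))\<^sup>2 / 2)) - (\<Sum>i<n. (a i)\<^sup>2)\<bar>
       \<le> (\<Sum>i<n. (a i)\<^sup>2) / 2"
proof -
  obtain K where K: "0 < K" "\<And>n z. (\<Sum>j<n. exp (- 1 * infnorm (z - x j))) \<le> K"
    using exponential_row_sums[of 1] by auto
  \<comment> \<open>The summand 2 serves \<open>4 (t - 1) \<le> r\<^sup>2 t\<^sup>2\<close> below, the other one makes the row sums at most 1/2.\<close>
  define r0 where "r0 = sqrt (2 + 4 * \<bar>ln (K * exp 1 * 2)\<bar> / \<Delta>\<^sup>2)"
  have r0: "r0\<^sup>2 = 2 + 4 * \<bar>ln (K * exp 1 * 2)\<bar> / \<Delta>\<^sup>2" "0 < r0" unfolding r0_def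
    by (auto simp: add_pos_nonneg)
  show thesis
  proof (rule that[OF r0(2)])
    fix r :: real and n and a :: "nat \<Rightarrow> real"
    assume r: "r0 \<le> r"
    define e where "e i j = (if i = j then 0 else exp (- r\<^sup>2 * (norm (x i - x j))\<^sup>2 / 2))" for i j
    have e0: "0 \<le> e i j" for i j by (simp add: e_def)
    have rr: "r0\<^sup>2 \<le> r\<^sup>2" using r r0(2) by (intro power_mono) auto
    have epsb: "exp (- r\<^sup>2 * \<Delta>\<^sup>2 / 4) * (exp 1 * K) \<le> 1 / 2"
    proof -
      define X where "X = r\<^sup>2 * \<Delta>\<^sup>2 / 4"
      have D2: "0 < \<Delta>\<^sup>2" using gap_pos by simp
      have "ln (K * exp 1 * 2) \<le> \<bar>ln (K * exp 1 * 2)\<bar>" by simp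
      also have "\<dots> = (4 * \<bar>ln (K * exp 1 * 2)\<bar> / \<Delta>\<^sup>2) * \<Delta>\<^sup>2 / 4" using D2 by simp
      also have "\<dots> \<le> r0\<^sup>2 * \<Delta>\<^sup>2 / 4"
        unfolding r0 by (intro divide_right_mono mult_right_mono) auto
      also have "\<dots> \<le> X" unfolding X_def using rr by (simp add: mult_right_mono)
      finally have "exp (ln (K * exp 1 * 2)) \<le> exp X" by (simp only: exp_le_cancel_iff)
      then have "K * exp 1 * 2 \<le> exp X" using K(1) by simp
      then have "exp (- X) * (exp 1 * K) \<le> exp (- X) * (exp X / 2)"
        by (intro mult_left_mono) (auto simp: mult_ac)
      also have "\<dots> = 1 / 2" by (simp add: exp_minus)
      finally show ?thesis by (simp add: X_def)
    qed
    have eb: "e i j \<le> exp (- r\<^sup>2 * \<Delta>\<^sup>2 / 4) * (exp 1 * exp (- 1 * infnorm (x i - x j)))" for i j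
    proof (cases "i = j")
      case False
      define t where "t = infnorm (x i - x j)"
      have t: "\<Delta> \<le> t" "0 \<le> t" using gap[OF False] gap_pos by (auto simp: t_def)
      have "t \<le> norm (x i - x j)" unfolding t_def by (rule infnorm_le_norm)
      then have "t\<^sup>2 \<le> (norm (x i - x j))\<^sup>2" using t by (intro power_mono)
      then have "r\<^sup>2 * t\<^sup>2 \<le> r\<^sup>2 * (norm (x i - x j))\<^sup>2" by (rule mult_left_mono) simp
      moreover have "r\<^sup>2 * \<Delta>\<^sup>2 \<le> r\<^sup>2 * t\<^sup>2" using t gap_pos by (intro mult_left_mono power_mono) auto
      moreover have "4 * (t - 1) \<le> r\<^sup>2 * t\<^sup>2"
      proof -
        have "2 * t\<^sup>2 \<le> r\<^sup>2 * t\<^sup>2" using rr unfolding r0 by (intro mult_right_mono) (auto intro: order_trans[rotated])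
        moreover have "0 \<le> (t - 1)\<^sup>2" by simp
        ultimately show ?thesis by (simp add: power2_diff)
      qed
      ultimately have "- r\<^sup>2 * (norm (x i - x j))\<^sup>2 / 2 \<le> - r\<^sup>2 * \<Delta>\<^sup>2 / 4 + (1 + (- 1 * t))" by simp
      then show ?thesis using False unfolding e_def t_def[symmetric] exp_add[symmetric] by simp
    qed (simp add: e_def)
    have row: "(\<Sum>j<n. e i j) \<le> 1 / 2" for i
    proof -
      have "(\<Sum>j<n. e i j) \<le> (\<Sum>j<n. exp (- r\<^sup>2 * \<Delta>\<^sup>2 / 4) * (exp 1 * exp (- 1 * infnorm (x i - x j))))"
        by (intro sum_mono eb)
      also have "\<dots> = exp (- r\<^sup>2 * \<Delta>\<^sup>2 / 4) * (exp 1 * (\<Sum>j<n. exp (- 1 * infnorm (x i - x j))))"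
        by (simp add: sum_distrib_left)
      also have "\<dots> \<le> exp (- r\<^sup>2 * \<Delta>\<^sup>2 / 4) * (exp 1 * K)" by (intro mult_left_mono K) auto
      finally show ?thesis using epsb by simp
    qed
    have sym: "e i j = e j i" for i j by (simp add: e_def norm_minus_commute)
    have col: "(\<Sum>i<n. e i j) \<le> 1 / 2" for j using row[of j] by (simp add: sym[of _ j])
    have "(\<Sum>i<n. \<Sum>j<n. a i * a j * exp (- r\<^sup>2 * (norm (x i - x j))\<^sup>2 / 2))
      = (\<Sum>i<n. \<Sum>j<n. (if j = i then (a i)\<^sup>2 else 0) + a i * a j * e i j)"
      by (intro sum.cong refl) (auto simp: e_def power2_eq_square)
    also have "\<dots> = (\<Sum>i<n. (a i)\<^sup>2) + (\<Sum>i<n. \<Sum>j<n. a i * a j * e i j)"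
      by (simp add: sum.distrib)
    finally have "\<bar>(\<Sum>i<n. \<Sum>j<n. a i * a j * exp (- r\<^sup>2 * (norm (x i - x j))\<^sup>2 / 2)) - (\<Sum>i<n. (a i)\<^sup>2)\<bar>
       = \<bar>\<Sum>i<n. \<Sum>j<n. a i * a j * e i j\<bar>" by simp
    also have "\<dots> \<le> (\<Sum>i<n. \<Sum>j<n. \<bar>a i * a j * e i j\<bar>)"
      by (rule order_trans[OF sum_abs sum_mono[OF sum_abs]])
    also have "\<dots> \<le> (\<Sum>i<n. \<Sum>j<n. ((a i)\<^sup>2 * e i j + (a j)\<^sup>2 * e i j) / 2)"
    proof (intro sum_mono)
      fix i j
      have "0 \<le> (\<bar>a i\<bar> - \<bar>a j\<bar>)\<^sup>2" by simp
      then have "\<bar>a i\<bar> * \<bar>a j\<bar> \<le> ((a i)\<^sup>2 + (a j)\<^sup>2) / 2" by (simp add: power2_diff)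
      then have "\<bar>a i\<bar> * \<bar>a j\<bar> * e i j \<le> ((a i)\<^sup>2 + (a j)\<^sup>2) / 2 * e i j" by (rule mult_right_mono) (rule e0)
      then show "\<bar>a i * a j * e i j\<bar> \<le> ((a i)\<^sup>2 * e i j + (a j)\<^sup>2 * e i j) / 2"
        using e0[of i j] by (simp add: abs_mult algebra_simps)
    qed
    also have "\<dots> = ((\<Sum>i<n. (a i)\<^sup>2 * (\<Sum>j<n. e i j)) + (\<Sum>j<n. (a j)\<^sup>2 * (\<Sum>i<n. e i j))) / 2"
    proof -
      have "(\<Sum>i<n. \<Sum>j<n. (a j)\<^sup>2 * e i j) = (\<Sum>j<n. (a j)\<^sup>2 * (\<Sum>i<n. e i j))"
        by (subst sum.swap) (simp add: sum_distrib_left)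
      then show ?thesis by (simp add: sum_divide_distrib[symmetric] sum.distrib sum_distrib_left)
    qed
    also have "\<dots> \<le> ((\<Sum>i<n. (a i)\<^sup>2 * (1 / 2)) + (\<Sum>j<n. (a j)\<^sup>2 * (1 / 2))) / 2"
      by (intro divide_right_mono add_mono sum_mono mult_left_mono row col) auto
    also have "\<dots> = (\<Sum>i<n. (a i)\<^sup>2) / 2" by (simp add: sum_divide_distrib[symmetric])
    finally show "\<bar>(\<Sum>i<n. \<Sum>j<n. a i * a j * exp (- r\<^sup>2 * (norm (x i - x j))\<^sup>2 / 2)) - (\<Sum>i<n. (a i)\<^sup>2)\<bar>
       \<le> (\<Sum>i<n. (a i)\<^sup>2) / 2" .
  qed
qed

text \<open>
  Kernels whose Fourier transform is positive and bounded below on one fixed ball have uniformly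
  coercive matrices. The radius is chosen after the width \<open>r\<close>, so large that the part of the
  Gaussian integral outside the ball takes away only a quarter of the squared norm.
\<close>
theorem positive_spectrum_coercive:
  obtains \<rho> \<kappa> where "0 < \<rho>" "0 < \<kappa>"
    "\<And>k m n a. stationary_covariance k \<Longrightarrow> integrable lebesgue k \<Longrightarrow> 0 \<le> m \<Longrightarrow>
       (\<And>f. 0 \<le> Re (fourier k f)) \<Longrightarrow> (\<And>f. norm f \<le> \<rho> \<Longrightarrow> m \<le> Re (fourier k f)) \<Longrightarrow>
       m * \<kappa> * (\<Sum>i<n. (a i)\<^sup>2) \<le> (\<Sum>i<n. \<Sum>j<n. a i * a j * k (x i - x j))"
proof -
  obtain r where r: "0 < r"
    and near: "\<And>r' n a. r \<le> r' \<Longrightarrow>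
      \<bar>(\<Sum>i<n. \<Sum>j<n. a i * a j * exp (- r'\<^sup>2 * (norm (x i - x j))\<^sup>2 / 2)) - (\<Sum>i<n. (a i)\<^sup>2)\<bar>
       \<le> (\<Sum>i<n. (a i)\<^sup>2) / 2"
    by (rule gaussian_gram_nearly_orthogonal) (rule that; assumption)
  define D where "D = CARD('d)"
  \<comment> \<open>The radius at which the tail ratio \<open>\<tau>\<close> drops below 1/6: against the widened weight the squared exponential sum integrates to at most 3/2 times the squared norm, so the tail contributes at most a quarter of it.\<close>
  define \<rho> where "\<rho> = sqrt (8 * r\<^sup>2 * (1 + ln (6 * 2 ^ D)) / 3)"
  have lnp: "0 \<le> ln (6 * 2 ^ D :: real)" proof (rule ln_ge_zero)
    have "(1::real) \<le> 2 ^ D" by simp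
    then show "(1::real) \<le> 6 * 2 ^ D" by linarith
  qed
  have rho2: "\<rho>\<^sup>2 = 8 * r\<^sup>2 * (1 + ln (6 * 2 ^ D)) / 3" unfolding \<rho>_def using lnp by simp
  have rho: "0 < \<rho>" unfolding \<rho>_def using lnp r by (simp add: add_pos_nonneg)
  define \<tau> where "\<tau> = 2 ^ D * exp (- 3 * \<rho>\<^sup>2 / (8 * r\<^sup>2))"
  have tau: "\<tau> \<le> 1 / 6"
  proof -
    have r8: "8 * r\<^sup>2 \<noteq> 0" using r by simp
    have "3 * \<rho>\<^sup>2 = (1 + ln (6 * 2 ^ D)) * (8 * r\<^sup>2)" unfolding rho2 by simp
    then have "3 * \<rho>\<^sup>2 / (8 * r\<^sup>2) = 1 + ln (6 * 2 ^ D)" by (simp only: nonzero_mult_div_cancel_right[OF r8])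
    then have "- 3 * \<rho>\<^sup>2 / (8 * r\<^sup>2) = - (1 + ln (6 * 2 ^ D))"
      by (simp only: minus_mult_left[symmetric] minus_divide_left[symmetric])
    then have "\<tau> \<le> 2 ^ D * exp (- ln (6 * 2 ^ D))" unfolding \<tau>_def by simp
    also have "\<dots> = 1 / 6" by (simp add: exp_minus)
    finally show ?thesis .
  qed
  \<comment> \<open>The normalisation of the averaging density in the spectral inequality.\<close>
  define J where "J = gauss_mass r TYPE(real ^ 'd)"
  have J: "0 < J" unfolding J_def by (rule gauss_mass_pos[OF r])
  define \<kappa> where "\<kappa> = (2 * pi) powr real CARD('d) / (4 * J)"
  show thesis
  proof (rule that[OF rho])
    show "0 < \<kappa>" unfolding \<kappa>_def using J by simp
    fix k :: "real ^ 'd \<Rightarrow> real" and m n and a :: "nat \<Rightarrow> real"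
    assume st: "stationary_covariance k" and k: "integrable lebesgue k" and m: "0 \<le> m"
      and nn: "\<And>f. 0 \<le> Re (fourier k f)" and low: "\<And>f. norm f \<le> \<rho> \<Longrightarrow> m \<le> Re (fourier k f)"
    define A where "A = (\<Sum>i<n. (a i)\<^sup>2)"
    note i1 = gauss_weight_exp_sum_sq(1)[OF r, where n=n and a=a and x=x] and e1 = gauss_weight_exp_sum_sq(2)[OF r, where n=n and a=a and x=x]
    have r2: "0 < 2 * r" using r by simp
    note i2 = gauss_weight_exp_sum_sq(1)[OF r2, where n=n and a=a and x=x] and e2 = gauss_weight_exp_sum_sq(2)[OF r2, where n=n and a=a and x=x]
    have "m * (A / 4) \<le> m * ((\<integral>u. gauss_weight r u * exp_sum_sq n a x u \<partial>lborel) - \<tau> * (\<integral>u. gauss_weight (2 * r) u * exp_sum_sq n a x u \<partial>lborel))"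
    proof (rule mult_left_mono[OF _ m])
      have "A / 2 \<le> (\<integral>u. gauss_weight r u * exp_sum_sq n a x u \<partial>lborel)"
        unfolding e1 using near[OF order_refl, of a n] unfolding A_def[symmetric] abs_le_iff by linarith
      moreover have "(\<integral>u. gauss_weight (2 * r) u * exp_sum_sq n a x u \<partial>lborel) \<le> 3 / 2 * A"
        unfolding e2 using near[of "2 * r" a n] r unfolding A_def[symmetric] abs_le_iff by linarith
      then have "\<tau> * (\<integral>u. gauss_weight (2 * r) u * exp_sum_sq n a x u \<partial>lborel) \<le> 1 / 6 * (3 / 2 * A)"
        by (rule mult_mono[OF tau]) (auto intro!: Bochner_Integration.integral_nonneg mult_nonneg_nonneg exp_sum_sq_nonneg less_imp_le[OF gauss_weight_pos[OF r2]])
      ultimately show "A / 4 \<le> (\<integral>u. gauss_weight r u * exp_sum_sq n a x u \<partial>lborel) - \<tau> * (\<integral>u. gauss_weight (2 * r) u * exp_sum_sq n a x u \<partial>lborel)"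
        by simp
    qed
    also have "\<dots> = (\<integral>u. m * (gauss_weight r u * exp_sum_sq n a x u - \<tau> * (gauss_weight (2 * r) u * exp_sum_sq n a x u)) \<partial>lborel)"
      using i1 i2 by simp
    also have "\<dots> \<le> (\<integral>u. gauss_weight r u * exp_sum_sq n a x u * Re (fourier k u) \<partial>lborel)"
    proof (rule integral_mono)
      show "integrable lborel (\<lambda>u. m * (gauss_weight r u * exp_sum_sq n a x u - \<tau> * (gauss_weight (2 * r) u * exp_sum_sq n a x u)))"
        using i1 i2 by simp
      show "integrable lborel (\<lambda>u. gauss_weight r u * exp_sum_sq n a x u * Re (fourier k u))"
        by (rule spectral_inequality[OF st k r])
      fix u :: "real ^ 'd"
      have p: "0 \<le> gauss_weight r u * exp_sum_sq n a x u" "0 \<le> gauss_weight (2 * r) u * exp_sum_sq n a x u"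
        using gauss_weight_pos[OF r, of u] gauss_weight_pos[OF r2, of u] exp_sum_sq_nonneg[of n a x u] by auto
      have t0: "0 \<le> \<tau>" unfolding \<tau>_def by simp
      show "m * (gauss_weight r u * exp_sum_sq n a x u - \<tau> * (gauss_weight (2 * r) u * exp_sum_sq n a x u)) \<le> gauss_weight r u * exp_sum_sq n a x u * Re (fourier k u)"
      proof (cases "norm u \<le> \<rho>")
        case True
        have "m * (gauss_weight r u * exp_sum_sq n a x u - \<tau> * (gauss_weight (2 * r) u * exp_sum_sq n a x u)) \<le> m * (gauss_weight r u * exp_sum_sq n a x u)"
          using m t0 p by (intro mult_left_mono) auto
        also have "\<dots> \<le> Re (fourier k u) * (gauss_weight r u * exp_sum_sq n a x u)"
          by (intro mult_right_mono low True p)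
        finally show ?thesis by (simp add: mult_ac)
      next
        case False
        then have "gauss_weight r u \<le> \<tau> * gauss_weight (2 * r) u"
          using gauss_weight_tail[OF r, of \<rho> u] rho unfolding \<tau>_def D_def by simp
        then have "gauss_weight r u * exp_sum_sq n a x u \<le> \<tau> * gauss_weight (2 * r) u * exp_sum_sq n a x u"
          by (rule mult_right_mono) (rule exp_sum_sq_nonneg)
        then have "m * (gauss_weight r u * exp_sum_sq n a x u - \<tau> * (gauss_weight (2 * r) u * exp_sum_sq n a x u)) \<le> 0"
          using m by (intro mult_nonneg_nonpos) auto
        also have "0 \<le> gauss_weight r u * exp_sum_sq n a x u * Re (fourier k u)" by (intro mult_nonneg_nonneg p nn)
        finally show ?thesis .
      qed
    qed
    finally have "(2 * pi) powr real CARD('d) * (m * (A / 4))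
       \<le> (2 * pi) powr real CARD('d) * (\<integral>u. gauss_weight r u * exp_sum_sq n a x u * Re (fourier k u) \<partial>lborel)"
      by (intro mult_left_mono) auto
    also have "\<dots> \<le> J * (\<Sum>i<n. \<Sum>j<n. a i * a j * k (x i - x j))"
      unfolding J_def by (rule spectral_inequality[OF st k r])
    finally have fin: "(2 * pi) powr real CARD('d) * (m * (A / 4)) \<le> J * (\<Sum>i<n. \<Sum>j<n. a i * a j * k (x i - x j))" .
    have "m * \<kappa> * A = ((2 * pi) powr real CARD('d) * (m * (A / 4))) / J"
      unfolding \<kappa>_def by simp
    also have "\<dots> \<le> (J * (\<Sum>i<n. \<Sum>j<n. a i * a j * k (x i - x j))) / J"
      by (rule divide_right_mono[OF fin]) (use J in simp)
    also have "\<dots> = (\<Sum>i<n. \<Sum>j<n. a i * a j * k (x i - x j))" using J by simp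
    finally show "m * \<kappa> * (\<Sum>i<n. (a i)\<^sup>2) \<le> (\<Sum>i<n. \<Sum>j<n. a i * a j * k (x i - x j))"
      unfolding A_def .
  qed
qed

end

section \<open>Joint laws are determined by characteristic functions\<close>

text \<open>
  Normalising the weight \<open>V\<close> turns the claim into the uniqueness theorem for characteristic functions
  on the line.
\<close>
lemma weighted_law_unique:
  fixes V X :: "'a \<Rightarrow> real" and V' X' :: "'b \<Rightarrow> real"
  assumes "prob_space M" and "prob_space N"
    and V[measurable]: "V \<in> borel_measurable M" and X[measurable]: "X \<in> borel_measurable M"
    and V'[measurable]: "V' \<in> borel_measurable N" and X'[measurable]: "X' \<in> borel_measurable N"
    and b: "\<And>\<omega>. 0 \<le> V \<omega>" "\<And>\<omega>. V \<omega> \<le> b" "\<And>\<omega>. 0 \<le> V' \<omega>" "\<And>\<omega>. V' \<omega> \<le> b"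
    and eq: "\<And>t. (\<integral>\<omega>. complex_of_real (V \<omega>) * iexp (t * X \<omega>) \<partial>M) = (\<integral>\<omega>. complex_of_real (V' \<omega>) * iexp (t * X' \<omega>) \<partial>N)"
    and A[measurable]: "A \<in> sets borel"
  shows "(\<integral>\<omega>. V \<omega> * indicator A (X \<omega>) \<partial>M) = (\<integral>\<omega>. V' \<omega> * indicator A (X' \<omega>) \<partial>N)"
proof -
  interpret M: prob_space M by fact
  interpret N: prob_space N by fact
  have iV: "integrable M V" by (rule M.integrable_const_bound[where B=b]) (use b in auto)
  have iV': "integrable N V'" by (rule N.integrable_const_bound[where B=b]) (use b in auto)
  define m where "m = (\<integral>\<omega>. V \<omega> \<partial>M)"
  have m': "m = (\<integral>\<omega>. V' \<omega> \<partial>N)"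
    using eq[of 0] unfolding m_def by simp
  show ?thesis
  proof (cases "m = 0")
    case True
    then have "AE \<omega> in M. V \<omega> = 0" "AE \<omega> in N. V' \<omega> = 0"
      using integral_nonneg_eq_0_iff_AE[OF iV] integral_nonneg_eq_0_iff_AE[OF iV'] b m' unfolding m_def by auto
    then have "(\<integral>\<omega>. V \<omega> * indicator A (X \<omega>) \<partial>M) = 0" "(\<integral>\<omega>. V' \<omega> * indicator A (X' \<omega>) \<partial>N) = 0"
      by (auto intro!: integral_eq_zero_AE)
    then show ?thesis by simp
  next
    case False
    have m: "0 < m" using False b(1) by (simp add: m_def less_le)
    have gen: "real_distribution (distr (density L (\<lambda>\<omega>. ennreal (U \<omega> / m))) borel Y) \<and>
        char (distr (density L (\<lambda>\<omega>. ennreal (U \<omega> / m))) borel Y) t = (\<integral>\<omega>. complex_of_real (U \<omega>) * iexp (t * Y \<omega>) \<partial>L) / m \<and>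
        measure (distr (density L (\<lambda>\<omega>. ennreal (U \<omega> / m))) borel Y) A = (\<integral>\<omega>. U \<omega> * indicator A (Y \<omega>) \<partial>L) / m"
      if "prob_space L" and U[measurable]: "U \<in> borel_measurable L" and Y[measurable]: "Y \<in> borel_measurable L"
        and iU: "integrable L U" and U0: "\<And>\<omega>. 0 \<le> U \<omega>" and mU: "m = (\<integral>\<omega>. U \<omega> \<partial>L)"
      for L :: "'c measure" and U Y t
    proof -
      let ?D = "density L (\<lambda>\<omega>. ennreal (U \<omega> / m))"
      have "emeasure ?D (space ?D) = (\<integral>\<^sup>+\<omega>. ennreal (U \<omega> / m) \<partial>L)"
        by (simp add: emeasure_density cong: nn_integral_cong)
      also have "\<dots> = ennreal (\<integral>\<omega>. U \<omega> / m \<partial>L)"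
        by (rule nn_integral_eq_integral) (use iU U0 m in auto)
      also have "\<dots> = 1" using m mU by simp
      finally have D: "prob_space ?D" by (rule prob_spaceI)
      have Ym: "Y \<in> borel_measurable ?D" by simp
      have "prob_space (distr ?D borel Y)" by (rule prob_space.prob_space_distr[OF D]) measurable
      then have 1: "real_distribution (distr ?D borel Y)"
        by (auto simp: real_distribution_def real_distribution_axioms_def)
      have "char (distr ?D borel Y) t = (\<integral>\<omega>. iexp (t * Y \<omega>) \<partial>?D)"
        unfolding char_def by (rule integral_distr) measurable
      also have "\<dots> = (\<integral>\<omega>. (U \<omega> / m) *\<^sub>R iexp (t * Y \<omega>) \<partial>L)"
        by (rule integral_density) (use U0 m in auto)
      also have "\<dots> = (\<integral>\<omega>. complex_of_real (U \<omega>) * iexp (t * Y \<omega>) / m \<partial>L)"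
        by (simp add: scaleR_conv_of_real)
      finally have 2: "char (distr ?D borel Y) t = (\<integral>\<omega>. complex_of_real (U \<omega>) * iexp (t * Y \<omega>) \<partial>L) / m" by simp
      have "measure (distr ?D borel Y) A = (\<integral>z. indicator A z \<partial>distr ?D borel Y)" by simp
      also have "\<dots> = (\<integral>\<omega>. indicator A (Y \<omega>) \<partial>?D)" by (rule integral_distr) measurable
      also have "\<dots> = (\<integral>\<omega>. (U \<omega> / m) *\<^sub>R indicator A (Y \<omega>) \<partial>L)"
        by (rule integral_density) (use U0 m in auto)
      finally have 3: "measure (distr ?D borel Y) A = (\<integral>\<omega>. U \<omega> * indicator A (Y \<omega>) \<partial>L) / m" by simp
      show ?thesis using 1 2 3 by blast
    qed
    note g1 = gen[OF \<open>prob_space M\<close> V X iV b(1) m_def] and g2 = gen[OF \<open>prob_space N\<close> V' X' iV' b(3) m']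
    have "distr (density M (\<lambda>\<omega>. ennreal (V \<omega> / m))) borel X = distr (density N (\<lambda>\<omega>. ennreal (V' \<omega> / m))) borel X'"
      by (rule Levy_uniqueness) (use g1 g2 eq in auto)
    then show ?thesis using g1 g2 m by simp
  qed
qed

text \<open>
  The weight \<open>1 + Re W\<close> is nonnegative, and its Fourier transforms are determined by those of \<open>W\<close>,
  by complex conjugation.
\<close>
lemma complex_weighted_law_unique_Re:
  fixes X :: "'a \<Rightarrow> real" and X' :: "'b \<Rightarrow> real" and W :: "'a \<Rightarrow> complex" and W' :: "'b \<Rightarrow> complex"
  assumes "prob_space M" and "prob_space N"
    and W[measurable]: "W \<in> borel_measurable M" and X[measurable]: "X \<in> borel_measurable M"
    and W'[measurable]: "W' \<in> borel_measurable N" and X'[measurable]: "X' \<in> borel_measurable N"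
    and b: "\<And>\<omega>. norm (W \<omega>) \<le> 1" "\<And>\<omega>. norm (W' \<omega>) \<le> 1"
    and eq: "\<And>t. (\<integral>\<omega>. W \<omega> * iexp (t * X \<omega>) \<partial>M) = (\<integral>\<omega>. W' \<omega> * iexp (t * X' \<omega>) \<partial>N)"
    and eq1: "\<And>t. (\<integral>\<omega>. iexp (t * X \<omega>) \<partial>M) = (\<integral>\<omega>. iexp (t * X' \<omega>) \<partial>N)"
    and A[measurable]: "A \<in> sets borel"
  shows "Re (\<integral>\<omega>. W \<omega> * indicator A (X \<omega>) \<partial>M) = Re (\<integral>\<omega>. W' \<omega> * indicator A (X' \<omega>) \<partial>N)"
proof -
  have gen: "(\<integral>\<omega>. complex_of_real (1 + Re (U \<omega>)) * iexp (t * Y \<omega>) \<partial>L)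
        = (\<integral>\<omega>. iexp (t * Y \<omega>) \<partial>L) + ((\<integral>\<omega>. U \<omega> * iexp (t * Y \<omega>) \<partial>L) + cnj (\<integral>\<omega>. U \<omega> * iexp (- t * Y \<omega>) \<partial>L)) / 2
      \<and> (\<integral>\<omega>. (1 + Re (U \<omega>)) * indicator A (Y \<omega>) \<partial>L) = (\<integral>\<omega>. 1 * indicator A (Y \<omega>) \<partial>L) + Re (\<integral>\<omega>. U \<omega> * indicator A (Y \<omega>) \<partial>L)"
    if "prob_space L" and U[measurable]: "U \<in> borel_measurable L" and Y[measurable]: "Y \<in> borel_measurable L"
      and b: "\<And>\<omega>. norm (U \<omega>) \<le> 1" for L :: "'c measure" and U Y t
  proof -
    interpret L: prob_space L by fact
    have i1: "integrable L (\<lambda>\<omega>. iexp (t * Y \<omega>))" for t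
      by (rule L.integrable_const_bound[where B=1]) auto
    have i2: "integrable L (\<lambda>\<omega>. U \<omega> * iexp (t * Y \<omega>))" for t
      by (rule L.integrable_const_bound[where B=1]) (use b in \<open>auto simp: norm_mult\<close>)
    have i3: "integrable L (\<lambda>\<omega>. U \<omega> * indicator A (Y \<omega>))"
      by (rule L.integrable_const_bound[where B=1]) (use b in \<open>auto simp: norm_mult split: split_indicator\<close>)
    have i4: "integrable L (\<lambda>\<omega>. 1 * indicator A (Y \<omega>) :: real)"
      by (rule L.integrable_const_bound[where B=1]) (auto split: split_indicator)
    have pt: "complex_of_real (1 + Re (U \<omega>)) * iexp (t * Y \<omega>)
       = iexp (t * Y \<omega>) + (U \<omega> * iexp (t * Y \<omega>) + cnj (U \<omega> * iexp (- t * Y \<omega>))) / 2" for \<omega>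
    proof -
      have "cnj (iexp (- t * Y \<omega>)) = iexp (t * Y \<omega>)" by (simp add: exp_cnj)
      moreover have "complex_of_real (Re (U \<omega>)) = (U \<omega> + cnj (U \<omega>)) / 2" by (simp add: complex_eq_iff)
      ultimately show ?thesis by (simp add: algebra_simps add_divide_distrib)
    qed
    have "(\<integral>\<omega>. complex_of_real (1 + Re (U \<omega>)) * iexp (t * Y \<omega>) \<partial>L)
      = (\<integral>\<omega>. iexp (t * Y \<omega>) \<partial>L) + (\<integral>\<omega>. (U \<omega> * iexp (t * Y \<omega>) + cnj (U \<omega> * iexp (- t * Y \<omega>))) / 2 \<partial>L)"
      unfolding pt using i1 i2[of t] i2[of "- t"]
      by (intro Bochner_Integration.integral_add integrable_divide Bochner_Integration.integrable_add) (simp_all only: integrable_cnj)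
    also have "(\<integral>\<omega>. (U \<omega> * iexp (t * Y \<omega>) + cnj (U \<omega> * iexp (- t * Y \<omega>))) / 2 \<partial>L)
       = ((\<integral>\<omega>. U \<omega> * iexp (t * Y \<omega>) \<partial>L) + (\<integral>\<omega>. cnj (U \<omega> * iexp (- t * Y \<omega>)) \<partial>L)) / 2"
      unfolding integral_divide_zero
      using i2[of t] i2[of "- t"] by (subst Bochner_Integration.integral_add) (simp_all only: integrable_cnj)
    also have "(\<integral>\<omega>. cnj (U \<omega> * iexp (- t * Y \<omega>)) \<partial>L) = cnj (\<integral>\<omega>. U \<omega> * iexp (- t * Y \<omega>) \<partial>L)"
      by (rule Bochner_Integration.integral_cnj)
    finally have 1: "(\<integral>\<omega>. complex_of_real (1 + Re (U \<omega>)) * iexp (t * Y \<omega>) \<partial>L)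
        = (\<integral>\<omega>. iexp (t * Y \<omega>) \<partial>L) + ((\<integral>\<omega>. U \<omega> * iexp (t * Y \<omega>) \<partial>L) + cnj (\<integral>\<omega>. U \<omega> * iexp (- t * Y \<omega>) \<partial>L)) / 2" .
    have "(\<integral>\<omega>. (1 + Re (U \<omega>)) * indicator A (Y \<omega>) \<partial>L)
       = (\<integral>\<omega>. 1 * indicator A (Y \<omega>) + Re (U \<omega> * indicator A (Y \<omega>)) \<partial>L)"
      by (intro Bochner_Integration.integral_cong refl) (auto split: split_indicator)
    also have "\<dots> = (\<integral>\<omega>. 1 * indicator A (Y \<omega>) \<partial>L) + (\<integral>\<omega>. Re (U \<omega> * indicator A (Y \<omega>)) \<partial>L)"
      by (intro Bochner_Integration.integral_add i4 integrable_Re i3)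
    also have "(\<integral>\<omega>. Re (U \<omega> * indicator A (Y \<omega>)) \<partial>L) = Re (\<integral>\<omega>. U \<omega> * indicator A (Y \<omega>) \<partial>L)"
      by (rule integral_Re[OF i3])
    finally show ?thesis using 1 by blast
  qed
  note gM = gen[OF \<open>prob_space M\<close> W X b(1)] and gN = gen[OF \<open>prob_space N\<close> W' X' b(2)]
  have re: "- 1 \<le> Re (W \<omega>)" "Re (W \<omega>) \<le> 1" for \<omega> using abs_Re_le_cmod[of "W \<omega>"] b(1)[of \<omega>] by auto
  have re': "- 1 \<le> Re (W' \<omega>)" "Re (W' \<omega>) \<le> 1" for \<omega> using abs_Re_le_cmod[of "W' \<omega>"] b(2)[of \<omega>] by auto
  have "(\<integral>\<omega>. (1 + Re (W \<omega>)) * indicator A (X \<omega>) \<partial>M) = (\<integral>\<omega>. (1 + Re (W' \<omega>)) * indicator A (X' \<omega>) \<partial>N)"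
  proof (rule weighted_law_unique[where b=2])
    show "(\<integral>\<omega>. complex_of_real (1 + Re (W \<omega>)) * iexp (t * X \<omega>) \<partial>M) = (\<integral>\<omega>. complex_of_real (1 + Re (W' \<omega>)) * iexp (t * X' \<omega>) \<partial>N)" for t
      using gM[of t] gN[of t] by (simp only: eq eq1)
    show "0 \<le> 1 + Re (W \<omega>)" "1 + Re (W \<omega>) \<le> 2" for \<omega> using re[of \<omega>] by auto
    show "0 \<le> 1 + Re (W' \<omega>)" "1 + Re (W' \<omega>) \<le> 2" for \<omega> using re'[of \<omega>] by auto
  qed (use assms in auto)
  moreover have "(\<integral>\<omega>. 1 * indicator A (X \<omega>) \<partial>M) = (\<integral>\<omega>. (1::real) * indicator A (X' \<omega>) \<partial>N)"
    by (rule weighted_law_unique[where b=1]) (use assms in auto)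
  ultimately show ?thesis using gM gN by simp
qed

lemma complex_weighted_law_unique:
  fixes X :: "'a \<Rightarrow> real" and X' :: "'b \<Rightarrow> real" and W :: "'a \<Rightarrow> complex" and W' :: "'b \<Rightarrow> complex"
  assumes MN: "prob_space M" "prob_space N"
    and W: "W \<in> borel_measurable M" and X: "X \<in> borel_measurable M"
    and W': "W' \<in> borel_measurable N" and X': "X' \<in> borel_measurable N"
    and b: "\<And>\<omega>. norm (W \<omega>) \<le> 1" "\<And>\<omega>. norm (W' \<omega>) \<le> 1"
    and eq: "\<And>t. (\<integral>\<omega>. W \<omega> * iexp (t * X \<omega>) \<partial>M) = (\<integral>\<omega>. W' \<omega> * iexp (t * X' \<omega>) \<partial>N)"
    and eq1: "\<And>t. (\<integral>\<omega>. iexp (t * X \<omega>) \<partial>M) = (\<integral>\<omega>. iexp (t * X' \<omega>) \<partial>N)"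
    and A: "A \<in> sets borel"
  shows "(\<integral>\<omega>. W \<omega> * indicator A (X \<omega>) \<partial>M) = (\<integral>\<omega>. W' \<omega> * indicator A (X' \<omega>) \<partial>N)"
proof (rule complex_eqI)
  show "Re (\<integral>\<omega>. W \<omega> * indicator A (X \<omega>) \<partial>M) = Re (\<integral>\<omega>. W' \<omega> * indicator A (X' \<omega>) \<partial>N)"
    by (rule complex_weighted_law_unique_Re[OF assms])
  have "Re (\<integral>\<omega>. (- \<i> * W \<omega>) * indicator A (X \<omega>) \<partial>M) = Re (\<integral>\<omega>. (- \<i> * W' \<omega>) * indicator A (X' \<omega>) \<partial>N)"
  proof (rule complex_weighted_law_unique_Re[OF MN _ X _ X' _ _ _ eq1 A])
    show "(\<integral>\<omega>. (- \<i> * W \<omega>) * iexp (t * X \<omega>) \<partial>M) = (\<integral>\<omega>. (- \<i> * W' \<omega>) * iexp (t * X' \<omega>) \<partial>N)" for t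
      by (simp only: mult.assoc integral_mult_right_zero eq)
  qed (use W W' b in \<open>auto simp: norm_mult\<close>)
  then show "Im (\<integral>\<omega>. W \<omega> * indicator A (X \<omega>) \<partial>M) = Im (\<integral>\<omega>. W' \<omega> * indicator A (X' \<omega>) \<partial>N)"
    by (simp add: mult.assoc)
qed

text \<open>
  The exponentials are replaced by indicators of Borel sets one coordinate at a time; the factors
  of the other coordinates serve as a weight of modulus at most one.
\<close>
theorem joint_law_unique:
  fixes X :: "'i \<Rightarrow> 'a \<Rightarrow> real" and X' :: "'i \<Rightarrow> 'b \<Rightarrow> real"
  assumes MN: "prob_space M" "prob_space N" and I: "finite I"
    and X[measurable]: "\<And>i. i \<in> I \<Longrightarrow> X i \<in> borel_measurable M"
    and X'[measurable]: "\<And>i. i \<in> I \<Longrightarrow> X' i \<in> borel_measurable N"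
    and eq: "\<And>t. (\<integral>\<omega>. iexp (\<Sum>i\<in>I. t i * X i \<omega>) \<partial>M) = (\<integral>\<omega>. iexp (\<Sum>i\<in>I. t i * X' i \<omega>) \<partial>N)"
  shows "distr M (Pi\<^sub>M I (\<lambda>_. borel)) (\<lambda>\<omega>. \<lambda>i\<in>I. X i \<omega>) = distr N (Pi\<^sub>M I (\<lambda>_. borel)) (\<lambda>\<omega>. \<lambda>i\<in>I. X' i \<omega>)"
proof -
  interpret M: prob_space M by fact
  interpret N: prob_space N by fact
  have step: "(\<integral>\<omega>. (\<Prod>j\<in>J. indicator (A j) (X j \<omega>)) * iexp (\<Sum>i\<in>I - J. t i * X i \<omega>) \<partial>M)
      = (\<integral>\<omega>. (\<Prod>j\<in>J. indicator (A j) (X' j \<omega>)) * iexp (\<Sum>i\<in>I - J. t i * X' i \<omega>) \<partial>N)"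
    if "finite J" "J \<subseteq> I" "\<And>j. j \<in> J \<Longrightarrow> A j \<in> sets borel" for J A t
    using that
  proof (induction J arbitrary: t rule: finite_induct)
    case empty
    then show ?case using eq[of t] by simp
  next
    case (insert k J)
    have k: "k \<in> I" "k \<notin> J" using insert by auto
    have Aj[measurable]: "A j \<in> sets borel" if "j \<in> insert k J" for j using insert that by auto
    have sub: "\<And>j. j \<in> J \<Longrightarrow> j \<in> I" using insert by auto
    have M[measurable]: "(\<lambda>\<omega>. (\<Prod>j\<in>J. indicator (A j) (X j \<omega>)) * iexp (\<Sum>i\<in>I - insert k J. t i * X i \<omega>)) \<in> borel_measurable M"
      using sub by (intro borel_measurable_times borel_measurable_prod) measurable
    have N[measurable]: "(\<lambda>\<omega>. (\<Prod>j\<in>J. indicator (A j) (X' j \<omega>)) * iexp (\<Sum>i\<in>I - insert k J. t i * X' i \<omega>)) \<in> borel_measurable N"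
      using sub by (intro borel_measurable_times borel_measurable_prod) measurable
    have bound: "norm ((\<Prod>j\<in>J. indicator (A j) (z j)) * iexp s) \<le> 1" for z :: "'i \<Rightarrow> real" and s :: real
    proof -
      have "norm (\<Prod>j\<in>J. indicator (A j) (z j) :: complex) = (\<Prod>j\<in>J. norm (indicator (A j) (z j) :: complex))"
        by (rule prod_norm[symmetric])
      also have "\<dots> \<le> 1" by (rule prod_le_1) (auto split: split_indicator)
      finally show ?thesis by (simp only: norm_mult norm_exp_i_times mult_1_right)
    qed
    have split: "(\<Sum>i\<in>I - J. (t(k := s)) i * z i) = (\<Sum>i\<in>I - insert k J. t i * z i) + s * z k"
      for z :: "'i \<Rightarrow> real" and s
    proof -
      have d: "I - J - {k} = I - insert k J" by auto
      have "(\<Sum>i\<in>I - J. (t(k := s)) i * z i) = (t(k := s)) k * z k + (\<Sum>i\<in>I - insert k J. (t(k := s)) i * z i)"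
        unfolding d[symmetric] by (rule sum.remove) (use I k in auto)
      also have "(t(k := s)) k * z k = s * z k" by simp
      also have "(\<Sum>i\<in>I - insert k J. (t(k := s)) i * z i) = (\<Sum>i\<in>I - insert k J. t i * z i)"
        by (intro sum.cong) auto
      finally show ?thesis by (simp only: add.commute)
    qed
    have ie: "iexp (p + q) = iexp p * iexp q" for p q :: real
      by (simp add: ring_distribs exp_add)
    have "(\<integral>\<omega>. ((\<Prod>j\<in>J. indicator (A j) (X j \<omega>)) * iexp (\<Sum>i\<in>I - insert k J. t i * X i \<omega>)) * indicator (A k) (X k \<omega>) \<partial>M)
       = (\<integral>\<omega>. ((\<Prod>j\<in>J. indicator (A j) (X' j \<omega>)) * iexp (\<Sum>i\<in>I - insert k J. t i * X' i \<omega>)) * indicator (A k) (X' k \<omega>) \<partial>N)"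
    proof (rule complex_weighted_law_unique[OF MN M X[OF k(1)] N X'[OF k(1)] bound bound _ _ Aj])
      fix s
      have "(\<integral>\<omega>. (\<Prod>j\<in>J. indicator (A j) (X j \<omega>)) * iexp (\<Sum>i\<in>I - J. (t(k := s)) i * X i \<omega>) \<partial>M)
         = (\<integral>\<omega>. (\<Prod>j\<in>J. indicator (A j) (X' j \<omega>)) * iexp (\<Sum>i\<in>I - J. (t(k := s)) i * X' i \<omega>) \<partial>N)"
        by (rule insert.IH) (use insert in auto)
      then show "(\<integral>\<omega>. (\<Prod>j\<in>J. indicator (A j) (X j \<omega>)) * iexp (\<Sum>i\<in>I - insert k J. t i * X i \<omega>) * iexp (s * X k \<omega>) \<partial>M)
         = (\<integral>\<omega>. (\<Prod>j\<in>J. indicator (A j) (X' j \<omega>)) * iexp (\<Sum>i\<in>I - insert k J. t i * X' i \<omega>) * iexp (s * X' k \<omega>) \<partial>N)"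
        unfolding split ie by (simp only: mult.assoc)
      have z: "(\<Sum>i\<in>I. (if i = k then s else 0) * z i) = s * z k" for z :: "'i \<Rightarrow> real"
        using I k by (simp add: mult_delta_left)
      show "(\<integral>\<omega>. iexp (s * X k \<omega>) \<partial>M) = (\<integral>\<omega>. iexp (s * X' k \<omega>) \<partial>N)"
        using eq[of "\<lambda>i. if i = k then s else 0"] unfolding z .
    qed auto
    then show ?case unfolding prod.insert[OF insert.hyps(1,2)] by (simp only: mult_ac)
  qed
  have box: "emeasure (distr L (Pi\<^sub>M I (\<lambda>_. borel)) (\<lambda>\<omega>. \<lambda>i\<in>I. Y i \<omega>)) (Pi\<^sub>E I A)
      = ennreal (Re (\<integral>\<omega>. (\<Prod>j\<in>I. indicator (A j) (Y j \<omega>)) \<partial>L))"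
    if "prob_space L" and Y[measurable]: "\<And>i. i \<in> I \<Longrightarrow> Y i \<in> borel_measurable L"
      and A[measurable]: "\<And>i. i \<in> I \<Longrightarrow> A i \<in> sets borel" for L :: "'c measure" and Y A
  proof -
    interpret L: prob_space L by fact
    have "emeasure (distr L (Pi\<^sub>M I (\<lambda>_. borel)) (\<lambda>\<omega>. \<lambda>i\<in>I. Y i \<omega>)) (Pi\<^sub>E I A)
       = emeasure L ((\<lambda>\<omega>. \<lambda>i\<in>I. Y i \<omega>) -` (Pi\<^sub>E I A) \<inter> space L)"
      by (rule emeasure_distr) (use I in \<open>auto intro!: sets_PiM_I_finite\<close>)
    also have "(\<lambda>\<omega>. \<lambda>i\<in>I. Y i \<omega>) -` (Pi\<^sub>E I A) \<inter> space L = {\<omega>\<in>space L. \<forall>i\<in>I. Y i \<omega> \<in> A i}"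
      by (auto simp: PiE_iff)
    also have "emeasure L {\<omega>\<in>space L. \<forall>i\<in>I. Y i \<omega> \<in> A i} = ennreal (measure L {\<omega>\<in>space L. \<forall>i\<in>I. Y i \<omega> \<in> A i})"
      by (rule L.emeasure_eq_measure)
    also have "measure L {\<omega>\<in>space L. \<forall>i\<in>I. Y i \<omega> \<in> A i} = Re (\<integral>\<omega>. (\<Prod>j\<in>I. indicator (A j) (Y j \<omega>)) \<partial>L)"
    proof -
      have S: "{\<omega>\<in>space L. \<forall>i\<in>I. Y i \<omega> \<in> A i} \<in> sets L"
        using I by measurable
      have "(\<integral>\<omega>. (\<Prod>j\<in>I. indicator (A j) (Y j \<omega>)) \<partial>L) = (\<integral>\<omega>. complex_of_real (indicator {\<omega>\<in>space L. \<forall>i\<in>I. Y i \<omega> \<in> A i} \<omega>) \<partial>L)"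
      proof (intro Bochner_Integration.integral_cong refl)
        fix \<omega> assume w: "\<omega> \<in> space L"
        show "(\<Prod>j\<in>I. indicator (A j) (Y j \<omega>)) = complex_of_real (indicator {\<omega>\<in>space L. \<forall>i\<in>I. Y i \<omega> \<in> A i} \<omega>)"
          using I w by (cases "\<forall>i\<in>I. Y i \<omega> \<in> A i") (auto simp: prod_zero_iff indicator_def)
      qed
      also have "\<dots> = complex_of_real (measure L {\<omega>\<in>space L. \<forall>i\<in>I. Y i \<omega> \<in> A i})"
        using S by simp
      finally show ?thesis by simp
    qed
    finally show ?thesis .
  qed
  show ?thesis
  proof (rule measure_eqI_PiM_finite[OF I, of _ "\<lambda>_. borel" _ "\<lambda>_. Pi\<^sub>E I (\<lambda>_. UNIV)"])
    fix A :: "'i \<Rightarrow> real set" assume A: "\<And>i. i \<in> I \<Longrightarrow> A i \<in> sets borel"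
    show "emeasure (distr M (Pi\<^sub>M I (\<lambda>_. borel)) (\<lambda>\<omega>. \<lambda>i\<in>I. X i \<omega>)) (Pi\<^sub>E I A)
        = emeasure (distr N (Pi\<^sub>M I (\<lambda>_. borel)) (\<lambda>\<omega>. \<lambda>i\<in>I. X' i \<omega>)) (Pi\<^sub>E I A)"
      using step[of I A "\<lambda>_. 0", OF I subset_refl A] box[OF MN(1) X A] box[OF MN(2) X' A] by simp
  next
    have "prob_space (distr M (Pi\<^sub>M I (\<lambda>_. borel)) (\<lambda>\<omega>. \<lambda>i\<in>I. X i \<omega>))"
      by (rule M.prob_space_distr) measurable
    then interpret D: prob_space "distr M (Pi\<^sub>M I (\<lambda>_. borel)) (\<lambda>\<omega>. \<lambda>i\<in>I. X i \<omega>)" .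
    show "emeasure (distr M (Pi\<^sub>M I (\<lambda>_. borel)) (\<lambda>\<omega>. \<lambda>i\<in>I. X i \<omega>)) (Pi\<^sub>E I (\<lambda>_. UNIV)) \<noteq> \<infinity>" for i :: nat
      using D.emeasure_finite[of "Pi\<^sub>E I (\<lambda>_. UNIV)"] by (simp add: infinity_ennreal_def)
  qed (use I in \<open>auto simp: space_PiM intro!: prod_algebraI_finite\<close>)
qed

section \<open>The Gaussian Poincare inequality\<close>

text \<open>
  The fundamental theorem of calculus followed by the Cauchy-Schwarz inequality, the latter as
  nonnegativity of the integral of \<open>(D - a)\<^sup>2\<close> with \<open>a\<close> the mean of \<open>D\<close>.
\<close>
lemma increment_sq_le:
  fixes f D :: "real \<Rightarrow> real"
  assumes b: "0 < b" and d: "\<And>t. (f has_real_derivative D t) (at t)" and c: "continuous_on UNIV D"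
  shows "ennreal ((f b - f 0)\<^sup>2) \<le> ennreal b * (\<integral>\<^sup>+t. ennreal ((D t)\<^sup>2) * indicator {0..b} t \<partial>lborel)"
proof -
  define I where "I = f b - f 0"
  have cI: "continuous_on S D" for S using c by (rule continuous_on_subset) simp
  have 1: "has_bochner_integral lborel (\<lambda>t. D t * indicator {0..b} t) I"
    unfolding I_def
    by (rule has_bochner_integral_FTC_Icc_real) (use d b c in \<open>auto simp: continuous_on_eq_continuous_at\<close>)
  have int1: "integrable lborel (\<lambda>t. D t * indicator {0..b} t)" and e1: "(\<integral>t. D t * indicator {0..b} t \<partial>lborel) = I"
    using 1 by (auto simp: has_bochner_integral_iff)
  have int2: "integrable lborel (\<lambda>t. (D t)\<^sup>2 * indicator {0..b} t)"
    using borel_integrable_compact[OF compact_Icc, of 0 b "\<lambda>t. (D t)\<^sup>2"] cI by (simp add: mult.commute continuous_on_power)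
  have int0: "integrable lborel (\<lambda>t. indicator {0..b} t :: real)"
    by (rule integrable_real_indicator) (auto simp: emeasure_lborel_Icc_eq)
  have e0: "(\<integral>t. indicator {0..b} t \<partial>lborel) = b" using b by simp
  define a where "a = I / b"
  have "0 \<le> (\<integral>t. (D t - a)\<^sup>2 * indicator {0..b} t \<partial>lborel)" by simp
  also have "(\<integral>t. (D t - a)\<^sup>2 * indicator {0..b} t \<partial>lborel)
     = (\<integral>t. ((D t)\<^sup>2 * indicator {0..b} t - 2 * a * (D t * indicator {0..b} t)) + a\<^sup>2 * indicator {0..b} t \<partial>lborel)"
    by (intro Bochner_Integration.integral_cong refl) (simp add: power2_diff algebra_simps split: split_indicator)
  also have "\<dots> = (\<integral>t. (D t)\<^sup>2 * indicator {0..b} t \<partial>lborel) - 2 * a * I + a\<^sup>2 * b"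
    using int0 int1 int2 e0 e1 by simp
  finally have "2 * a * I - a\<^sup>2 * b \<le> (\<integral>t. (D t)\<^sup>2 * indicator {0..b} t \<partial>lborel)" by simp
  also have "2 * a * I - a\<^sup>2 * b = I\<^sup>2 / b" unfolding a_def using b by (simp add: power2_eq_square)
  finally have "I\<^sup>2 \<le> b * (\<integral>t. (D t)\<^sup>2 * indicator {0..b} t \<partial>lborel)" using b by (simp add: divide_le_eq mult.commute)
  then have "ennreal (I\<^sup>2) \<le> ennreal (b * (\<integral>t. (D t)\<^sup>2 * indicator {0..b} t \<partial>lborel))" by (rule ennreal_leI)
  also have "\<dots> = ennreal b * ennreal (\<integral>t. (D t)\<^sup>2 * indicator {0..b} t \<partial>lborel)"
    using b by (intro ennreal_mult) auto
  also have "ennreal (\<integral>t. (D t)\<^sup>2 * indicator {0..b} t \<partial>lborel) = (\<integral>\<^sup>+t. ennreal ((D t)\<^sup>2 * indicator {0..b} t) \<partial>lborel)"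
    by (rule nn_integral_eq_integral[symmetric, OF int2]) auto
  also have "\<dots> = (\<integral>\<^sup>+t. ennreal ((D t)\<^sup>2) * indicator {0..b} t \<partial>lborel)"
    by (intro nn_integral_cong) (auto split: split_indicator)
  finally show ?thesis unfolding I_def .
qed

text \<open>
  The law is prescribed through its characteristic function, which includes degenerate covariance
  matrices.
\<close>
locale gaussian_vector = prob_space M for M :: "'w measure" +
  fixes n :: nat and z :: "nat \<Rightarrow> 'w \<Rightarrow> real" and Sg :: "nat \<Rightarrow> nat \<Rightarrow> real"
  assumes z_meas: "\<And>i. i < n \<Longrightarrow> z i \<in> borel_measurable M"
    and z_char: "\<And>t. (\<integral>\<omega>. iexp (\<Sum>i<n. t i * z i \<omega>) \<partial>M)
       = complex_of_real (exp (- (\<Sum>i<n. \<Sum>j<n. t i * t j * Sg i j) / 2))"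
    and z_cov_int: "\<And>i j. i < n \<Longrightarrow> j < n \<Longrightarrow> integrable M (\<lambda>\<omega>. z i \<omega> * z j \<omega>)"
    and z_cov: "\<And>i j. i < n \<Longrightarrow> j < n \<Longrightarrow> (\<integral>\<omega>. z i \<omega> * z j \<omega> \<partial>M) = Sg i j"
begin

sublocale pair: pair_prob_space M M ..

text \<open>
  Labels for the coordinates of two copies of the vector: \<^const>\<open>False\<close> for the first and \<^const>\<open>True\<close>
  for the second.
\<close>
definition copies :: "(bool \<times> nat) set" where "copies = UNIV \<times> {..<n}"

lemma finite_copies: "finite copies" by (simp add: copies_def)

lemma sum_copies: "(\<Sum>p\<in>copies. g p) = (\<Sum>i<n. g (False, i)) + (\<Sum>i<n. g (True, i))"
proof -
  have "(\<Sum>p\<in>copies. g p) = (\<Sum>b\<in>UNIV. \<Sum>i<n. g (b, i))" unfolding copies_def by (simp add: sum.cartesian_product)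
  then show ?thesis by (simp add: UNIV_bool)
qed

text \<open>The pair of independent copies, rotated by the angle \<open>\<theta>\<close>.\<close>
definition rot :: "real \<Rightarrow> bool \<times> nat \<Rightarrow> 'w \<times> 'w \<Rightarrow> real" where
  "rot \<theta> p \<omega> = (if fst p then - sin \<theta> * z (snd p) (fst \<omega>) + cos \<theta> * z (snd p) (snd \<omega>)
                       else cos \<theta> * z (snd p) (fst \<omega>) + sin \<theta> * z (snd p) (snd \<omega>))"

lemma rot_meas: "p \<in> copies \<Longrightarrow> rot \<theta> p \<in> borel_measurable (M \<Otimes>\<^sub>M M)"
proof -
  assume p: "p \<in> copies"
  then have [measurable]: "z (snd p) \<in> borel_measurable M" using z_meas by (auto simp: copies_def)
  show ?thesis unfolding rot_def[abs_def] by measurable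
qed

lemma rot_char:
  "(\<integral>\<omega>. iexp (\<Sum>p\<in>copies. t p * rot \<theta> p \<omega>) \<partial>(M \<Otimes>\<^sub>M M))
   = complex_of_real (exp (- ((\<Sum>i<n. \<Sum>j<n. t (False, i) * t (False, j) * Sg i j)
        + (\<Sum>i<n. \<Sum>j<n. t (True, i) * t (True, j) * Sg i j)) / 2))"
proof -
  note [measurable] = z_meas
  define f where "f i = cos \<theta> * t (False, i) - sin \<theta> * t (True, i)" for i
  define g where "g i = sin \<theta> * t (False, i) + cos \<theta> * t (True, i)" for i
  define A where "A h \<omega> = iexp (\<Sum>i<n. h i * z i \<omega>)" for h :: "nat \<Rightarrow> real" and \<omega>
  have Am[measurable]: "A h \<in> borel_measurable M" for h unfolding A_def[abs_def] by measurable
  have sep: "iexp (\<Sum>p\<in>copies. t p * rot \<theta> p \<omega>) = A f (fst \<omega>) * A g (snd \<omega>)" for \<omega>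
  proof -
    have "(\<Sum>p\<in>copies. t p * rot \<theta> p \<omega>) = (\<Sum>i<n. f i * z i (fst \<omega>)) + (\<Sum>i<n. g i * z i (snd \<omega>))"
      unfolding sum_copies sum.distrib[symmetric]
      by (intro sum.cong refl) (simp add: rot_def f_def g_def algebra_simps)
    then show ?thesis unfolding A_def by (simp only: of_real_add distrib_left exp_add)
  qed
  have int: "integrable (M \<Otimes>\<^sub>M M) (\<lambda>\<omega>. A f (fst \<omega>) * A g (snd \<omega>))"
    by (rule pair.P.integrable_const_bound[where B=1]) (auto simp: A_def norm_mult)
  have "(\<integral>\<omega>. iexp (\<Sum>p\<in>copies. t p * rot \<theta> p \<omega>) \<partial>(M \<Otimes>\<^sub>M M)) = (\<integral>x. (\<integral>y. A f x * A g y \<partial>M) \<partial>M)"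
    unfolding sep using pair.integral_fst'[OF int] by simp
  also have "\<dots> = (\<integral>x. A f x \<partial>M) * (\<integral>y. A g y \<partial>M)" by simp
  also have "\<dots> = complex_of_real (exp (- (\<Sum>i<n. \<Sum>j<n. f i * f j * Sg i j) / 2)
      * exp (- (\<Sum>i<n. \<Sum>j<n. g i * g j * Sg i j) / 2))"
    unfolding A_def z_char by simp
  also have "exp (- (\<Sum>i<n. \<Sum>j<n. f i * f j * Sg i j) / 2) * exp (- (\<Sum>i<n. \<Sum>j<n. g i * g j * Sg i j) / 2)
     = exp (- ((\<Sum>i<n. \<Sum>j<n. f i * f j * Sg i j) + (\<Sum>i<n. \<Sum>j<n. g i * g j * Sg i j)) / 2)"
    by (simp add: exp_add[symmetric] add_divide_distrib)
  also have "(\<Sum>i<n. \<Sum>j<n. f i * f j * Sg i j) + (\<Sum>i<n. \<Sum>j<n. g i * g j * Sg i j)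
     = (\<Sum>i<n. \<Sum>j<n. t (False, i) * t (False, j) * Sg i j) + (\<Sum>i<n. \<Sum>j<n. t (True, i) * t (True, j) * Sg i j)"
    unfolding sum.distrib[symmetric]
  proof (intro sum.cong refl)
    fix i j
    have "f i * f j + g i * g j = ((cos \<theta>)\<^sup>2 + (sin \<theta>)\<^sup>2) * (t (False, i) * t (False, j) + t (True, i) * t (True, j))"
    proof -
      have "(c * a - s * b) * (c * a' - s * b') + (s * a + c * b) * (s * a' + c * b')
          = (c\<^sup>2 + s\<^sup>2) * (a * a' + b * b')" for a b a' b' c s :: real
        by (simp add: algebra_simps power2_eq_square)
      then show ?thesis unfolding f_def g_def .
    qed
    then have "f i * f j + g i * g j = t (False, i) * t (False, j) + t (True, i) * t (True, j)"
      by (simp only: sin_cos_squared_add2 mult_1)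
    then show "f i * f j * Sg i j + g i * g j * Sg i j = t (False, i) * t (False, j) * Sg i j + t (True, i) * t (True, j) * Sg i j"
      by (simp add: distrib_right[symmetric])
  qed
  finally show ?thesis .
qed

text \<open>
  A centred Gaussian pair of independent copies is rotation invariant, because its characteristic
  function is.
\<close>
lemma rot_invariant:
  assumes H: "H \<in> borel_measurable (Pi\<^sub>M copies (\<lambda>_. borel))"
  shows "(\<integral>\<^sup>+\<omega>. H (\<lambda>p\<in>copies. rot \<theta> p \<omega>) \<partial>(M \<Otimes>\<^sub>M M)) = (\<integral>\<^sup>+\<omega>. H (\<lambda>p\<in>copies. rot 0 p \<omega>) \<partial>(M \<Otimes>\<^sub>M M))"
proof -
  have P: "prob_space (M \<Otimes>\<^sub>M M)" by (rule pair.P.prob_space_axioms)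
  have eq: "distr (M \<Otimes>\<^sub>M M) (Pi\<^sub>M copies (\<lambda>_. borel)) (\<lambda>\<omega>. \<lambda>p\<in>copies. rot \<theta> p \<omega>)
     = distr (M \<Otimes>\<^sub>M M) (Pi\<^sub>M copies (\<lambda>_. borel)) (\<lambda>\<omega>. \<lambda>p\<in>copies. rot 0 p \<omega>)"
    by (rule joint_law_unique[OF P P finite_copies]) (auto simp only: rot_char intro: rot_meas)
  have m: "(\<lambda>\<omega>. \<lambda>p\<in>copies. rot \<theta> p \<omega>) \<in> measurable (M \<Otimes>\<^sub>M M) (Pi\<^sub>M copies (\<lambda>_. borel))" for \<theta>
    by (rule measurable_restrict) (rule rot_meas)
  have "(\<integral>\<^sup>+w. H w \<partial>distr (M \<Otimes>\<^sub>M M) (Pi\<^sub>M copies (\<lambda>_. borel)) (\<lambda>\<omega>. \<lambda>p\<in>copies. rot \<theta> p \<omega>))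
     = (\<integral>\<^sup>+\<omega>. H (\<lambda>p\<in>copies. rot \<theta> p \<omega>) \<partial>(M \<Otimes>\<^sub>M M))" for \<theta>
    by (rule nn_integral_distr[OF m]) (simp add: H)
  from this[of \<theta>] this[of 0] show ?thesis unfolding eq by simp
qed

text \<open>
  The argument of Maurey and Pisier. Along the path \<open>Z\<^sub>\<theta> = cos \<theta> Z + sin \<theta> Z'\<close> from \<open>Z\<close> to its copy, the
  derivative of \<open>F\<close> is \<open>\<nabla>F(Z\<^sub>\<theta>) \<bullet> Z'\<^sub>\<theta>\<close>, where \<open>Z'\<^sub>\<theta>\<close> is the rotated companion of \<open>Z\<^sub>\<theta>\<close>. By invariance its
  second moment does not depend on \<open>\<theta>\<close>, and at \<open>\<theta> = 0\<close> the companion is independent of \<open>Z\<close>.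
\<close>
theorem poincare:
  fixes F :: "(nat \<Rightarrow> real) \<Rightarrow> real" and G :: "nat \<Rightarrow> (nat \<Rightarrow> real) \<Rightarrow> real"
  assumes Gm: "\<And>i. i < n \<Longrightarrow> G i \<in> borel_measurable (Pi\<^sub>M {..<n} (\<lambda>_. borel))"
    and Gcong: "\<And>i u v. i < n \<Longrightarrow> (\<And>j. j < n \<Longrightarrow> u j = v j) \<Longrightarrow> G i u = G i v"
    and deriv: "\<And>u v \<theta>. ((\<lambda>\<theta>. F (\<lambda>i. cos \<theta> * u i + sin \<theta> * v i)) has_real_derivative
        (\<Sum>i<n. G i (\<lambda>i. cos \<theta> * u i + sin \<theta> * v i) * (- sin \<theta> * u i + cos \<theta> * v i))) (at \<theta>)"
    and Gcont: "\<And>i u v. i < n \<Longrightarrow> continuous_on UNIV (\<lambda>\<theta>. G i (\<lambda>i. cos \<theta> * u i + sin \<theta> * v i))"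
  shows "(\<integral>\<^sup>+\<omega>. ennreal ((F (\<lambda>i. z i (fst \<omega>)) - F (\<lambda>i. z i (snd \<omega>)))\<^sup>2) \<partial>(M \<Otimes>\<^sub>M M))
    \<le> ennreal ((pi / 2)\<^sup>2) * (\<integral>\<^sup>+\<omega>. ennreal (\<Sum>i<n. \<Sum>j<n. G i (\<lambda>i. z i \<omega>) * G j (\<lambda>i. z i \<omega>) * Sg i j) \<partial>M)"
proof -
  note [measurable] = z_meas
  define H where "H w = ennreal ((\<Sum>i<n. G i (\<lambda>j\<in>{..<n}. w (False, j)) * w (True, i))\<^sup>2)" for w :: "bool \<times> nat \<Rightarrow> real"
  have Hm[measurable]: "H \<in> borel_measurable (Pi\<^sub>M copies (\<lambda>_. borel))"
  proof -
    have r: "(\<lambda>w. \<lambda>j\<in>{..<n}. w (False, j)) \<in> measurable (Pi\<^sub>M copies (\<lambda>_. borel)) (Pi\<^sub>M {..<n} (\<lambda>_. borel :: real measure))"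
      by (rule measurable_restrict) (rule measurable_component_singleton, simp add: copies_def)
    have g: "(\<lambda>w. G i (\<lambda>j\<in>{..<n}. w (False, j))) \<in> borel_measurable (Pi\<^sub>M copies (\<lambda>_. borel))" if "i < n" for i
      by (rule measurable_compose[OF r Gm[OF that]])
    have c: "(\<lambda>w. w (True, i)) \<in> borel_measurable (Pi\<^sub>M copies (\<lambda>_. borel :: real measure))" if "i < n" for i
      by (rule measurable_component_singleton) (simp add: copies_def that)
    show ?thesis unfolding H_def[abs_def]
      by (intro measurable_compose[OF _ measurable_ennreal] borel_measurable_power borel_measurable_sum borel_measurable_times)
         (auto intro: g c)
  qed
  define D where "D \<omega> \<theta> = (\<Sum>i<n. G i (\<lambda>i. cos \<theta> * z i (fst \<omega>) + sin \<theta> * z i (snd \<omega>))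
      * (- sin \<theta> * z i (fst \<omega>) + cos \<theta> * z i (snd \<omega>)))" for \<omega> :: "'w \<times> 'w" and \<theta>
  have HD: "H (\<lambda>p\<in>copies. rot \<theta> p \<omega>) = ennreal ((D \<omega> \<theta>)\<^sup>2)" for \<theta> \<omega>
  proof -
    have "(\<Sum>i<n. G i (\<lambda>j\<in>{..<n}. (\<lambda>p\<in>copies. rot \<theta> p \<omega>) (False, j)) * (\<lambda>p\<in>copies. rot \<theta> p \<omega>) (True, i)) = D \<omega> \<theta>"
      unfolding D_def
    proof (rule sum.cong[OF refl])
      fix i assume "i \<in> {..<n}"
      moreover have "G i (\<lambda>j\<in>{..<n}. (\<lambda>p\<in>copies. rot \<theta> p \<omega>) (False, j)) = G i (\<lambda>i. cos \<theta> * z i (fst \<omega>) + sin \<theta> * z i (snd \<omega>))"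
        using calculation by (intro Gcong) (auto simp: copies_def rot_def)
      ultimately show "G i (\<lambda>j\<in>{..<n}. (\<lambda>p\<in>copies. rot \<theta> p \<omega>) (False, j)) * (\<lambda>p\<in>copies. rot \<theta> p \<omega>) (True, i)
         = G i (\<lambda>i. cos \<theta> * z i (fst \<omega>) + sin \<theta> * z i (snd \<omega>)) * (- sin \<theta> * z i (fst \<omega>) + cos \<theta> * z i (snd \<omega>))"
        by (simp add: copies_def rot_def)
    qed
    then show ?thesis unfolding H_def by simp
  qed
  interpret PL: pair_sigma_finite "M \<Otimes>\<^sub>M M" lborel ..
  have joint: "(\<lambda>x. ennreal ((D (fst x) (snd x))\<^sup>2) * indicator {0..pi / 2} (snd x)) \<in> borel_measurable ((M \<Otimes>\<^sub>M M) \<Otimes>\<^sub>M lborel)"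
  proof -
    have m: "(\<lambda>x. \<lambda>p\<in>copies. rot (snd x) p (fst x)) \<in> measurable ((M \<Otimes>\<^sub>M M) \<Otimes>\<^sub>M lborel) (Pi\<^sub>M copies (\<lambda>_. borel))"
    proof (rule measurable_restrict)
      fix p assume "p \<in> copies"
      then have [measurable]: "z (snd p) \<in> borel_measurable M" using z_meas by (auto simp: copies_def)
      show "(\<lambda>x. rot (snd x) p (fst x)) \<in> borel_measurable ((M \<Otimes>\<^sub>M M) \<Otimes>\<^sub>M lborel)"
        unfolding rot_def by measurable
    qed
    have "(\<lambda>x. H (\<lambda>p\<in>copies. rot (snd x) p (fst x))) \<in> borel_measurable ((M \<Otimes>\<^sub>M M) \<Otimes>\<^sub>M lborel)"
      by (rule measurable_compose[OF m Hm])
    then have [measurable]: "(\<lambda>x. ennreal ((D (fst x) (snd x))\<^sup>2)) \<in> borel_measurable ((M \<Otimes>\<^sub>M M) \<Otimes>\<^sub>M lborel)"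
      unfolding HD .
    show ?thesis by measurable
  qed
  have "(\<integral>\<^sup>+\<omega>. ennreal ((F (\<lambda>i. z i (fst \<omega>)) - F (\<lambda>i. z i (snd \<omega>)))\<^sup>2) \<partial>(M \<Otimes>\<^sub>M M))
     \<le> (\<integral>\<^sup>+\<omega>. ennreal (pi / 2) * (\<integral>\<^sup>+\<theta>. ennreal ((D \<omega> \<theta>)\<^sup>2) * indicator {0..pi / 2} \<theta> \<partial>lborel) \<partial>(M \<Otimes>\<^sub>M M))"
  proof (rule nn_integral_mono)
    fix \<omega>
    let ?f = "\<lambda>\<theta>. F (\<lambda>i. cos \<theta> * z i (fst \<omega>) + sin \<theta> * z i (snd \<omega>))"
    have "ennreal ((?f (pi / 2) - ?f 0)\<^sup>2) \<le> ennreal (pi / 2) * (\<integral>\<^sup>+\<theta>. ennreal ((D \<omega> \<theta>)\<^sup>2) * indicator {0..pi / 2} \<theta> \<partial>lborel)"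
    proof (rule increment_sq_le)
      show "(?f has_real_derivative D \<omega> \<theta>) (at \<theta>)" for \<theta> unfolding D_def by (rule deriv)
      show "continuous_on UNIV (D \<omega>)"
        unfolding D_def[abs_def] by (intro continuous_intros Gcont) auto
    qed simp
    then show "ennreal ((F (\<lambda>i. z i (fst \<omega>)) - F (\<lambda>i. z i (snd \<omega>)))\<^sup>2)
       \<le> ennreal (pi / 2) * (\<integral>\<^sup>+\<theta>. ennreal ((D \<omega> \<theta>)\<^sup>2) * indicator {0..pi / 2} \<theta> \<partial>lborel)"
      by (simp add: power2_commute)
  qed
  also have "\<dots> = ennreal (pi / 2) * (\<integral>\<^sup>+\<omega>. (\<integral>\<^sup>+\<theta>. ennreal ((D \<omega> \<theta>)\<^sup>2) * indicator {0..pi / 2} \<theta> \<partial>lborel) \<partial>(M \<Otimes>\<^sub>M M))"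
    by (rule nn_integral_cmult) (use lborel.borel_measurable_nn_integral_fst[OF joint] in simp)
  also have "(\<integral>\<^sup>+\<omega>. (\<integral>\<^sup>+\<theta>. ennreal ((D \<omega> \<theta>)\<^sup>2) * indicator {0..pi / 2} \<theta> \<partial>lborel) \<partial>(M \<Otimes>\<^sub>M M))
     = (\<integral>\<^sup>+\<theta>. (\<integral>\<^sup>+\<omega>. ennreal ((D \<omega> \<theta>)\<^sup>2) * indicator {0..pi / 2} \<theta> \<partial>(M \<Otimes>\<^sub>M M)) \<partial>lborel)"
    using PL.Fubini[OF joint] by simp
  also have "\<dots> = (\<integral>\<^sup>+\<theta>. (\<integral>\<^sup>+\<omega>. ennreal ((D \<omega> 0)\<^sup>2) \<partial>(M \<Otimes>\<^sub>M M)) * indicator {0..pi / 2} \<theta> \<partial>lborel)"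
  proof (rule nn_integral_cong)
    fix \<theta>
    have "(\<integral>\<^sup>+\<omega>. ennreal ((D \<omega> \<theta>)\<^sup>2) \<partial>(M \<Otimes>\<^sub>M M)) = (\<integral>\<^sup>+\<omega>. ennreal ((D \<omega> 0)\<^sup>2) \<partial>(M \<Otimes>\<^sub>M M))"
      using rot_invariant[OF Hm, of \<theta>] unfolding HD .
    then show "(\<integral>\<^sup>+\<omega>. ennreal ((D \<omega> \<theta>)\<^sup>2) * indicator {0..pi / 2} \<theta> \<partial>(M \<Otimes>\<^sub>M M))
       = (\<integral>\<^sup>+\<omega>. ennreal ((D \<omega> 0)\<^sup>2) \<partial>(M \<Otimes>\<^sub>M M)) * indicator {0..pi / 2} \<theta>"
      by (simp split: split_indicator)
  qed
  also have "\<dots> = (\<integral>\<^sup>+\<omega>. ennreal ((D \<omega> 0)\<^sup>2) \<partial>(M \<Otimes>\<^sub>M M)) * ennreal (pi / 2)"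
    by (subst nn_integral_cmult) auto
  also have "(\<integral>\<^sup>+\<omega>. ennreal ((D \<omega> 0)\<^sup>2) \<partial>(M \<Otimes>\<^sub>M M))
     = (\<integral>\<^sup>+x. (\<integral>\<^sup>+y. ennreal ((D (x, y) 0)\<^sup>2) \<partial>M) \<partial>M)"
  proof (rule nn_integral_fst[symmetric])
    have "(\<lambda>\<omega>. H (\<lambda>p\<in>copies. rot 0 p \<omega>)) \<in> borel_measurable (M \<Otimes>\<^sub>M M)"
      by (rule measurable_compose[OF _ Hm]) (rule measurable_restrict, rule rot_meas)
    then show "(\<lambda>\<omega>. ennreal ((D \<omega> 0)\<^sup>2)) \<in> borel_measurable (M \<Otimes>\<^sub>M M)" unfolding HD .
  qed
  also have "\<dots> = (\<integral>\<^sup>+\<omega>. ennreal (\<Sum>i<n. \<Sum>j<n. G i (\<lambda>i. z i \<omega>) * G j (\<lambda>i. z i \<omega>) * Sg i j) \<partial>M)"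
  proof (rule nn_integral_cong)
    fix x
    define g where "g i = G i (\<lambda>i. z i x)" for i
    have e: "(D (x, y) 0)\<^sup>2 = (\<Sum>i<n. \<Sum>j<n. g i * g j * (z i y * z j y))" for y
      unfolding D_def g_def by (simp add: power2_eq_square sum_product mult_ac)
    have int: "integrable M (\<lambda>y. \<Sum>i<n. \<Sum>j<n. g i * g j * (z i y * z j y))"
      by (intro Bochner_Integration.integrable_sum integrable_mult_right z_cov_int) auto
    have "(\<integral>\<^sup>+y. ennreal ((D (x, y) 0)\<^sup>2) \<partial>M) = (\<integral>\<^sup>+y. ennreal (\<Sum>i<n. \<Sum>j<n. g i * g j * (z i y * z j y)) \<partial>M)"
      unfolding e ..
    also have "\<dots> = ennreal (\<integral>y. (\<Sum>i<n. \<Sum>j<n. g i * g j * (z i y * z j y)) \<partial>M)"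
      by (rule nn_integral_eq_integral[OF int]) (simp only: e[symmetric], simp)
    also have "(\<integral>y. (\<Sum>i<n. \<Sum>j<n. g i * g j * (z i y * z j y)) \<partial>M)
       = (\<Sum>i<n. \<Sum>j<n. g i * g j * Sg i j)"
    proof -
      have "(\<integral>y. (\<Sum>i<n. \<Sum>j<n. g i * g j * (z i y * z j y)) \<partial>M)
         = (\<Sum>i<n. (\<integral>y. (\<Sum>j<n. g i * g j * (z i y * z j y)) \<partial>M))"
        by (rule Bochner_Integration.integral_sum)
           (intro Bochner_Integration.integrable_sum integrable_mult_right z_cov_int, auto)
      also have "\<dots> = (\<Sum>i<n. \<Sum>j<n. (\<integral>y. g i * g j * (z i y * z j y) \<partial>M))"
        by (intro sum.cong refl Bochner_Integration.integral_sum) (intro integrable_mult_right z_cov_int, auto)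
      also have "\<dots> = (\<Sum>i<n. \<Sum>j<n. g i * g j * Sg i j)"
        by (intro sum.cong refl) (simp add: z_cov)
      finally show ?thesis .
    qed
    finally show "(\<integral>\<^sup>+y. ennreal ((D (x, y) 0)\<^sup>2) \<partial>M) = ennreal (\<Sum>i<n. \<Sum>j<n. G i (\<lambda>i. z i x) * G j (\<lambda>i. z i x) * Sg i j)"
      unfolding g_def .
  qed
  moreover have "ennreal ((pi / 2)\<^sup>2) = ennreal (pi / 2) * ennreal (pi / 2)"
    by (simp add: power2_eq_square flip: ennreal_mult)
  ultimately show ?thesis by (simp only: mult_ac)
qed

end

section \<open>Moments of subexponential functions of a Gaussian process\<close>

lemma normal_density_mult_exp:
  assumes s: "0 < \<sigma>"
  shows "normal_density 0 \<sigma> x * exp (a * x) = exp (a\<^sup>2 * \<sigma>\<^sup>2 / 2) * normal_density (a * \<sigma>\<^sup>2) \<sigma> x"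
proof -
  have "- x\<^sup>2 / (2 * \<sigma>\<^sup>2) + a * x = a\<^sup>2 * \<sigma>\<^sup>2 / 2 + - (x - a * \<sigma>\<^sup>2)\<^sup>2 / (2 * \<sigma>\<^sup>2)"
  proof -
    define q where "q = \<sigma>\<^sup>2"
    have q: "q \<noteq> 0" using s by (simp add: q_def)
    have "(x - a * q)\<^sup>2 = x\<^sup>2 - 2 * q * (a * x) + 2 * q * (a\<^sup>2 * q / 2)"
      by (simp add: power2_eq_square algebra_simps)
    then have "(x - a * q)\<^sup>2 / (2 * q) = x\<^sup>2 / (2 * q) - a * x + a\<^sup>2 * q / 2"
      using q by (simp only: add_divide_distrib diff_divide_distrib) simp
    then show ?thesis unfolding q_def by simp
  qed
  then have "exp (- x\<^sup>2 / (2 * \<sigma>\<^sup>2)) * exp (a * x) = exp (a\<^sup>2 * \<sigma>\<^sup>2 / 2) * exp (- (x - a * \<sigma>\<^sup>2)\<^sup>2 / (2 * \<sigma>\<^sup>2))"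
    by (simp only: exp_add[symmetric])
  then show ?thesis unfolding normal_density_def by simp
qed

context prob_space
begin

lemma centred_gaussian_cases:
  assumes g: "gaussian_variable M X" and i: "integrable M X" and m: "expectation X = 0"
    and v: "expectation (\<lambda>\<omega>. (X \<omega>)\<^sup>2) = v"
  obtains "v = 0" "AE \<omega> in M. X \<omega> = 0"
  | \<sigma> where "0 < \<sigma>" "v = \<sigma>\<^sup>2" "distributed M lborel X (normal_density 0 \<sigma>)"
proof -
  from g obtain \<mu> \<sigma> where c: "(\<sigma> = 0 \<and> (AE \<omega> in M. X \<omega> = \<mu>)) \<or> (0 < \<sigma> \<and> distributed M lborel X (normal_density \<mu> \<sigma>))"
    and X[measurable]: "X \<in> borel_measurable M"
    unfolding gaussian_variable_def by blast
  from c show thesis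
  proof
    assume "\<sigma> = 0 \<and> (AE \<omega> in M. X \<omega> = \<mu>)"
    then have ae: "AE \<omega> in M. X \<omega> = \<mu>" by simp
    have "expectation X = expectation (\<lambda>_. \<mu>)" by (rule integral_cong_AE) (use ae in auto)
    then have "\<mu> = 0" using m by (simp add: prob_space)
    with ae have ae0: "AE \<omega> in M. X \<omega> = 0" by simp
    have "expectation (\<lambda>\<omega>. (X \<omega>)\<^sup>2) = expectation (\<lambda>_. 0)"
      by (rule integral_cong_AE) (use ae0 in auto)
    then show thesis using that(1) ae0 v by simp
  next
    assume a: "0 < \<sigma> \<and> distributed M lborel X (normal_density \<mu> \<sigma>)"
    then have "\<mu> = 0" using normal_distributed_expectation[of \<sigma> X \<mu>] m by simp
    with a have d: "0 < \<sigma>" "distributed M lborel X (normal_density 0 \<sigma>)" by auto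
    then have "variance X = \<sigma>\<^sup>2" using normal_distributed_variance[of \<sigma> X 0] by simp
    then have "v = \<sigma>\<^sup>2" using v m by simp
    then show thesis using that(2) d by blast
  qed
qed

lemma centred_gaussian_char:
  assumes g: "gaussian_variable M X" and i: "integrable M X" and m: "expectation X = 0"
    and v: "expectation (\<lambda>\<omega>. (X \<omega>)\<^sup>2) = v"
  shows "(\<integral>\<omega>. iexp (X \<omega>) \<partial>M) = complex_of_real (exp (- v / 2))"
proof -
  have X[measurable]: "X \<in> borel_measurable M" using i by simp
  show ?thesis
    using g i m v
  proof (cases rule: centred_gaussian_cases)
    case 1
    have "(\<integral>\<omega>. iexp (X \<omega>) \<partial>M) = (\<integral>\<omega>. 1 \<partial>M)"
      by (rule integral_cong_AE) (use 1(2) in auto)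
    then show ?thesis using 1 by (simp add: prob_space)
  next
    case (2 \<sigma>)
    have d: "distr M lborel X = density lborel (\<lambda>x. ennreal (normal_density 0 \<sigma> x))"
      using 2(3) by (rule distributed_distr_eq_density)
    have "(\<integral>\<omega>. iexp (X \<omega>) \<partial>M) = (\<integral>x. iexp x \<partial>distr M lborel X)"
      by (rule integral_distr[symmetric]) auto
    also have "\<dots> = (\<integral>x. normal_density 0 \<sigma> x *\<^sub>R iexp x \<partial>lborel)"
      unfolding d by (rule integral_density) (auto simp: normal_density_nonneg)
    also have "\<dots> = (\<integral>x. complex_of_real (normal_density 0 \<sigma> x) * iexp (1 * x) \<partial>lborel)"
      by (simp add: scaleR_conv_of_real)
    also have "\<dots> = complex_of_real (exp (- (\<sigma> * 1)\<^sup>2 / 2))" by (rule normal_char(2)[OF 2(1)])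
    finally show ?thesis using 2(2) by simp
  qed
qed

lemma centred_gaussian_exp_moment:
  assumes g: "gaussian_variable M X" and i: "integrable M X" and m: "expectation X = 0"
    and v: "expectation (\<lambda>\<omega>. (X \<omega>)\<^sup>2) = v"
  shows "(\<integral>\<^sup>+\<omega>. ennreal (exp (a * X \<omega>)) \<partial>M) = ennreal (exp (a\<^sup>2 * v / 2))"
proof -
  have X[measurable]: "X \<in> borel_measurable M" using i by simp
  show ?thesis
    using g i m v
  proof (cases rule: centred_gaussian_cases)
    case 1
    have "(\<integral>\<^sup>+\<omega>. ennreal (exp (a * X \<omega>)) \<partial>M) = (\<integral>\<^sup>+\<omega>. 1 \<partial>M)"
      by (rule nn_integral_cong_AE) (use 1(2) in auto)
    then show ?thesis using 1 by (simp add: emeasure_space_1)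
  next
    case (2 \<sigma>)
    have d: "distr M lborel X = density lborel (\<lambda>x. ennreal (normal_density 0 \<sigma> x))"
      using 2(3) by (rule distributed_distr_eq_density)
    have "(\<integral>\<^sup>+\<omega>. ennreal (exp (a * X \<omega>)) \<partial>M) = (\<integral>\<^sup>+x. ennreal (exp (a * x)) \<partial>distr M lborel X)"
      by (rule nn_integral_distr[symmetric]) auto
    also have "\<dots> = (\<integral>\<^sup>+x. ennreal (normal_density 0 \<sigma> x) * ennreal (exp (a * x)) \<partial>lborel)"
      unfolding d by (rule nn_integral_density) auto
    also have "\<dots> = (\<integral>\<^sup>+x. ennreal (exp (a\<^sup>2 * \<sigma>\<^sup>2 / 2)) * ennreal (normal_density (a * \<sigma>\<^sup>2) \<sigma> x) \<partial>lborel)"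
      by (simp add: ennreal_mult[symmetric] normal_density_nonneg normal_density_mult_exp[OF 2(1)])
    also have "\<dots> = ennreal (exp (a\<^sup>2 * \<sigma>\<^sup>2 / 2)) * (\<integral>\<^sup>+x. ennreal (normal_density (a * \<sigma>\<^sup>2) \<sigma> x) \<partial>lborel)"
      by (rule nn_integral_cmult) auto
    also have "(\<integral>\<^sup>+x. ennreal (normal_density (a * \<sigma>\<^sup>2) \<sigma> x) \<partial>lborel) = 1"
      using emeasure_density[of "\<lambda>x. ennreal (normal_density (a * \<sigma>\<^sup>2) \<sigma> x)" lborel UNIV]
        prob_space.emeasure_space_1[OF prob_space_normal_density[OF 2(1), of "a * \<sigma>\<^sup>2"]] by simp
    finally show ?thesis using 2(2) by simp
  qed
qed

lemma subexp_fourth_moment: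
  assumes g: "gaussian_variable M X" and i: "integrable M X" and m: "expectation X = 0"
    and v: "expectation (\<lambda>\<omega>. (X \<omega>)\<^sup>2) = v"
    and h: "\<And>t. \<bar>h t\<bar> \<le> C * exp (C * \<bar>t\<bar>)" and hm: "h \<in> borel_measurable borel"
  shows "integrable M (\<lambda>\<omega>. (h (X \<omega>)) ^ 4)"
    and "expectation (\<lambda>\<omega>. (h (X \<omega>)) ^ 4) \<le> 2 * C ^ 4 * exp (8 * C\<^sup>2 * v)"
proof -
  have X[measurable]: "X \<in> borel_measurable M" using i by simp
  note [measurable] = hm
  have C: "0 \<le> C" using h[of 0] by simp
  have pt: "(h t) ^ 4 \<le> C ^ 4 * (exp (4 * C * t) + exp (- (4 * C) * t))" for t
  proof -
    have "(h t) ^ 4 = \<bar>h t\<bar> ^ 4" by simp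
    also have "\<dots> \<le> (C * exp (C * \<bar>t\<bar>)) ^ 4" by (rule power_mono[OF h]) simp
    also have "\<dots> = C ^ 4 * exp (4 * C * \<bar>t\<bar>)"
      by (simp add: power_mult_distrib exp_of_nat_mult[symmetric] mult.assoc)
    also have "exp (4 * C * \<bar>t\<bar>) \<le> exp (4 * C * t) + exp (- (4 * C) * t)"
      by (cases "0 \<le> t") (auto simp: abs_if)
    finally show ?thesis using C by (simp add: mult_left_mono)
  qed
  have "(\<integral>\<^sup>+\<omega>. ennreal ((h (X \<omega>)) ^ 4) \<partial>M)
      \<le> (\<integral>\<^sup>+\<omega>. ennreal (C ^ 4) * (ennreal (exp (4 * C * X \<omega>)) + ennreal (exp (- (4 * C) * X \<omega>))) \<partial>M)"
  proof (rule nn_integral_mono)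
    fix \<omega>
    have "ennreal ((h (X \<omega>)) ^ 4) \<le> ennreal (C ^ 4 * (exp (4 * C * X \<omega>) + exp (- (4 * C) * X \<omega>)))"
      by (rule ennreal_leI[OF pt])
    also have "\<dots> = ennreal (C ^ 4) * (ennreal (exp (4 * C * X \<omega>)) + ennreal (exp (- (4 * C) * X \<omega>)))"
      using C by (simp add: ennreal_mult ennreal_plus[symmetric] del: ennreal_plus)
    finally show "ennreal ((h (X \<omega>)) ^ 4) \<le> ennreal (C ^ 4) * (ennreal (exp (4 * C * X \<omega>)) + ennreal (exp (- (4 * C) * X \<omega>)))" .
  qed
  also have "\<dots> = ennreal (C ^ 4) * ((\<integral>\<^sup>+\<omega>. ennreal (exp (4 * C * X \<omega>)) \<partial>M) + (\<integral>\<^sup>+\<omega>. ennreal (exp (- (4 * C) * X \<omega>)) \<partial>M))"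
    by (subst nn_integral_cmult, measurable, subst nn_integral_add, auto)
  also have "\<dots> = ennreal (2 * C ^ 4 * exp (8 * C\<^sup>2 * v))"
  proof -
    have e: "(4 * C)\<^sup>2 * v / 2 = 8 * C\<^sup>2 * v" "(- (4 * C))\<^sup>2 * v / 2 = 8 * C\<^sup>2 * v"
      by (simp_all add: power_mult_distrib)
    have "ennreal (C ^ 4) * (ennreal (exp (8 * C\<^sup>2 * v)) + ennreal (exp (8 * C\<^sup>2 * v))) = ennreal (C ^ 4 * (exp (8 * C\<^sup>2 * v) + exp (8 * C\<^sup>2 * v)))"
      using C by (simp add: ennreal_mult ennreal_plus[symmetric] del: ennreal_plus)
    then show ?thesis
      unfolding centred_gaussian_exp_moment[OF g i m v] e by (simp add: mult_ac)
  qed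
  finally have b: "(\<integral>\<^sup>+\<omega>. ennreal ((h (X \<omega>)) ^ 4) \<partial>M) \<le> ennreal (2 * C ^ 4 * exp (8 * C\<^sup>2 * v))" .
  then show int: "integrable M (\<lambda>\<omega>. (h (X \<omega>)) ^ 4)"
    by (intro integrableI_bounded) (auto intro: le_less_trans)
  have "ennreal (expectation (\<lambda>\<omega>. (h (X \<omega>)) ^ 4)) \<le> ennreal (2 * C ^ 4 * exp (8 * C\<^sup>2 * v))"
    using b nn_integral_eq_integral[OF int] by simp
  then show "expectation (\<lambda>\<omega>. (h (X \<omega>)) ^ 4) \<le> 2 * C ^ 4 * exp (8 * C\<^sup>2 * v)"
    using C by (simp add: ennreal_le_iff)
qed

end

text \<open>
  Since the sites are distinct, a sum over indices is one over a finite set of points, the form in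
  which Gaussian processes are defined.
\<close>
lemma gaussian_process_vector:
  fixes Z :: "real ^ 'd \<Rightarrow> 'w \<Rightarrow> real" and s :: "nat \<Rightarrow> real ^ 'd"
  assumes M: "prob_space M" and gp: "gaussian_process M Z" and zm: "zero_mean M Z"
    and cov: "has_stationary_covariance M Z k" and inj: "inj s"
  shows "gaussian_vector M n (\<lambda>i. Z (s i)) (\<lambda>i j. k (s i - s j))"
proof -
  interpret prob_space M by fact
  have int: "integrable M (Z x)" and mean: "expectation (Z x) = 0" for x
    using zm by (auto simp: zero_mean_def)
  have ci: "integrable M (\<lambda>\<omega>. Z x \<omega> * Z y \<omega>)" and ce: "expectation (\<lambda>\<omega>. Z x \<omega> * Z y \<omega>) = k (x - y)" for x y
    using cov mean unfolding has_stationary_covariance_def by (auto simp: mean)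
  show ?thesis
  proof (unfold_locales)
    show "Z (s i) \<in> borel_measurable M" for i using int by simp
    show "integrable M (\<lambda>\<omega>. Z (s i) \<omega> * Z (s j) \<omega>)" "expectation (\<lambda>\<omega>. Z (s i) \<omega> * Z (s j) \<omega>) = k (s i - s j)" for i j
      by (rule ci, rule ce)
    fix t :: "nat \<Rightarrow> real"
    define X where "X \<omega> = (\<Sum>i<n. t i * Z (s i) \<omega>)" for \<omega>
    have "gaussian_variable M X"
    proof -
      have "X = (\<lambda>\<omega>. \<Sum>x\<in>s ` {..<n}. t (the_inv s x) * Z x \<omega>)"
        unfolding X_def using inj
        by (intro ext, subst sum.reindex) (auto simp: inj_on_def the_inv_f_f intro!: sum.cong)
      then show ?thesis using gp unfolding gaussian_process_def by simp
    qed
    moreover have "integrable M X" unfolding X_def by (intro Bochner_Integration.integrable_sum integrable_mult_right int)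
    moreover have "expectation X = 0" unfolding X_def
      by (subst Bochner_Integration.integral_sum) (auto simp: int mean)
    moreover have "expectation (\<lambda>\<omega>. (X \<omega>)\<^sup>2) = (\<Sum>i<n. \<Sum>j<n. t i * t j * k (s i - s j))"
    proof -
      have e: "(X \<omega>)\<^sup>2 = (\<Sum>i<n. \<Sum>j<n. t i * t j * (Z (s i) \<omega> * Z (s j) \<omega>))" for \<omega>
        unfolding X_def by (simp add: power2_eq_square sum_product mult_ac)
      show ?thesis unfolding e
        by (simp add: Bochner_Integration.integral_sum Bochner_Integration.integrable_sum ci ce)
    qed
    ultimately show "expectation (\<lambda>\<omega>. iexp (\<Sum>i<n. t i * Z (s i) \<omega>))
       = complex_of_real (exp (- (\<Sum>i<n. \<Sum>j<n. t i * t j * k (s i - s j)) / 2))"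
      unfolding X_def by (rule centred_gaussian_char)
  qed
qed

section \<open>Variance of quadratic forms in a transformed Gaussian vector\<close>

lemma sum_sq_sq_le: "(\<Sum>i<n. (y i)\<^sup>2)\<^sup>2 \<le> real n * (\<Sum>i<n. (y i) ^ 4)" for y :: "nat \<Rightarrow> real"
  using Cauchy_Schwarz_ineq_sum[of "\<lambda>_. 1" "\<lambda>i. (y i)\<^sup>2" "{..<n}"] by simp

text \<open>
  The largest weight \<open>t\<^sub>i\<^sup>2\<close> is at most the square root of \<open>\<Sum> t\<^sub>i\<^sup>4\<close>. The resulting growth \<open>n\<^sup>1\<^sup>/\<^sup>2\<close> beyond
  the order \<open>n\<close> of the sums is affordable, since the variance has a factor \<open>n\<^sup>-\<^sup>2\<close> in front.
\<close>
lemma weighted_sq_sum_le: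
  fixes v t y :: "nat \<Rightarrow> real"
  assumes n: "0 < n" and v: "(\<Sum>i<n. (v i)\<^sup>2) \<le> K * (\<Sum>i<n. (y i)\<^sup>2)" and K: "0 \<le> K"
  shows "(\<Sum>i<n. (v i * t i)\<^sup>2) \<le> K * (sqrt (real n) / 2) * ((\<Sum>i<n. (t i) ^ 4) + (\<Sum>i<n. (y i) ^ 4))"
proof -
  define S where "S = (\<Sum>i<n. (t i) ^ 4)"
  define Q where "Q = (\<Sum>i<n. (y i)\<^sup>2)"
  define r where "r = sqrt (real n)"
  have r: "0 < r" "r * r = real n" unfolding r_def using n by auto
  have S: "0 \<le> S" unfolding S_def by (simp add: sum_nonneg)
  have Q: "0 \<le> Q" unfolding Q_def by (simp add: sum_nonneg)
  have t: "(t i)\<^sup>2 \<le> sqrt S" if "i < n" for i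
  proof (rule real_le_rsqrt)
    have "((t i)\<^sup>2)\<^sup>2 = (t i) ^ 4" by simp
    also have "\<dots> \<le> S" unfolding S_def by (rule member_le_sum) (use that in auto)
    finally show "((t i)\<^sup>2)\<^sup>2 \<le> S" .
  qed
  have "(\<Sum>i<n. (v i * t i)\<^sup>2) \<le> (\<Sum>i<n. (v i)\<^sup>2 * sqrt S)"
    by (intro sum_mono) (simp add: power_mult_distrib mult_left_mono t)
  also have "\<dots> = (\<Sum>i<n. (v i)\<^sup>2) * sqrt S" by (simp add: sum_distrib_right)
  also have "\<dots> \<le> K * Q * sqrt S" unfolding Q_def by (intro mult_right_mono v) (simp add: S)
  also have "\<dots> = K * (Q * sqrt S)" by simp
  also have "\<dots> \<le> K * ((r * S + r * (\<Sum>i<n. (y i) ^ 4)) / 2)"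
  proof (rule mult_left_mono[OF _ K])
    have "0 \<le> (r * sqrt S - Q)\<^sup>2" by simp
    then have "2 * (r * (Q * sqrt S)) \<le> (r * sqrt S)\<^sup>2 + Q\<^sup>2" by (simp add: power2_diff mult_ac)
    also have "(r * sqrt S)\<^sup>2 = r * (r * S)" using S by (simp add: power_mult_distrib power2_eq_square)
    also have "Q\<^sup>2 \<le> r * (r * (\<Sum>i<n. (y i) ^ 4))"
      unfolding Q_def mult.assoc[symmetric] r by (rule sum_sq_sq_le)
    finally have "r * (2 * (Q * sqrt S)) \<le> r * (r * S + r * (\<Sum>i<n. (y i) ^ 4))" by (simp add: algebra_simps)
    then have "2 * (Q * sqrt S) \<le> r * S + r * (\<Sum>i<n. (y i) ^ 4)" using r(1) by (simp only: mult_le_cancel_left_pos)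
    then show "Q * sqrt S \<le> (r * S + r * (\<Sum>i<n. (y i) ^ 4)) / 2" by simp
  qed
  finally show ?thesis unfolding S_def r_def by (simp add: algebra_simps)
qed

context prob_space
begin

text \<open>
  Averaging over the second copy inside the square can only decrease it.
\<close>
lemma variance_le_of_copy:
  fixes f :: "'a \<Rightarrow> real"
  assumes f: "integrable M f" and f2: "integrable M (\<lambda>\<omega>. (f \<omega>)\<^sup>2)" and c: "0 \<le> c"
    and le: "(\<integral>\<^sup>+\<omega>. ennreal ((f (fst \<omega>) - f (snd \<omega>))\<^sup>2) \<partial>(M \<Otimes>\<^sub>M M)) \<le> ennreal c"
  shows "variance f \<le> c"
proof -
  have [measurable]: "f \<in> borel_measurable M" using f by simp
  define \<mu> where "\<mu> = expectation f"
  have sqint: "integrable M (\<lambda>y. (a - f y)\<^sup>2)" for a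
  proof -
    have "integrable M (\<lambda>y. a\<^sup>2 + (f y)\<^sup>2 - 2 * a * f y)"
      using f f2 by (intro Bochner_Integration.integrable_diff Bochner_Integration.integrable_add integrable_mult_right) auto
    then show ?thesis by (simp add: power2_diff)
  qed
  have inner: "ennreal ((f x - \<mu>)\<^sup>2) \<le> (\<integral>\<^sup>+y. ennreal ((f x - f y)\<^sup>2) \<partial>M)" for x
  proof -
    \<comment> \<open>The variance of the second copy is the amount gained.\<close>
    have "0 \<le> expectation (\<lambda>y. (\<mu> - f y)\<^sup>2)" by simp
    also have "\<dots> = expectation (\<lambda>y. \<mu>\<^sup>2 + (f y)\<^sup>2 - 2 * \<mu> * f y)" by (simp add: power2_diff)
    also have "\<dots> = expectation (\<lambda>y. (f y)\<^sup>2) - \<mu>\<^sup>2"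
      using f f2 by (simp add: \<mu>_def[symmetric] prob_space power2_eq_square)
    finally have v: "\<mu>\<^sup>2 \<le> expectation (\<lambda>y. (f y)\<^sup>2)" by simp
    have "expectation (\<lambda>y. (f x - f y)\<^sup>2) = expectation (\<lambda>y. (f x)\<^sup>2 + (f y)\<^sup>2 - 2 * f x * f y)" by (simp add: power2_diff)
    also have "\<dots> = (f x)\<^sup>2 + expectation (\<lambda>y. (f y)\<^sup>2) - 2 * f x * \<mu>"
      using f f2 by (simp add: \<mu>_def[symmetric] prob_space)
    finally have "(f x - \<mu>)\<^sup>2 \<le> expectation (\<lambda>y. (f x - f y)\<^sup>2)" using v by (simp add: power2_diff)
    then have "ennreal ((f x - \<mu>)\<^sup>2) \<le> ennreal (expectation (\<lambda>y. (f x - f y)\<^sup>2))" by (rule ennreal_leI)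
    also have "\<dots> = (\<integral>\<^sup>+y. ennreal ((f x - f y)\<^sup>2) \<partial>M)"
      by (rule nn_integral_eq_integral[symmetric, OF sqint]) simp
    finally show ?thesis .
  qed
  have "ennreal (variance f) = (\<integral>\<^sup>+x. ennreal ((f x - \<mu>)\<^sup>2) \<partial>M)"
    unfolding \<mu>_def[symmetric]
    by (rule nn_integral_eq_integral[symmetric]) (use sqint[of \<mu>] in \<open>auto simp: power2_commute\<close>)
  also have "\<dots> \<le> (\<integral>\<^sup>+x. (\<integral>\<^sup>+y. ennreal ((f x - f y)\<^sup>2) \<partial>M) \<partial>M)"
    by (rule nn_integral_mono) (rule inner)
  also have "\<dots> = (\<integral>\<^sup>+\<omega>. ennreal ((f (fst \<omega>) - f (snd \<omega>))\<^sup>2) \<partial>(M \<Otimes>\<^sub>M M))"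
    using nn_integral_fst[of "\<lambda>\<omega>. ennreal ((f (fst \<omega>) - f (snd \<omega>))\<^sup>2)" M] by simp
  also have "\<dots> \<le> ennreal c" by (rule le)
  finally show ?thesis using c by (simp add: ennreal_le_iff)
qed

end

context gaussian_vector
begin

text \<open>
  The gradient of the form at \<open>z\<close> has entries \<open>2 / n (B\<^sup>T B y)\<^sub>i T'(z\<^sub>i)\<close> with \<open>y\<^sub>i = T(z\<^sub>i)\<close>. Its squared norm is of
  order \<open>n\<^sup>-\<^sup>2\<close> times \<open>n\<^sup>3\<^sup>/\<^sup>2\<close> in expectation.
\<close>
theorem quadratic_form_variance:
  fixes T T' :: "real \<Rightarrow> real"
  assumes n: "0 < n"
    and dT: "\<And>t. (T has_real_derivative T' t) (at t)" and cT': "continuous_on UNIV T'"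
    and m1: "\<And>i. i < n \<Longrightarrow> integrable M (\<lambda>\<omega>. (T (z i \<omega>)) ^ 4)" "\<And>i. i < n \<Longrightarrow> expectation (\<lambda>\<omega>. (T (z i \<omega>)) ^ 4) \<le> m"
    and m2: "\<And>i. i < n \<Longrightarrow> integrable M (\<lambda>\<omega>. (T' (z i \<omega>)) ^ 4)" "\<And>i. i < n \<Longrightarrow> expectation (\<lambda>\<omega>. (T' (z i \<omega>)) ^ 4) \<le> m"
    and Sg: "op_norm_le n Sg K" "0 \<le> K" and B: "op_norm_le n B b" "0 \<le> b"
  defines "f \<equiv> (\<lambda>\<omega>. (\<Sum>k<n. (matvec n B (\<lambda>j. T (z j \<omega>)) k)\<^sup>2) / real n)"
  shows "integrable M (\<lambda>\<omega>. (f \<omega>)\<^sup>2)" and "integrable M f"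
    and "variance f \<le> 4 * (pi / 2)\<^sup>2 * b ^ 4 * K * m / sqrt (real n)"
proof -
  note [measurable] = z_meas
  have cT: "continuous_on UNIV T"
    using dT by (intro continuous_at_imp_continuous_on) (auto intro: DERIV_isCont)
  have Tm[measurable]: "T \<in> borel_measurable borel" and T'm[measurable]: "T' \<in> borel_measurable borel"
    using cT cT' by (auto intro: borel_measurable_continuous_onI)
  have m0: "0 \<le> m"
    using order_trans[OF integral_nonneg_AE m1(2)[OF n]] by simp
  define F where "F u = (\<Sum>k<n. (matvec n B (\<lambda>j. T (u j)) k)\<^sup>2) / real n" for u
  define A where "A u i = (\<Sum>k<n. matvec n B (\<lambda>j. T (u j)) k * B k i)" for u i
  define G where "G i u = 2 / real n * (A u i * T' (u i))" for i u
  have fF: "f \<omega> = F (\<lambda>i. z i \<omega>)" for \<omega> unfolding f_def F_def ..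
  have fm[measurable]: "f \<in> borel_measurable M" unfolding f_def matvec_def by measurable
  have yint: "integrable M (\<lambda>\<omega>. \<Sum>i<n. (T (z i \<omega>)) ^ 4)" by (intro Bochner_Integration.integrable_sum m1) auto
  have tint: "integrable M (\<lambda>\<omega>. \<Sum>i<n. (T' (z i \<omega>)) ^ 4)" by (intro Bochner_Integration.integrable_sum m2) auto
  have f0: "0 \<le> f \<omega>" for \<omega> unfolding f_def by (simp add: sum_nonneg)
  have fle: "f \<omega> \<le> b\<^sup>2 * (\<Sum>i<n. (T (z i \<omega>))\<^sup>2) / real n" for \<omega>
    unfolding f_def by (intro divide_right_mono op_norm_le_sq B) auto
  have f2le: "(f \<omega>)\<^sup>2 \<le> (b\<^sup>2 / real n)\<^sup>2 * (real n * (\<Sum>i<n. (T (z i \<omega>)) ^ 4))" for \<omega>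
  proof -
    have "(f \<omega>)\<^sup>2 \<le> (b\<^sup>2 * (\<Sum>i<n. (T (z i \<omega>))\<^sup>2) / real n)\<^sup>2" by (rule power_mono[OF fle f0])
    also have "\<dots> = (b\<^sup>2 / real n)\<^sup>2 * (\<Sum>i<n. (T (z i \<omega>))\<^sup>2)\<^sup>2" by (simp add: power_mult_distrib power_divide)
    also have "\<dots> \<le> (b\<^sup>2 / real n)\<^sup>2 * (real n * (\<Sum>i<n. (T (z i \<omega>)) ^ 4))"
      by (intro mult_left_mono sum_sq_sq_le) auto
    finally show ?thesis .
  qed
  show f2: "integrable M (\<lambda>\<omega>. (f \<omega>)\<^sup>2)"
  proof (rule Bochner_Integration.integrable_bound)
    show "integrable M (\<lambda>\<omega>. (b\<^sup>2 / real n)\<^sup>2 * (real n * (\<Sum>i<n. (T (z i \<omega>)) ^ 4)))" using yint by simp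
    show "AE \<omega> in M. norm ((f \<omega>)\<^sup>2) \<le> norm ((b\<^sup>2 / real n)\<^sup>2 * (real n * (\<Sum>i<n. (T (z i \<omega>)) ^ 4)))"
      by (rule AE_I2) (use f2le in \<open>auto intro: order_trans[OF _ abs_ge_self]\<close>)
  qed measurable
  show f1: "integrable M f" using square_integrable_imp_integrable[OF fm f2] .
  have "(\<integral>\<^sup>+\<omega>. ennreal ((F (\<lambda>i. z i (fst \<omega>)) - F (\<lambda>i. z i (snd \<omega>)))\<^sup>2) \<partial>(M \<Otimes>\<^sub>M M))
    \<le> ennreal ((pi / 2)\<^sup>2) * (\<integral>\<^sup>+\<omega>. ennreal (\<Sum>i<n. \<Sum>j<n. G i (\<lambda>i. z i \<omega>) * G j (\<lambda>i. z i \<omega>) * Sg i j) \<partial>M)"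
  proof (rule poincare)
    fix i assume i: "i < n"
    have c: "(\<lambda>u. u j) \<in> borel_measurable (Pi\<^sub>M {..<n} (\<lambda>_. borel :: real measure))" if "j < n" for j
      by (rule measurable_component_singleton) (use that in simp)
    have cT: "(\<lambda>u. T (u j)) \<in> borel_measurable (Pi\<^sub>M {..<n} (\<lambda>_. borel :: real measure))" if "j < n" for j
      by (rule measurable_compose[OF c[OF that] Tm])
    show "G i \<in> borel_measurable (Pi\<^sub>M {..<n} (\<lambda>_. borel))"
      unfolding G_def[abs_def] A_def matvec_def
      by (intro borel_measurable_times borel_measurable_const borel_measurable_sum measurable_compose[OF c T'm])
         (auto intro: cT i)
    fix u v :: "nat \<Rightarrow> real"
    {
      assume uv: "\<And>j. j < n \<Longrightarrow> u j = v j"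
      show "G i u = G i v" unfolding G_def A_def matvec_def using uv i by simp
    }
    show "continuous_on UNIV (\<lambda>\<theta>. G i (\<lambda>i. cos \<theta> * u i + sin \<theta> * v i))"
      unfolding G_def A_def matvec_def
      by (intro continuous_intros continuous_on_compose2[OF cT'] continuous_on_compose2[OF \<open>continuous_on UNIV T\<close>]) auto
  next
    fix u v :: "nat \<Rightarrow> real" and \<theta> :: real
    define w where "w i \<theta> = cos \<theta> * u i + sin \<theta> * v i" for i \<theta>
    define w' where "w' i = - sin \<theta> * u i + cos \<theta> * v i" for i
    have dw: "(w i has_real_derivative w' i) (at \<theta>)" for i
      unfolding w_def w'_def by (auto intro!: derivative_eq_intros)
    have dm: "((\<lambda>\<theta>. matvec n B (\<lambda>j. T (w j \<theta>)) k) has_real_derivative (\<Sum>j<n. B k j * (T' (w j \<theta>) * w' j))) (at \<theta>)" for k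
      unfolding matvec_def by (intro DERIV_sum DERIV_cmult DERIV_chain2[OF dT dw])
    have dF: "((\<lambda>\<theta>. F (\<lambda>i. w i \<theta>)) has_real_derivative
        (\<Sum>k<n. 2 * matvec n B (\<lambda>j. T (w j \<theta>)) k * (\<Sum>j<n. B k j * (T' (w j \<theta>) * w' j))) / real n) (at \<theta>)"
      unfolding F_def
    proof (intro DERIV_cdivide DERIV_sum)
      fix k
      show "((\<lambda>\<theta>. (matvec n B (\<lambda>j. T (w j \<theta>)) k)\<^sup>2) has_real_derivative
          2 * matvec n B (\<lambda>j. T (w j \<theta>)) k * (\<Sum>j<n. B k j * (T' (w j \<theta>) * w' j))) (at \<theta>)"
        using DERIV_power[where n=2, OF dm[of k]] by (simp add: mult_ac)
    qed
    have "(\<Sum>k<n. 2 * matvec n B (\<lambda>j. T (w j \<theta>)) k * (\<Sum>j<n. B k j * (T' (w j \<theta>) * w' j))) / real n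
      = (\<Sum>j<n. G j (\<lambda>i. w i \<theta>) * w' j)"
    proof -
      have "(\<Sum>k<n. 2 * matvec n B (\<lambda>j. T (w j \<theta>)) k * (\<Sum>j<n. B k j * (T' (w j \<theta>) * w' j)))
         = (\<Sum>j<n. \<Sum>k<n. 2 * matvec n B (\<lambda>j. T (w j \<theta>)) k * (B k j * (T' (w j \<theta>) * w' j)))"
        unfolding sum_distrib_left by (rule sum.swap)
      also have "\<dots> = (\<Sum>j<n. 2 * (A (\<lambda>i. w i \<theta>) j * T' (w j \<theta>)) * w' j)"
        unfolding A_def sum_distrib_left sum_distrib_right by (simp add: mult_ac)
      finally show ?thesis unfolding G_def by (simp add: sum_divide_distrib)
    qed
    with dF show "((\<lambda>\<theta>. F (\<lambda>i. cos \<theta> * u i + sin \<theta> * v i)) has_real_derivative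
        (\<Sum>i<n. G i (\<lambda>i. cos \<theta> * u i + sin \<theta> * v i) * (- sin \<theta> * u i + cos \<theta> * v i))) (at \<theta>)"
      unfolding w_def w'_def by simp
  qed
  also have "(\<integral>\<^sup>+\<omega>. ennreal (\<Sum>i<n. \<Sum>j<n. G i (\<lambda>i. z i \<omega>) * G j (\<lambda>i. z i \<omega>) * Sg i j) \<partial>M)
     \<le> (\<integral>\<^sup>+\<omega>. ennreal (K * ((2 / real n)\<^sup>2 * (b ^ 4 * (sqrt (real n) / 2) *
           ((\<Sum>i<n. (T' (z i \<omega>)) ^ 4) + (\<Sum>i<n. (T (z i \<omega>)) ^ 4))))) \<partial>M)"
  proof (rule nn_integral_mono, rule ennreal_leI)
    fix \<omega>
    let ?u = "\<lambda>i. z i \<omega>"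
    have "(\<Sum>i<n. \<Sum>j<n. G i ?u * G j ?u * Sg i j) \<le> K * (\<Sum>i<n. (G i ?u)\<^sup>2)"
      by (rule quadratic_form_le[OF Sg(1)])
    also have "(\<Sum>i<n. (G i ?u)\<^sup>2) = (2 / real n)\<^sup>2 * (\<Sum>i<n. (A ?u i * T' (?u i))\<^sup>2)"
      unfolding G_def sum_distrib_left by (simp add: power_mult_distrib power_divide)
    also have "(\<Sum>i<n. (A ?u i * T' (?u i))\<^sup>2)
       \<le> b ^ 4 * (sqrt (real n) / 2) * ((\<Sum>i<n. (T' (?u i)) ^ 4) + (\<Sum>i<n. (T (?u i)) ^ 4))"
    proof (rule weighted_sq_sum_le[OF n])
      have "A ?u i = matvec n (\<lambda>i j. B j i) (matvec n B (\<lambda>j. T (?u j))) i" for i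
        unfolding A_def matvec_def[of n "\<lambda>i j. B j i"] by (simp add: mult.commute)
      then have "(\<Sum>i<n. (A ?u i)\<^sup>2) \<le> b\<^sup>2 * (\<Sum>i<n. (matvec n B (\<lambda>j. T (?u j)) i)\<^sup>2)"
        using op_norm_le_sq[OF op_norm_le_transpose[OF B]] by simp
      also have "\<dots> \<le> b\<^sup>2 * (b\<^sup>2 * (\<Sum>i<n. (T (?u i))\<^sup>2))"
        by (intro mult_left_mono op_norm_le_sq B) auto
      finally show "(\<Sum>i<n. (A ?u i)\<^sup>2) \<le> b ^ 4 * (\<Sum>i<n. (T (?u i))\<^sup>2)"
        by (simp add: power2_eq_square power4_eq_xxxx mult.assoc)
    qed (use B in simp)
    finally show "(\<Sum>i<n. \<Sum>j<n. G i ?u * G j ?u * Sg i j)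
      \<le> K * ((2 / real n)\<^sup>2 * (b ^ 4 * (sqrt (real n) / 2) * ((\<Sum>i<n. (T' (?u i)) ^ 4) + (\<Sum>i<n. (T (?u i)) ^ 4))))"
      using Sg(2) by (simp add: mult_left_mono)
  qed
  also have "\<dots> = ennreal (K * ((2 / real n)\<^sup>2 * (b ^ 4 * (sqrt (real n) / 2) *
           (expectation (\<lambda>\<omega>. \<Sum>i<n. (T' (z i \<omega>)) ^ 4) + expectation (\<lambda>\<omega>. \<Sum>i<n. (T (z i \<omega>)) ^ 4)))))"
    by (subst nn_integral_eq_integral)
       (use yint tint Sg B in \<open>auto intro!: mult_nonneg_nonneg add_nonneg_nonneg sum_nonneg\<close>)
  also have "\<dots> \<le> ennreal (K * ((2 / real n)\<^sup>2 * (b ^ 4 * (sqrt (real n) / 2) * (real n * m + real n * m))))"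
  proof (intro ennreal_leI mult_left_mono add_mono)
    have "expectation (\<lambda>\<omega>. \<Sum>i<n. (T' (z i \<omega>)) ^ 4) = (\<Sum>i<n. expectation (\<lambda>\<omega>. (T' (z i \<omega>)) ^ 4))"
      by (rule Bochner_Integration.integral_sum) (use m2 in auto)
    also have "\<dots> \<le> (\<Sum>i<n. m)" by (intro sum_mono m2) auto
    finally show "expectation (\<lambda>\<omega>. \<Sum>i<n. (T' (z i \<omega>)) ^ 4) \<le> real n * m" by simp
    have "expectation (\<lambda>\<omega>. \<Sum>i<n. (T (z i \<omega>)) ^ 4) = (\<Sum>i<n. expectation (\<lambda>\<omega>. (T (z i \<omega>)) ^ 4))"
      by (rule Bochner_Integration.integral_sum) (use m1 in auto)
    also have "\<dots> \<le> (\<Sum>i<n. m)" by (intro sum_mono m1) auto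
    finally show "expectation (\<lambda>\<omega>. \<Sum>i<n. (T (z i \<omega>)) ^ 4) \<le> real n * m" by simp
  qed (use Sg B in auto)
  also have "K * ((2 / real n)\<^sup>2 * (b ^ 4 * (sqrt (real n) / 2) * (real n * m + real n * m)))
     = 4 * b ^ 4 * K * m / sqrt (real n)"
  proof -
    define r where "r = sqrt (real n)"
    have r: "r \<noteq> 0" "real n = r * r" unfolding r_def using n by auto
    show ?thesis unfolding r_def[symmetric] unfolding r(2) using r(1) by (simp add: power2_eq_square)
  qed
  finally have "(\<integral>\<^sup>+\<omega>. ennreal ((f (fst \<omega>) - f (snd \<omega>))\<^sup>2) \<partial>(M \<Otimes>\<^sub>M M))
     \<le> ennreal ((pi / 2)\<^sup>2) * ennreal (4 * b ^ 4 * K * m / sqrt (real n))"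
    unfolding fF by (simp add: mult_left_mono)
  also have "\<dots> = ennreal ((pi / 2)\<^sup>2 * (4 * b ^ 4 * K * m / sqrt (real n)))"
    using Sg B m0 by (intro ennreal_mult[symmetric]) auto
  also have "(pi / 2)\<^sup>2 * (4 * b ^ 4 * K * m / sqrt (real n)) = 4 * (pi / 2)\<^sup>2 * b ^ 4 * K * m / sqrt (real n)"
    by simp
  finally have fin: "(\<integral>\<^sup>+\<omega>. ennreal ((f (fst \<omega>) - f (snd \<omega>))\<^sup>2) \<partial>(M \<Otimes>\<^sub>M M))
     \<le> ennreal (4 * (pi / 2)\<^sup>2 * b ^ 4 * K * m / sqrt (real n))" .
  show "variance f \<le> 4 * (pi / 2)\<^sup>2 * b ^ 4 * K * m / sqrt (real n)"
    by (rule variance_le_of_copy[OF f1 f2 _ fin]) (use Sg B m0 in auto)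
qed

end

section \<open>Lipschitz dependence on the parameter\<close>

text \<open>
  Only derivatives within \<open>U\<close> are available, which is enough for the mean value theorem on a segment
  that stays in \<open>U\<close>.
\<close>
lemma segment_lipschitz:
  fixes g :: "'a::euclidean_space \<Rightarrow> real"
  assumes seg: "closed_segment x y \<subseteq> U" and d: "g differentiable_on U"
    and b: "\<And>\<theta> b. \<theta> \<in> U \<Longrightarrow> b \<in> Basis \<Longrightarrow> \<bar>pderiv_within U b g \<theta>\<bar> \<le> B"
  shows "\<bar>g x - g y\<bar> \<le> real DIM('a) * B * norm (x - y)"
proof -
  have "norm (g x - g y) \<le> (real DIM('a) * B) * norm (x - y)"
  proof (rule differentiable_bound[of "closed_segment x y" g "\<lambda>u. frechet_derivative g (at u within U)"])
    fix u assume u: "u \<in> closed_segment x y"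
    then have uU: "u \<in> U" using seg by auto
    have D: "(g has_derivative frechet_derivative g (at u within U)) (at u within U)"
      using d uU unfolding differentiable_on_def frechet_derivative_works by blast
    then show "(g has_derivative frechet_derivative g (at u within U)) (at u within closed_segment x y)"
      by (rule has_derivative_subset[OF _ seg])
    have "onorm (frechet_derivative g (at u within U)) \<le> (\<Sum>i\<in>Basis. norm (frechet_derivative g (at u within U) i))"
      by (rule onorm_componentwise) (use D has_derivative_bounded_linear in blast)
    also have "\<dots> \<le> (\<Sum>i\<in>(Basis::'a set). B)"
      by (intro sum_mono) (use b[OF uU] in \<open>simp add: pderiv_within_def\<close>)
    finally show "onorm (frechet_derivative g (at u within U)) \<le> real DIM('a) * B" by simp
  qed auto
  then show ?thesis by simp
qed

text \<open>
  If \<open>U\<close> is open, a Lebesgue number of the compact parameter set keeps short segments inside \<open>U\<close>;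
  if \<open>U\<close> is convex, all segments qualify.
\<close>
lemma regular_model_lipschitz:
  fixes k :: "'a::euclidean_space \<Rightarrow> real ^ 'd \<Rightarrow> real"
  assumes reg: "regular_model \<Theta> k" and comp: "compact \<Theta>"
  obtains \<delta> C c where "0 < \<delta>" "0 < C" "0 < c"
    "\<And>\<theta> \<theta>' s. \<theta> \<in> \<Theta> \<Longrightarrow> \<theta>' \<in> \<Theta> \<Longrightarrow> dist \<theta> \<theta>' < \<delta> \<Longrightarrow>
       \<bar>k \<theta> s - k \<theta>' s\<bar> \<le> C * dist \<theta> \<theta>' * (1 / (1 + infnorm s powr (real CARD('d) + c)))"
    "\<And>\<theta> s. \<theta> \<in> \<Theta> \<Longrightarrow> \<bar>k \<theta> s\<bar> \<le> C * exp (- c * infnorm s)"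
proof -
  obtain U K C c where r: "\<Theta> \<subseteq> U \<and> (convex U \<or> open U) \<and> 0 < c \<and>
        (\<forall>\<theta>\<in>\<Theta>. \<forall>s. K \<theta> s = k \<theta> s) \<and>
        (\<forall>s. continuously_differentiable_on 3 (\<lambda>\<theta>. K \<theta> s) U) \<and>
        (\<forall>\<theta>\<in>\<Theta>. \<forall>s. \<bar>k \<theta> s\<bar> \<le> C * exp (- c * infnorm s)) \<and>
        (\<forall>\<theta>\<in>U. \<forall>s. \<forall>bs. set bs \<subseteq> Basis \<and> length bs \<in> {1, 2, 3} \<longrightarrow>
           \<bar>iterated_pderiv_within U bs (\<lambda>\<theta>. K \<theta> s) \<theta>\<bar>
             \<le> C / (1 + infnorm s powr (real CARD('d) + c)))"
    using reg unfolding regular_model_def by (elim exE) (rule that)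
  from r have U: "\<Theta> \<subseteq> U" "convex U \<or> open U" by (simp_all only: simp_thms)
  from r have c: "0 < c" by (elim conjE)
  from r have K: "K \<theta> s = k \<theta> s" if "\<theta> \<in> \<Theta>" for \<theta> s using that by (elim conjE) blast
  from r have cd: "continuously_differentiable_on 3 (\<lambda>\<theta>. K \<theta> s) U" for s by (elim conjE) (erule spec)
  from r have ex: "\<bar>k \<theta> s\<bar> \<le> C * exp (- c * infnorm s)" if "\<theta> \<in> \<Theta>" for \<theta> s using that by (elim conjE) blast
  from r have der: "\<bar>iterated_pderiv_within U bs (\<lambda>\<theta>. K \<theta> s) \<theta>\<bar> \<le> C / (1 + infnorm s powr (real CARD('d) + c))"
    if "\<theta> \<in> U" "set bs \<subseteq> Basis" "length bs \<in> {1, 2, 3}" for \<theta> s bs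
    using that by (elim conjE) blast
  have diff: "(\<lambda>\<theta>. K \<theta> s) differentiable_on U" for s
    using cd[of s] by (simp add: numeral_3_eq_3)
  have der1: "\<bar>pderiv_within U b (\<lambda>\<theta>. K \<theta> s) \<theta>\<bar> \<le> C / (1 + infnorm s powr (real CARD('d) + c))"
    if "\<theta> \<in> U" "b \<in> Basis" for \<theta> b s
    using der[of \<theta> "[b]" s] that by simp
  obtain \<delta> where \<delta>: "0 < \<delta>" and seg: "\<And>\<theta> \<theta>'. \<theta> \<in> \<Theta> \<Longrightarrow> \<theta>' \<in> \<Theta> \<Longrightarrow> dist \<theta> \<theta>' < \<delta> \<Longrightarrow> closed_segment \<theta> \<theta>' \<subseteq> U"
  proof (cases "convex U")
    case True
    have "closed_segment \<theta> \<theta>' \<subseteq> U" if "\<theta> \<in> \<Theta>" "\<theta>' \<in> \<Theta>" for \<theta> \<theta>'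
      using True that U(1) by (intro closed_segment_subset) auto
    then show thesis using that[of 1] by simp
  next
    case False
    then have "open U" using U(2) by simp
    then obtain e where e: "0 < e" "(\<Union>x\<in>\<Theta>. ball x e) \<subseteq> U"
      by (rule compact_subset_open_imp_ball_epsilon_subset[OF comp _ U(1)])
    have "closed_segment \<theta> \<theta>' \<subseteq> U" if "\<theta> \<in> \<Theta>" "\<theta>' \<in> \<Theta>" "dist \<theta> \<theta>' < e" for \<theta> \<theta>'
    proof -
      have "closed_segment \<theta> \<theta>' \<subseteq> ball \<theta> e" using that e(1) by (intro closed_segment_subset) auto
      then show ?thesis using e(2) that(1) by auto
    qed
    then show thesis using that[of e] e(1) by simp
  qed
  define C' where "C' = real DIM('a) * \<bar>C\<bar> + \<bar>C\<bar> + 1"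
  have D0: "0 \<le> real DIM('a) * \<bar>C\<bar>" by simp
  show thesis
  proof (rule that[OF \<delta> _ c])
    show "0 < C'" unfolding C'_def using D0 by linarith
    fix \<theta> \<theta>' :: 'a and s :: "real ^ 'd" assume t: "\<theta> \<in> \<Theta>" "\<theta>' \<in> \<Theta>" "dist \<theta> \<theta>' < \<delta>"
    let ?w = "1 / (1 + infnorm s powr (real CARD('d) + c))"
    have w: "0 \<le> ?w" by simp
    have "\<bar>K \<theta> s - K \<theta>' s\<bar> \<le> real DIM('a) * (C / (1 + infnorm s powr (real CARD('d) + c))) * norm (\<theta> - \<theta>')"
      by (rule segment_lipschitz[OF seg[OF t] diff der1])
    also have "\<dots> = (real DIM('a) * C) * (dist \<theta> \<theta>' * ?w)" by (simp add: dist_norm)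
    also have "\<dots> \<le> C' * (dist \<theta> \<theta>' * ?w)"
    proof (rule mult_right_mono)
      have "real DIM('a) * C \<le> real DIM('a) * \<bar>C\<bar>" by (intro mult_left_mono) auto
      then show "real DIM('a) * C \<le> C'" unfolding C'_def by linarith
    qed (use w in \<open>simp add: mult_nonneg_nonneg\<close>)
    finally show "\<bar>k \<theta> s - k \<theta>' s\<bar> \<le> C' * dist \<theta> \<theta>' * ?w" using K t by (simp add: mult.assoc)
  next
    fix \<theta> :: 'a and s :: "real ^ 'd" assume t: "\<theta> \<in> \<Theta>"
    have "C * exp (- c * infnorm s) \<le> C' * exp (- c * infnorm s)"
    proof (rule mult_right_mono)
      show "C \<le> C'" unfolding C'_def using D0 by linarith
    qed simp
    then show "\<bar>k \<theta> s\<bar> \<le> C' * exp (- c * infnorm s)" using ex[OF t, of s] by linarith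
  qed
qed

section \<open>Minimisers of equicontinuous concentrating criteria\<close>

text \<open>
  Off the event that the criterion deviates from its deterministic limit at the reference point or
  at a point of a finite net, or that the Lipschitz factor is large, no parameter at distance
  \<open>\<epsilon>\<close> can beat the reference point. No supremum over the parameter set has to be measurable.
\<close>
lemma (in prob_space) argmin_consistent:
  fixes Q :: "nat \<Rightarrow> 'p::euclidean_space \<Rightarrow> 'a \<Rightarrow> real" and e :: "nat \<Rightarrow> 'p \<Rightarrow> real"
    and W :: "nat \<Rightarrow> 'a \<Rightarrow> real" and X :: "nat \<Rightarrow> 'a \<Rightarrow> 'p"
  assumes S: "compact S" and p0: "p0 \<in> S"
    and Qm: "\<And>n p. p \<in> S \<Longrightarrow> Q n p \<in> borel_measurable M" and Wm: "\<And>n. W n \<in> borel_measurable M"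
    and Xm: "\<And>n. 1 \<le> n \<Longrightarrow> X n \<in> borel_measurable M"
    and conc: "\<And>p \<eta>. p \<in> S \<Longrightarrow> 0 < \<eta> \<Longrightarrow> (\<lambda>n. prob {\<omega>\<in>space M. \<eta> \<le> \<bar>Q n p \<omega> - e n p\<bar>}) \<longlonglongrightarrow> 0"
    and concW: "(\<lambda>n. prob {\<omega>\<in>space M. 1 \<le> \<bar>W n \<omega> - w\<bar>}) \<longlonglongrightarrow> 0"
    and lip: "0 < \<delta>" "0 \<le> K" "\<And>n p p' \<omega>. 1 \<le> n \<Longrightarrow> p \<in> S \<Longrightarrow> p' \<in> S \<Longrightarrow> dist p p' < \<delta> \<Longrightarrow>
        \<bar>Q n p \<omega> - Q n p' \<omega>\<bar> \<le> K * dist p p' * W n \<omega>"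
    and sep: "\<And>\<alpha>. 0 < \<alpha> \<Longrightarrow> \<exists>A>0. \<forall>\<^sub>F n in sequentially. \<forall>p\<in>S. \<alpha> \<le> dist p p0 \<longrightarrow> A \<le> e n p - e n p0"
    and argmin: "\<And>n \<omega>. 1 \<le> n \<Longrightarrow> \<omega> \<in> space M \<Longrightarrow> X n \<omega> \<in> S \<and> Q n (X n \<omega>) \<omega> \<le> Q n p0 \<omega>"
  shows "converges_in_probability M X p0"
  unfolding converges_in_probability_def
proof (intro allI impI)
  fix \<epsilon> :: real assume eps: "0 < \<epsilon>"
  obtain A where A: "0 < A"
    and ev: "\<forall>\<^sub>F n in sequentially. \<forall>p\<in>S. \<epsilon> \<le> dist p p0 \<longrightarrow> A \<le> e n p - e n p0"
    using sep[OF eps] by blast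
  define B where "B = \<bar>w\<bar> + 1"
  have B: "0 < B" unfolding B_def by simp
  define r where "r = min \<delta> (A / (4 * (K + 1) * B))"
  have r: "0 < r" unfolding r_def using lip(1,2) A B by simp
  have rA: "K * r * B \<le> A / 4"
  proof -
    have "K * r * B \<le> (K + 1) * (A / (4 * (K + 1) * B)) * B"
      unfolding r_def using lip(1,2) A B by (intro mult_right_mono mult_mono) auto
    also have "\<dots> = A / 4"
    proof -
      have g: "k * (A / (4 * k * b)) * b = A / 4" if "k \<noteq> 0" "b \<noteq> 0" for k b :: real
        using that by (simp add: divide_simps)
      have "K + 1 \<noteq> 0" "B \<noteq> 0" using lip(2) B by linarith+
      then show ?thesis by (rule g)
    qed
    finally show ?thesis .
  qed
  obtain N where N: "finite N" "N \<subseteq> S \<inter> {p. \<epsilon> \<le> dist p p0}" "S \<inter> {p. \<epsilon> \<le> dist p p0} \<subseteq> (\<Union>p\<in>N. ball p r)"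
  proof -
    have cl: "closed {p. \<epsilon> \<le> dist p p0}" by (intro closed_Collect_le continuous_intros)
    have "compact (S \<inter> {p. \<epsilon> \<le> dist p p0})" by (rule compact_Int_closed[OF S cl])
    then show thesis
    proof (rule compactE_image[where f="\<lambda>p. ball p r" and C="S \<inter> {p. \<epsilon> \<le> dist p p0}"])
      show "S \<inter> {p. \<epsilon> \<le> dist p p0} \<subseteq> (\<Union>p\<in>S \<inter> {p. \<epsilon> \<le> dist p p0}. ball p r)"
        using r by (intro subsetI UN_I) auto
    next
      fix N assume "N \<subseteq> S \<inter> {p. \<epsilon> \<le> dist p p0}" "finite N" "S \<inter> {p. \<epsilon> \<le> dist p p0} \<subseteq> (\<Union>p\<in>N. ball p r)"
      then show thesis by (intro that)
    qed simp
  qed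
  define bad where "bad n p = {\<omega>\<in>space M. A / 4 \<le> \<bar>Q n p \<omega> - e n p\<bar>}" for n p
  define badW where "badW n = {\<omega>\<in>space M. 1 \<le> \<bar>W n \<omega> - w\<bar>}" for n
  have NS: "p \<in> S" if "p \<in> insert p0 N" for p using that N(2) p0 by auto
  have badm: "bad n p \<in> sets M" if "p \<in> insert p0 N" for n p
  proof -
    have [measurable]: "Q n p \<in> borel_measurable M" by (rule Qm[OF NS[OF that]])
    show ?thesis unfolding bad_def by measurable
  qed
  have badWm: "badW n \<in> sets M" for n
  proof -
    have [measurable]: "W n \<in> borel_measurable M" by (rule Wm)
    show ?thesis unfolding badW_def by measurable
  qed
  have le: "\<forall>\<^sub>F n in sequentially. prob {\<omega>\<in>space M. \<epsilon> < dist (X n \<omega>) p0} \<le> (\<Sum>p\<in>insert p0 N. prob (bad n p)) + prob (badW n)"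
    using ev eventually_ge_at_top[of 1]
  proof eventually_elim
    case (elim n)
    have "{\<omega>\<in>space M. \<epsilon> < dist (X n \<omega>) p0} \<subseteq> (\<Union>p\<in>insert p0 N. bad n p) \<union> badW n"
    proof (rule subsetI, rule ccontr)
      fix \<omega> assume w: "\<omega> \<in> {\<omega>\<in>space M. \<epsilon> < dist (X n \<omega>) p0}" and nb: "\<omega> \<notin> (\<Union>p\<in>insert p0 N. bad n p) \<union> badW n"
      let ?x = "X n \<omega>"
      have sp: "\<omega> \<in> space M" using w by simp
      have x: "?x \<in> S" "Q n ?x \<omega> \<le> Q n p0 \<omega>" using argmin[OF elim(2) sp] by auto
      have "?x \<in> S \<inter> {p. \<epsilon> \<le> dist p p0}" using x(1) w by simp
      then have "?x \<in> (\<Union>p\<in>N. ball p r)" by (rule subsetD[OF N(3)])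
      then obtain p where "p \<in> N" "?x \<in> ball p r" by (rule UN_E)
      then have p: "p \<in> N" "dist p ?x < r" by simp_all
      have pS: "p \<in> S" "\<epsilon> \<le> dist p p0" using p(1) N(2) by auto
      have good: "\<bar>Q n q \<omega> - e n q\<bar> < A / 4" if "q \<in> insert p0 N" for q
      proof -
        have "\<omega> \<notin> bad n q" using nb that by (intro notI) (elim notE, rule UnI1, rule UN_I)
        then show ?thesis using sp by (simp add: bad_def)
      qed
      have "\<omega> \<notin> badW n" using nb by (intro notI) (elim notE, rule UnI2)
      then have "\<bar>W n \<omega> - w\<bar> < 1" using sp by (simp add: badW_def)
      then have WB: "W n \<omega> \<le> B" unfolding B_def by linarith
      have "\<bar>Q n p \<omega> - Q n ?x \<omega>\<bar> \<le> K * dist p ?x * W n \<omega>"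
        by (rule lip(3)[OF elim(2) pS(1) x(1)]) (use p(2) r_def in simp)
      also have "\<dots> \<le> K * dist p ?x * B" by (rule mult_left_mono[OF WB]) (simp add: lip(2))
      also have "\<dots> \<le> K * r * B" using p(2) lip(2) B by (intro mult_right_mono mult_left_mono) auto
      also have "\<dots> \<le> A / 4" by (rule rA)
      finally have d: "\<bar>Q n p \<omega> - Q n ?x \<omega>\<bar> \<le> A / 4" .
      have "A \<le> e n p - e n p0" using elim(1) pS by blast
      moreover have "\<bar>Q n p \<omega> - e n p\<bar> < A / 4" "\<bar>Q n p0 \<omega> - e n p0\<bar> < A / 4" using good p(1) by auto
      ultimately show False using d x(2) A by linarith
    qed
    moreover have um: "(\<Union>p\<in>insert p0 N. bad n p) \<in> sets M"
      by (rule sets.finite_UN) (use N(1) badm in auto)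
    ultimately have "prob {\<omega>\<in>space M. \<epsilon> < dist (X n \<omega>) p0} \<le> prob ((\<Union>p\<in>insert p0 N. bad n p) \<union> badW n)"
      by (intro finite_measure_mono sets.Un badWm) auto
    also have "\<dots> \<le> prob (\<Union>p\<in>insert p0 N. bad n p) + prob (badW n)"
      by (rule measure_Un_le[OF um badWm])
    also have "prob (\<Union>p\<in>insert p0 N. bad n p) \<le> (\<Sum>p\<in>insert p0 N. prob (bad n p))"
      using badm N(1) by (intro finite_measure_subadditive_finite) auto
    finally show ?case by simp
  qed
  have "(\<lambda>n. (\<Sum>p\<in>insert p0 N. prob (bad n p)) + prob (badW n)) \<longlonglongrightarrow> (\<Sum>p\<in>insert p0 N. 0) + 0"
    unfolding bad_def badW_def by (intro tendsto_add tendsto_sum conc concW) (use NS A in auto)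
  then have lim: "(\<lambda>n. (\<Sum>p\<in>insert p0 N. prob (bad n p)) + prob (badW n)) \<longlonglongrightarrow> 0" by simp
  show "(\<lambda>n. prob {\<omega>\<in>space M. \<epsilon> < dist (X n \<omega>) p0}) \<longlonglongrightarrow> 0"
    by (rule tendsto_sandwich[OF _ le tendsto_const lim]) simp
qed

section \<open>Uniform bounds for the correlation matrices of the model\<close>

text \<open>
  The Bochner integral of a function that is not integrable is zero.
\<close>
lemma fourier_nonzero_integrable:
  assumes "fourier k 0 \<noteq> 0"
  shows "integrable lebesgue k"
proof -
  have "integrable lebesgue (\<lambda>t. complex_of_real (k t))"
  proof (rule ccontr)
    assume "\<not> ?thesis"
    then have "(\<integral>t. complex_of_real (k t) \<partial>lebesgue) = 0" by (rule not_integrable_integral_eq)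
    with assms show False by (simp add: fourier_def)
  qed
  then show ?thesis by (simp add: complex_of_real_integrable_eq)
qed

lemma stationary_covariance_scale:
  assumes "stationary_covariance k" "0 \<le> v"
  shows "stationary_covariance (\<lambda>s. v * k s)"
  unfolding stationary_covariance_def covariance_function_def
proof (intro conjI allI)
  show "v * k (x - y) = v * k (y - x)" for x y
    using covariance_even[OF assms(1), of "x - y"] by simp
  fix n :: nat and x a
  have "0 \<le> (\<Sum>i<n. \<Sum>j<n. a i * a j * k (x i - x j))"
    using assms(1) unfolding stationary_covariance_def covariance_function_def by blast
  then have "0 \<le> v * (\<Sum>i<n. \<Sum>j<n. a i * a j * k (x i - x j))" using assms(2) by simp
  then show "0 \<le> (\<Sum>i<n. \<Sum>j<n. a i * a j * (v * k (x i - x j)))"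
    by (simp add: sum_distrib_left mult_ac)
qed

context separated
begin

lemma kernel_op_norm_le:
  assumes k: "\<And>v. \<bar>k v\<bar> \<le> C * w v" and even: "\<And>v. k (- v) = k v" and C: "0 \<le> C"
    and K: "\<And>n z. (\<Sum>j<n. w (z - x j)) \<le> K" "0 \<le> K"
  shows "op_norm_le n (\<lambda>i j. k (x i - x j)) (C * K)"
proof (rule op_norm_le_row_sums)
  show row: "(\<Sum>j<n. \<bar>k (x i - x j)\<bar>) \<le> C * K" for i
  proof -
    have "(\<Sum>j<n. \<bar>k (x i - x j)\<bar>) \<le> (\<Sum>j<n. C * w (x i - x j))" by (intro sum_mono k)
    also have "\<dots> \<le> C * K" unfolding sum_distrib_left[symmetric] by (intro mult_left_mono K C)
    finally show ?thesis .
  qed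
  show "(\<Sum>i<n. \<bar>k (x i - x j)\<bar>) \<le> C * K" for j
  proof -
    have "k (x i - x j) = k (x j - x i)" for i using even[of "x j - x i"] by simp
    then show ?thesis using row[of j] by simp
  qed
  show "0 \<le> C * K" using C K by simp
qed

text \<open>
  Correlations are \<open>1 / vinf\<close> times the covariances with parameter \<open>(vinf, \<psi>)\<close>. The lower spectral
  bound is the minimum of a continuous positive function on a compact set of parameters and
  frequencies.
\<close>
lemma correlation_model_bounds:
  fixes c :: "real ^ 'q \<Rightarrow> real ^ 'd \<Rightarrow> real"
  assumes v: "0 < vinf" "vinf < vsup" and S: "compact S" "S \<noteq> {}"
    and corr: "\<And>\<psi>. \<psi> \<in> S \<Longrightarrow> stationary_correlation (c \<psi>)"
    and reg: "regular_model (param_space vinf vsup S) (model_cov c)"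
    and four: "positive_continuous_fourier (param_space vinf vsup S) (model_cov c)"
  obtains l L \<delta> P where "0 < l" "0 < L" "0 < \<delta>" "0 \<le> P"
    "\<And>\<psi> n a. \<psi> \<in> S \<Longrightarrow> l * (\<Sum>i<n. (a i)\<^sup>2) \<le> (\<Sum>i<n. a i * matvec n (\<lambda>i j. c \<psi> (x i - x j)) a i)"
    "\<And>\<psi> n. \<psi> \<in> S \<Longrightarrow> op_norm_le n (\<lambda>i j. c \<psi> (x i - x j)) L"
    "\<And>\<psi> \<psi>' n. \<psi> \<in> S \<Longrightarrow> \<psi>' \<in> S \<Longrightarrow> dist \<psi> \<psi>' < \<delta> \<Longrightarrow>
       op_norm_le n (\<lambda>i j. c \<psi> (x i - x j) - c \<psi>' (x i - x j)) (P * dist \<psi> \<psi>')"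
proof -
  let ?T = "param_space vinf vsup S"
  have T: "(vinf, \<psi>) \<in> ?T" if "\<psi> \<in> S" for \<psi> using that v by (simp add: param_space_def)
  have compT: "compact ?T" unfolding param_space_def by (intro compact_Times S(1)) simp
  have st: "stationary_covariance (c \<psi>)" if "\<psi> \<in> S" for \<psi>
    using corr[OF that] by (simp add: stationary_correlation_def)
  note even = covariance_even[OF st]
  have mc: "model_cov c (vinf, \<psi>) s = vinf * c \<psi> s" for \<psi> s by (simp add: model_cov_def)
  obtain \<delta> C e where \<delta>: "0 < \<delta>" and C: "0 < C" and e: "0 < e"
    and lip: "\<And>\<theta> \<theta>' s. \<theta> \<in> ?T \<Longrightarrow> \<theta>' \<in> ?T \<Longrightarrow> dist \<theta> \<theta>' < \<delta> \<Longrightarrow>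
       \<bar>model_cov c \<theta> s - model_cov c \<theta>' s\<bar> \<le> C * dist \<theta> \<theta>' * (1 / (1 + infnorm s powr (real CARD('d) + e)))"
    and ex: "\<And>\<theta> s. \<theta> \<in> ?T \<Longrightarrow> \<bar>model_cov c \<theta> s\<bar> \<le> C * exp (- e * infnorm s)"
    by (rule regular_model_lipschitz[OF reg compT]) (rule that; assumption)
  obtain K1 where K1: "0 < K1" "\<And>n z. (\<Sum>j<n. exp (- e * infnorm (z - x j))) \<le> K1"
    by (rule exponential_row_sums[OF e]) (rule that; assumption)
  obtain K2 where K2: "0 < K2" "\<And>n z. (\<Sum>j<n. 1 / (1 + infnorm (z - x j) powr (real CARD('d) + e))) \<le> K2"
    by (rule polynomial_row_sums[OF e]) (rule that; assumption)
  obtain \<rho> \<kappa> where rk: "0 < \<rho>" "0 < \<kappa>"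
    and spec: "\<And>k m n a. stationary_covariance k \<Longrightarrow> integrable lebesgue k \<Longrightarrow> 0 \<le> m \<Longrightarrow>
       (\<And>f. 0 \<le> Re (fourier k f)) \<Longrightarrow> (\<And>f. norm f \<le> \<rho> \<Longrightarrow> m \<le> Re (fourier k f)) \<Longrightarrow>
       m * \<kappa> * (\<Sum>i<n. (a i)\<^sup>2) \<le> (\<Sum>i<n. \<Sum>j<n. a i * a j * k (x i - x j))"
  proof (rule positive_spectrum_coercive, goal_cases)
    case (1 \<rho> \<kappa>)
    show ?case by (rule 1(1)) (fact 1)+
  qed
  have cont: "continuous_on (?T \<times> UNIV) (\<lambda>(\<theta>, f). fourier (model_cov c \<theta>) f)"
    and pos: "\<And>\<theta> f. \<theta> \<in> ?T \<Longrightarrow> 0 < Re (fourier (model_cov c \<theta>) f)"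
    using four unfolding positive_continuous_fourier_def by auto
  let ?A = "({vinf} \<times> S) \<times> cball (0 :: real ^ 'd) \<rho>"
  have contA: "continuous_on ?A (\<lambda>p. Re (fourier (model_cov c (fst p)) (snd p)))"
  proof -
    have "continuous_on ?A (\<lambda>(\<theta>, f). fourier (model_cov c \<theta>) f)"
      by (rule continuous_on_subset[OF cont]) (use T in auto)
    then show ?thesis by (auto simp: split_beta intro: continuous_on_Re)
  qed
  \<comment> \<open>The spectral density is bounded away from zero over all correlations and all low frequencies.\<close>
  have "compact ?A" by (intro compact_Times S(1) compact_cball) auto
  moreover have "?A \<noteq> {}" using S(2) rk(1) by auto
  ultimately obtain p where p: "p \<in> ?A"
    and pmin: "\<And>q. q \<in> ?A \<Longrightarrow> Re (fourier (model_cov c (fst p)) (snd p)) \<le> Re (fourier (model_cov c (fst q)) (snd q))"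
    using continuous_attains_inf[OF _ _ contA] by blast
  define m where "m = Re (fourier (model_cov c (fst p)) (snd p))"
  have m: "0 < m" unfolding m_def using p T by (intro pos) auto
  show thesis
  proof (rule that[of "m * \<kappa> / vinf" "C / vinf * K1" \<delta> "C / vinf * K2"])
    show "0 < m * \<kappa> / vinf" "0 < C / vinf * K1" "0 < \<delta>" "0 \<le> C / vinf * K2"
      using m rk v C K1 K2 \<delta> by auto
  next
    fix \<psi> n and a :: "nat \<Rightarrow> real" assume psi: "\<psi> \<in> S"
    have k: "model_cov c (vinf, \<psi>) = (\<lambda>s. vinf * c \<psi> s)" by (rule ext) (rule mc)
    have "m * \<kappa> * (\<Sum>i<n. (a i)\<^sup>2) \<le> (\<Sum>i<n. \<Sum>j<n. a i * a j * model_cov c (vinf, \<psi>) (x i - x j))"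
    proof (rule spec)
      show "stationary_covariance (model_cov c (vinf, \<psi>))"
        unfolding k by (rule stationary_covariance_scale[OF st[OF psi]]) (use v in simp)
      have "Re (fourier (model_cov c (vinf, \<psi>)) 0) \<noteq> 0" using pos[OF T[OF psi], of 0] by simp
      then show "integrable lebesgue (model_cov c (vinf, \<psi>))" by (intro fourier_nonzero_integrable) auto
      show "0 \<le> Re (fourier (model_cov c (vinf, \<psi>)) f)" for f using pos[OF T[OF psi], of f] by simp
      show "m \<le> Re (fourier (model_cov c (vinf, \<psi>)) f)" if "norm f \<le> \<rho>" for f
        unfolding m_def using pmin[of "((vinf, \<psi>), f)"] psi that by simp
    qed (use m in simp)
    also have "\<dots> = vinf * (\<Sum>i<n. a i * matvec n (\<lambda>i j. c \<psi> (x i - x j)) a i)"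
      unfolding mc matvec_def sum_distrib_left by (simp add: mult_ac)
    finally show "m * \<kappa> / vinf * (\<Sum>i<n. (a i)\<^sup>2) \<le> (\<Sum>i<n. a i * matvec n (\<lambda>i j. c \<psi> (x i - x j)) a i)"
      using v by (simp add: divide_le_eq mult.commute)
  next
    fix \<psi> n assume psi: "\<psi> \<in> S"
    show "op_norm_le n (\<lambda>i j. c \<psi> (x i - x j)) (C / vinf * K1)"
    proof (rule kernel_op_norm_le[where w="\<lambda>v. exp (- e * infnorm v)"])
      show "\<bar>c \<psi> v\<bar> \<le> C / vinf * exp (- e * infnorm v)" for v
        using ex[OF T[OF psi], of v] v unfolding mc by (simp add: abs_mult field_simps)
    qed (use even[OF psi] C v K1 in auto)
  next
    fix \<psi> \<psi>' n assume psi: "\<psi> \<in> S" "\<psi>' \<in> S" "dist \<psi> \<psi>' < \<delta>"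
    have "op_norm_le n (\<lambda>i j. (\<lambda>v. c \<psi> v - c \<psi>' v) (x i - x j)) (C * dist \<psi> \<psi>' / vinf * K2)"
    proof (rule kernel_op_norm_le[where w="\<lambda>v. 1 / (1 + infnorm v powr (real CARD('d) + e))"])
      fix v :: "real ^ 'd"
      have d: "dist (vinf, \<psi>) (vinf, \<psi>') = dist \<psi> \<psi>'" by (simp add: dist_Pair_Pair)
      have "\<bar>vinf * c \<psi> v - vinf * c \<psi>' v\<bar> \<le> C * dist \<psi> \<psi>' * (1 / (1 + infnorm v powr (real CARD('d) + e)))"
        using lip[OF T[OF psi(1)] T[OF psi(2)], of v] psi(3) unfolding mc d by simp
      then have "vinf * \<bar>c \<psi> v - c \<psi>' v\<bar> \<le> C * dist \<psi> \<psi>' * (1 / (1 + infnorm v powr (real CARD('d) + e)))"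
        using v(1) by (simp add: right_diff_distrib[symmetric] abs_mult)
      then show "\<bar>c \<psi> v - c \<psi>' v\<bar> \<le> C * dist \<psi> \<psi>' / vinf * (1 / (1 + infnorm v powr (real CARD('d) + e)))"
      proof -
        assume h: "vinf * \<bar>c \<psi> v - c \<psi>' v\<bar> \<le> C * dist \<psi> \<psi>' * (1 / (1 + infnorm v powr (real CARD('d) + e)))"
        have "\<bar>c \<psi> v - c \<psi>' v\<bar> = (vinf * \<bar>c \<psi> v - c \<psi>' v\<bar>) / vinf" using v(1) by simp
        also have "\<dots> \<le> (C * dist \<psi> \<psi>' * (1 / (1 + infnorm v powr (real CARD('d) + e)))) / vinf"
          by (rule divide_right_mono[OF h]) (use v(1) in simp)
        also have "\<dots> = C * dist \<psi> \<psi>' / vinf * (1 / (1 + infnorm v powr (real CARD('d) + e)))" by simp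
        finally show ?thesis .
      qed
    qed (use even psi C v K2 in auto)
    then show "op_norm_le n (\<lambda>i j. c \<psi> (x i - x j) - c \<psi>' (x i - x j)) (C / vinf * K2 * dist \<psi> \<psi>')"
      by (simp add: mult_ac)
  qed
qed

end

section \<open>Consistency of the cross validation estimator\<close>

text \<open>
  Chebyshev's inequality with a variance of order \<open>n\<^sup>-\<^sup>1\<^sup>/\<^sup>2\<close>.
\<close>
lemma quadratic_form_concentrates:
  fixes Z :: "real ^ 'd \<Rightarrow> 'w \<Rightarrow> real" and s :: "nat \<Rightarrow> real ^ 'd"
  assumes M: "prob_space M" and gp: "gaussian_process M Z" and zm: "zero_mean M Z"
    and cov: "has_stationary_covariance M Z kZ" and sub: "subexp_asymp_positive kZ"
    and T: "subexp_nondecreasing T" and ws: "well_separated s"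
    and B: "\<And>n. op_norm_le n (B n) b" "0 \<le> b" and eta: "0 < \<eta>"
  defines "f \<equiv> (\<lambda>n \<omega>. (\<Sum>k<n. (matvec n (B n) (\<lambda>j. T (Z (s j) \<omega>)) k)\<^sup>2) / real n)"
  shows "(\<lambda>n. measure M {\<omega>\<in>space M. \<eta> \<le> \<bar>f n \<omega> - integral\<^sup>L M (f n)\<bar>}) \<longlonglongrightarrow> 0"
proof -
  interpret prob_space M by fact
  obtain \<Delta> where sgap: "0 < \<Delta>" "\<And>i j. i \<noteq> j \<Longrightarrow> \<Delta> \<le> infnorm (s i - s j)"
    by (rule well_separated_gap[OF ws]) (rule that; assumption)
  interpret separated s \<Delta> by unfold_locales (rule sgap)+
  have inj: "inj s"
  proof (rule injI, rule ccontr)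
    fix i j assume "s i = s j" "i \<noteq> j"
    then show False using sgap(2)[of i j] sgap(1) by (simp add: infnorm_0)
  qed
  obtain C e where e: "0 < e" and C: "\<And>v. \<bar>kZ v\<bar> \<le> C * exp (- e * infnorm v)" and st: "stationary_covariance kZ"
  proof -
    have "\<exists>C c. 0 < c \<and> (\<forall>s. \<bar>kZ s\<bar> \<le> C * exp (- c * infnorm s))" "stationary_covariance kZ"
      using sub unfolding subexp_asymp_positive_def by (simp_all only: simp_thms)
    then show thesis using that by blast
  qed
  have C0: "0 \<le> C" using order_trans[OF abs_ge_zero C[of 0]] by (simp add: infnorm_0)
  obtain K1 where K1: "0 < K1" "\<And>n z. (\<Sum>j<n. exp (- e * infnorm (z - s j))) \<le> K1"
    by (rule exponential_row_sums[OF e]) (rule that; assumption)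
  have op: "op_norm_le n (\<lambda>i j. kZ (s i - s j)) (C * K1)" for n
  proof (rule kernel_op_norm_le[where w="\<lambda>v. exp (- e * infnorm v)"])
    show "\<bar>kZ v\<bar> \<le> C * exp (- e * infnorm v)" for v by (rule C)
    show "kZ (- v) = kZ v" for v by (rule covariance_even[OF st])
    show "0 \<le> C" by (rule C0)
    show "(\<Sum>j<n. exp (- e * infnorm (z - s j))) \<le> K1" for n z by (rule K1)
    show "0 \<le> K1" using K1 by simp
  qed
  obtain D where D: "\<And>t. \<bar>T t\<bar> \<le> D * exp (D * \<bar>t\<bar>)" "\<And>t. \<bar>deriv T t\<bar> \<le> D * exp (D * \<bar>t\<bar>)"
    and diff: "T differentiable_on UNIV" and cont: "continuous_on UNIV (deriv T)"
  proof -
    have "\<exists>C. \<forall>t. \<bar>T t\<bar> \<le> C * exp (C * \<bar>t\<bar>) \<and> \<bar>deriv T t\<bar> \<le> C * exp (C * \<bar>t\<bar>)"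
      using T unfolding subexp_nondecreasing_def by (elim conjE)
    moreover have "T differentiable_on UNIV" using T unfolding subexp_nondecreasing_def by (elim conjE)
    moreover have "continuous_on UNIV (deriv T)" using T unfolding subexp_nondecreasing_def by (elim conjE)
    ultimately show thesis using that by blast
  qed
  have dT: "(T has_real_derivative deriv T t) (at t)" for t
    using diff unfolding differentiable_on_def by (simp add: DERIV_deriv_iff_real_differentiable)
  have cT: "continuous_on UNIV T" using diff by (rule differentiable_imp_continuous_on)
  have Tm: "T \<in> borel_measurable borel" "deriv T \<in> borel_measurable borel"
    using cT cont by (auto intro: borel_measurable_continuous_onI)
  have Zint: "integrable M (Z x)" and Zmean: "expectation (Z x) = 0" for x
    using zm by (auto simp: zero_mean_def)
  have Zg: "gaussian_variable M (Z x)" for x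
  proof -
    show ?thesis
      using gp[unfolded gaussian_process_def, rule_format, of "{x}" "\<lambda>_. 1"] by simp
  qed
  have Zvar: "expectation (\<lambda>\<omega>. (Z x \<omega>)\<^sup>2) = kZ 0" for x
  proof -
    have "kZ (x - x) = expectation (\<lambda>\<omega>. (Z x \<omega> - expectation (Z x)) * (Z x \<omega> - expectation (Z x)))"
      using cov[unfolded has_stationary_covariance_def, rule_format, of x x] by (rule conjunct2)
    then show ?thesis by (simp add: Zmean power2_eq_square)
  qed
  define m where "m = 2 * D ^ 4 * exp (8 * D\<^sup>2 * kZ 0)"
  note mT = subexp_fourth_moment[OF Zg Zint Zmean Zvar D(1) Tm(1), folded m_def]
    and mT' = subexp_fourth_moment[OF Zg Zint Zmean Zvar D(2) Tm(2), folded m_def]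
  define V where "V = 4 * (pi / 2)\<^sup>2 * b ^ 4 * (C * K1) * m"
  have bound: "prob {\<omega>\<in>space M. \<eta> \<le> \<bar>f n \<omega> - expectation (f n)\<bar>} \<le> V / \<eta>\<^sup>2 / sqrt (real n)" if n: "1 \<le> n" for n
  proof -
    interpret gaussian_vector M n "\<lambda>i. Z (s i)" "\<lambda>i j. kZ (s i - s j)"
      by (rule gaussian_process_vector[OF M gp zm cov inj])
    have n0: "0 < n" using n by simp
    have CK: "0 \<le> C * K1" using C0 K1 by simp
    note q = quadratic_form_variance[OF n0 dT cont mT mT' op CK B]
    have f2: "integrable M (\<lambda>\<omega>. (f n \<omega>)\<^sup>2)" unfolding f_def by (rule q(1))
    have f1: "integrable M (f n)" unfolding f_def by (rule q(2))
    have fv: "variance (f n) \<le> V / sqrt (real n)" unfolding f_def V_def by (rule q(3))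
    have "prob {\<omega>\<in>space M. \<eta> \<le> \<bar>f n \<omega> - expectation (f n)\<bar>} \<le> variance (f n) / \<eta>\<^sup>2"
      by (rule Chebyshev_inequality) (use f1 f2 eta in auto)
    also have "\<dots> \<le> V / sqrt (real n) / \<eta>\<^sup>2" by (intro divide_right_mono fv) simp
    finally show ?thesis by (simp add: mult.commute)
  qed
  have lim: "(\<lambda>n. V / \<eta>\<^sup>2 / sqrt (real n)) \<longlonglongrightarrow> 0"
    by (rule tendsto_divide_0[OF tendsto_const])
       (rule filterlim_at_top_imp_at_infinity[OF filterlim_compose[OF sqrt_at_top filterlim_real_sequentially]])
  show ?thesis
  proof (rule tendsto_sandwich[OF _ _ tendsto_const lim])
    show "\<forall>\<^sub>F n in sequentially. prob {\<omega>\<in>space M. \<eta> \<le> \<bar>f n \<omega> - expectation (f n)\<bar>} \<le> V / \<eta>\<^sup>2 / sqrt (real n)"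
      using eventually_ge_at_top[of 1] by eventually_elim (rule bound)
  qed simp
qed

lemma quadratic_form_expectation:
  assumes int: "\<And>i j. i < n \<Longrightarrow> j < n \<Longrightarrow> integrable M (\<lambda>\<omega>. y i \<omega> * y j \<omega>)"
    and cov: "\<And>i j. i < n \<Longrightarrow> j < n \<Longrightarrow> (\<integral>\<omega>. y i \<omega> * y j \<omega> \<partial>M) = v * C i j"
  shows "(\<integral>\<omega>. (\<Sum>k<n. (matvec n B (\<lambda>j. y j \<omega>) k)\<^sup>2) / real n \<partial>M)
     = v * (\<Sum>k<n. \<Sum>j<n. B k j * matvec n C (B k) j) / real n"
proof -
  have e: "(matvec n B (\<lambda>j. y j \<omega>) k)\<^sup>2 = (\<Sum>j<n. \<Sum>i<n. B k j * B k i * (y j \<omega> * y i \<omega>))" for k \<omega>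
    unfolding matvec_def by (simp add: power2_eq_square sum_product mult_ac)
  have i1: "integrable M (\<lambda>\<omega>. \<Sum>i<n. B k j * B k i * (y j \<omega> * y i \<omega>))" if "j < n" for k j
    using that by (intro Bochner_Integration.integrable_sum integrable_mult_right int) auto
  have i2: "integrable M (\<lambda>\<omega>. \<Sum>j<n. \<Sum>i<n. B k j * B k i * (y j \<omega> * y i \<omega>))" for k
    by (rule Bochner_Integration.integrable_sum) (use i1 in auto)
  have "(\<integral>\<omega>. (\<Sum>k<n. (matvec n B (\<lambda>j. y j \<omega>) k)\<^sup>2) \<partial>M) = (\<Sum>k<n. (\<integral>\<omega>. (\<Sum>j<n. \<Sum>i<n. B k j * B k i * (y j \<omega> * y i \<omega>)) \<partial>M))"
    unfolding e by (rule Bochner_Integration.integral_sum) (rule i2)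
  also have "\<dots> = (\<Sum>k<n. \<Sum>j<n. (\<integral>\<omega>. (\<Sum>i<n. B k j * B k i * (y j \<omega> * y i \<omega>)) \<partial>M))"
    by (intro sum.cong refl Bochner_Integration.integral_sum) (use i1 in auto)
  also have "\<dots> = (\<Sum>k<n. \<Sum>j<n. \<Sum>i<n. (\<integral>\<omega>. B k j * B k i * (y j \<omega> * y i \<omega>) \<partial>M))"
    by (intro sum.cong refl Bochner_Integration.integral_sum integrable_mult_right int) auto
  also have "\<dots> = (\<Sum>k<n. \<Sum>j<n. \<Sum>i<n. B k j * B k i * (v * C j i))"
    by (intro sum.cong refl) (simp add: cov)
  also have "\<dots> = v * (\<Sum>k<n. \<Sum>j<n. B k j * matvec n C (B k) j)"
    unfolding matvec_def sum_distrib_left by (simp add: mult_ac)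
  finally show ?thesis by simp
qed

theorem theorem5:
  fixes M :: "'w measure"
    and Z :: "real ^ 'd \<Rightarrow> 'w \<Rightarrow> real"
    and Y :: "real ^ 'd \<Rightarrow> 'w \<Rightarrow> real"
    and T :: "real \<Rightarrow> real"
    and kZ kY :: "real ^ 'd \<Rightarrow> real"
    and s :: "nat \<Rightarrow> real ^ 'd"
    and S :: "(real ^ 'q) set"
    and \<Theta> :: "(real \<times> (real ^ 'q)) set"
    and c :: "real ^ 'q \<Rightarrow> real ^ 'd \<Rightarrow> real"
    and vinf vsup v0 :: real
    and \<psi>0 :: "real ^ 'q"
    and \<psi>CV :: "nat \<Rightarrow> 'w \<Rightarrow> real ^ 'q"
  assumes "prob_space M"
    and "gaussian_process M Z" and "zero_mean M Z"
    and "has_stationary_covariance M Z kZ" and "subexp_asymp_positive kZ"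
    and "subexp_nondecreasing T"
    and "Y = (\<lambda>x \<omega>. T (Z x \<omega>))"
    and "zero_mean M Y" and "has_stationary_covariance M Y kY"
    and "well_separated s"
    and "0 < vinf" and "vinf < vsup" and "compact S"
    and "\<Theta> = param_space vinf vsup S"
    and "\<And>\<psi>. \<psi> \<in> S \<Longrightarrow> stationary_correlation (c \<psi>)"
    and "regular_model \<Theta> (model_cov c)"
    and "positive_continuous_fourier \<Theta> (model_cov c)"
    and "(v0, \<psi>0) \<in> interior \<Theta>" and "kY = model_cov c (v0, \<psi>0)"
    and "\<And>\<alpha>. 0 < \<alpha> \<Longrightarrow>
          0 < liminf (\<lambda>n. INF \<psi>\<in>{\<psi>\<in>S. \<alpha> \<le> norm (\<psi> - \<psi>0)}.
                ereal (1 / real n * (\<Sum>i<n. \<Sum>j<n. (c \<psi> (s i - s j) - c \<psi>0 (s i - s j))\<^sup>2)))"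
    and "\<And>n. 1 \<le> n \<Longrightarrow> \<psi>CV n \<in> borel_measurable M"
    and "\<And>n \<omega>. 1 \<le> n \<Longrightarrow> \<omega> \<in> space M \<Longrightarrow>
          is_arg_min (\<lambda>\<psi>. cv_criterion (c \<psi>) s n (observations Y s n \<omega>)) (\<lambda>\<psi>. \<psi> \<in> S) (\<psi>CV n \<omega>)"
  shows "converges_in_probability M \<psi>CV \<psi>0"
proof -
  note M = assms(1) and gp = assms(2) and zm = assms(3) and cov = assms(4) and sub = assms(5) and T = assms(6)
    and Y = assms(7) and zmY = assms(8) and covY = assms(9) and ws = assms(10) and v = assms(11,12) and S = assms(13)
    and Theta = assms(14) and corr = assms(15) and reg = assms(16)[unfolded Theta] and four = assms(17)[unfolded Theta]
    and int0 = assms(18) and kY = assms(19) and ident = assms(20) and meas = assms(21) and argmin = assms(22)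
  interpret prob_space M by fact
  have "(v0, \<psi>0) \<in> \<Theta>" using int0 interior_subset by blast
  then have psi0: "\<psi>0 \<in> S" and v0: "0 < v0" using v unfolding Theta param_space_def by auto
  obtain \<Delta> where sgap: "0 < \<Delta>" "\<And>i j. i \<noteq> j \<Longrightarrow> \<Delta> \<le> infnorm (s i - s j)"
    by (rule well_separated_gap[OF ws]) (rule that; assumption)
  interpret separated s \<Delta> by unfold_locales (rule sgap)+
  have Sne: "S \<noteq> {}" using psi0 by blast
  obtain l L \<delta> P where l: "0 < l" and L: "0 < L" and \<delta>: "0 < \<delta>" and P: "0 \<le> P"
    and coer: "\<And>\<psi> n a. \<psi> \<in> S \<Longrightarrow> l * (\<Sum>i<n. (a i)\<^sup>2) \<le> (\<Sum>i<n. a i * matvec n (\<lambda>i j. c \<psi> (s i - s j)) a i)"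
    and opL: "\<And>\<psi> n. \<psi> \<in> S \<Longrightarrow> op_norm_le n (\<lambda>i j. c \<psi> (s i - s j)) L"
    and opP: "\<And>\<psi> \<psi>' n. \<psi> \<in> S \<Longrightarrow> \<psi>' \<in> S \<Longrightarrow> dist \<psi> \<psi>' < \<delta> \<Longrightarrow>
       op_norm_le n (\<lambda>i j. c \<psi> (s i - s j) - c \<psi>' (s i - s j)) (P * dist \<psi> \<psi>')"
  proof (rule correlation_model_bounds[OF v S Sne corr reg four], goal_cases)
    case (2 l L \<delta> P)
    show ?case by (rule 2(1)) (fact 2)+
  qed assumption
  define Cm where "Cm \<psi> i j = c \<psi> (s i - s j)" for \<psi> i j
  have st: "stationary_covariance (c \<psi>)" and c0: "c \<psi> 0 = 1" if "\<psi> \<in> S" for \<psi>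
    using corr[OF that] by (auto simp: stationary_correlation_def)
  have ex: "\<exists>R. correlation_matrix n (Cm \<psi>) R l L" if psi: "\<psi> \<in> S" for n \<psi>
  proof -
    have co: "l * (\<Sum>i<n. (a i)\<^sup>2) \<le> (\<Sum>i<n. a i * matvec n (Cm \<psi>) a i)" for a
      using coer[OF psi] unfolding Cm_def[abs_def] .
    obtain R where R: "\<And>i j. i < n \<Longrightarrow> j < n \<Longrightarrow> (\<Sum>k<n. Cm \<psi> i k * R k j) = (if i = j then 1 else 0)"
      by (rule coercive_right_inverse[OF l co]) (rule that; assumption)
    have "correlation_matrix n (Cm \<psi>) R l L"
    proof (unfold_locales; (rule l L R co; assumption)?)
      show "Cm \<psi> i j = Cm \<psi> j i" for i j
        using covariance_even[OF st[OF psi], of "s i - s j"] by (simp add: Cm_def)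
      show "Cm \<psi> i i = 1" for i using c0[OF psi] by (simp add: Cm_def)
      show "op_norm_le n (Cm \<psi>) L" using opL[OF psi] unfolding Cm_def[abs_def] .
    qed
    then show ?thesis by (intro exI[where x=R])
  qed
  \<comment> \<open>Only values below \<open>n\<close> are determined by this choice, and only they are used.\<close>
  define R where "R n \<psi> = (SOME R. correlation_matrix n (Cm \<psi>) R l L)" for n \<psi>
  have cm: "correlation_matrix n (Cm \<psi>) (R n \<psi>) l L" if "\<psi> \<in> S" for n \<psi>
    unfolding R_def by (rule someI_ex[OF ex[OF that]])
  have cm2: "two_correlation_matrices n (Cm \<psi>) (R n \<psi>) (Cm \<psi>') (R n \<psi>') l L" if "\<psi> \<in> S" "\<psi>' \<in> S" for n \<psi> \<psi>'
    using cm[OF that(1)] cm[OF that(2)] by (simp add: two_correlation_matrices_def)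
  define B where "B n \<psi> = correlation_matrix.loo (R n \<psi>)" for n \<psi>
  define b where "b = L\<^sup>2 / l\<^sup>2"
  have b: "0 \<le> b" by (simp add: b_def)
  have opB: "op_norm_le n (B n \<psi>) b" if "\<psi> \<in> S" for n \<psi>
    unfolding B_def b_def by (rule correlation_matrix.loo_bound[OF cm[OF that]])
  define Q where "Q n \<psi> \<omega> = (\<Sum>k<n. (matvec n (B n \<psi>) (\<lambda>j. T (Z (s j) \<omega>)) k)\<^sup>2) / real n" for n \<psi> \<omega>
  define W where "W n \<omega> = (\<Sum>k<n. (T (Z (s k) \<omega>))\<^sup>2) / real n" for n \<omega>
  have Q: "cv_criterion (c \<psi>) s n (observations Y s n \<omega>) = Q n \<psi> \<omega>" if "\<psi> \<in> S" for n \<psi> \<omega>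
    unfolding observations_def Y Q_def B_def
    by (rule correlation_matrix.cv_criterion_eq[OF cm[OF that]]) (simp add: Cm_def)
  have Ymean: "expectation (Y x) = 0" and Yint: "integrable M (Y x)" for x using zmY by (auto simp: zero_mean_def)
  have ym[measurable]: "(\<lambda>\<omega>. T (Z x \<omega>)) \<in> borel_measurable M" for x
    using Yint[of x] unfolding Y by simp
  have yint: "integrable M (\<lambda>\<omega>. T (Z x \<omega>) * T (Z x' \<omega>))"
    and ycov: "expectation (\<lambda>\<omega>. T (Z x \<omega>) * T (Z x' \<omega>)) = v0 * c \<psi>0 (x - x')" for x x'
  proof -
    have "integrable M (\<lambda>\<omega>. (Y x \<omega> - expectation (Y x)) * (Y x' \<omega> - expectation (Y x')))
       \<and> kY (x - x') = expectation (\<lambda>\<omega>. (Y x \<omega> - expectation (Y x)) * (Y x' \<omega> - expectation (Y x')))"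
      by (rule covY[unfolded has_stationary_covariance_def, rule_format])
    then show "integrable M (\<lambda>\<omega>. T (Z x \<omega>) * T (Z x' \<omega>))"
      "expectation (\<lambda>\<omega>. T (Z x \<omega>) * T (Z x' \<omega>)) = v0 * c \<psi>0 (x - x')"
      unfolding Ymean unfolding Y kY by (simp_all add: model_cov_def)
  qed
  define e where "e n \<psi> = expectation (Q n \<psi>)" for n \<psi>
  have e: "e n \<psi> = v0 * (\<Sum>k<n. \<Sum>j<n. B n \<psi> k j * matvec n (Cm \<psi>0) (B n \<psi> k) j) / real n" for n \<psi>
    unfolding e_def Q_def
    by (rule quadratic_form_expectation) (simp_all add: yint ycov Cm_def)
  have lipQ: "\<bar>Q n \<psi> \<omega> - Q n \<psi>' \<omega>\<bar> \<le> two_correlation_matrices.cv_lipschitz l L * P * dist \<psi> \<psi>' * W n \<omega>"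
    if "\<psi> \<in> S" "\<psi>' \<in> S" "dist \<psi> \<psi>' < \<delta>" for n \<psi> \<psi>' \<omega>
  proof -
    have op: "op_norm_le n (\<lambda>i j. Cm \<psi> i j - Cm \<psi>' i j) (P * dist \<psi> \<psi>')"
      using opP[OF that] unfolding Cm_def .
    have "\<bar>(\<Sum>k<n. (matvec n (B n \<psi>) (\<lambda>j. T (Z (s j) \<omega>)) k)\<^sup>2) - (\<Sum>k<n. (matvec n (B n \<psi>') (\<lambda>j. T (Z (s j) \<omega>)) k)\<^sup>2)\<bar>
       \<le> two_correlation_matrices.cv_lipschitz l L * (P * dist \<psi> \<psi>') * (\<Sum>k<n. (T (Z (s k) \<omega>))\<^sup>2)"
      unfolding B_def by (rule two_correlation_matrices.cv_diff_bound[OF cm2[OF that(2,1)] op]) (use P in simp)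
    then have "\<bar>(\<Sum>k<n. (matvec n (B n \<psi>) (\<lambda>j. T (Z (s j) \<omega>)) k)\<^sup>2) - (\<Sum>k<n. (matvec n (B n \<psi>') (\<lambda>j. T (Z (s j) \<omega>)) k)\<^sup>2)\<bar> / real n
       \<le> two_correlation_matrices.cv_lipschitz l L * (P * dist \<psi> \<psi>') * (\<Sum>k<n. (T (Z (s k) \<omega>))\<^sup>2) / real n"
      by (rule divide_right_mono) simp
    then show ?thesis unfolding Q_def W_def by (simp add: diff_divide_distrib[symmetric] mult.assoc)
  qed
  have lip0: "0 \<le> two_correlation_matrices.cv_lipschitz l L * P"
    unfolding two_correlation_matrices.cv_lipschitz_def[OF cm2[OF psi0 psi0]] using l L P by (intro mult_nonneg_nonneg) auto
  define q where "q = 2 * (L\<^sup>2 / l)\<^sup>2 * (1 + L\<^sup>2) * (L / l) ^ 4"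
  have q: "0 < q" unfolding q_def using l L by (intro mult_pos_pos zero_less_power divide_pos_pos add_pos_nonneg) auto
  have excess: "v0 * l / q * (1 / real n * (\<Sum>i<n. \<Sum>j<n. (c \<psi> (s i - s j) - c \<psi>0 (s i - s j))\<^sup>2)) \<le> e n \<psi> - e n \<psi>0"
    if psi: "\<psi> \<in> S" for n \<psi>
  proof -
    interpret two_correlation_matrices n "Cm \<psi>0" "R n \<psi>0" "Cm \<psi>" "R n \<psi>" l L by (rule cm2[OF psi0 psi])
    have "(\<Sum>i<n. \<Sum>j<n. (Cm \<psi> i j - Cm \<psi>0 i j)\<^sup>2) \<le> q * frob_sq n loo_diff"
      using frob_sq_C_diff unfolding q_def by (simp add: frob_sq_def)
    then have "l * ((\<Sum>i<n. \<Sum>j<n. (Cm \<psi> i j - Cm \<psi>0 i j)\<^sup>2) / q) \<le> l * frob_sq n loo_diff"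
      using l q by (intro mult_left_mono) (auto simp: divide_le_eq mult.commute)
    also have "\<dots> \<le> (\<Sum>k<n. \<Sum>j<n. B n \<psi> k j * matvec n (Cm \<psi>0) (B n \<psi> k) j)
        - (\<Sum>k<n. \<Sum>j<n. B n \<psi>0 k j * matvec n (Cm \<psi>0) (B n \<psi>0 k) j)"
      using excess unfolding B_def by simp
    finally have "v0 / real n * (l * ((\<Sum>i<n. \<Sum>j<n. (Cm \<psi> i j - Cm \<psi>0 i j)\<^sup>2) / q))
      \<le> v0 / real n * ((\<Sum>k<n. \<Sum>j<n. B n \<psi> k j * matvec n (Cm \<psi>0) (B n \<psi> k) j)
        - (\<Sum>k<n. \<Sum>j<n. B n \<psi>0 k j * matvec n (Cm \<psi>0) (B n \<psi>0 k) j))"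
      using v0 by (intro mult_left_mono) auto
    also have "\<dots> = e n \<psi> - e n \<psi>0" unfolding e by (simp add: right_diff_distrib diff_divide_distrib)
    finally show ?thesis unfolding Cm_def by (simp add: mult_ac)
  qed
  show ?thesis
  proof (rule argmin_consistent[where Q=Q and e=e and W=W and w=v0 and \<delta>=\<delta> and K="two_correlation_matrices.cv_lipschitz l L * P", OF S psi0])
    show "Q n \<psi> \<in> borel_measurable M" for n \<psi> unfolding Q_def[abs_def] matvec_def by measurable
    show "W n \<in> borel_measurable M" for n unfolding W_def[abs_def] by measurable
    show "\<psi>CV n \<in> borel_measurable M" if "1 \<le> n" for n by (rule meas[OF that])
    show "(\<lambda>n. prob {\<omega> \<in> space M. \<eta> \<le> \<bar>Q n \<psi> \<omega> - e n \<psi>\<bar>}) \<longlonglongrightarrow> 0" if "\<psi> \<in> S" "0 < \<eta>" for \<psi> \<eta>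
      unfolding e_def Q_def
      by (rule quadratic_form_concentrates[OF M gp zm cov sub T ws opB[OF that(1)] b that(2)])
    show "(\<lambda>n. prob {\<omega> \<in> space M. 1 \<le> \<bar>W n \<omega> - v0\<bar>}) \<longlonglongrightarrow> 0"
    proof -
      \<comment> \<open>The mean square of the observations is the quadratic form of the identity matrix.\<close>
      define J where "J i j = (if i = j then 1 else 0 :: real)" for i j :: nat
      have mvJ: "matvec n J x k = x k" if "k < n" for n x k
        using that unfolding matvec_def J_def by (simp add: mult_delta_left)
      have opJ: "op_norm_le n J 1" for n
        unfolding op_norm_le_def by (intro allI, subst mult_1) (rule eq_refl, rule L2_set_cong, auto simp: mvJ)
      have WJ: "W n = (\<lambda>\<omega>. (\<Sum>k<n. (matvec n J (\<lambda>j. T (Z (s j) \<omega>)) k)\<^sup>2) / real n)" for n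
        unfolding W_def by (intro ext arg_cong2[where f="(/)"] sum.cong refl) (simp add: mvJ)
      have "(\<lambda>n. prob {\<omega> \<in> space M. 1 \<le> \<bar>W n \<omega> - expectation (W n)\<bar>}) \<longlonglongrightarrow> 0"
        unfolding WJ by (rule quadratic_form_concentrates[OF M gp zm cov sub T ws opJ]) auto
      moreover have "\<forall>\<^sub>F n in sequentially. prob {\<omega> \<in> space M. 1 \<le> \<bar>W n \<omega> - expectation (W n)\<bar>} = prob {\<omega> \<in> space M. 1 \<le> \<bar>W n \<omega> - v0\<bar>}"
        using eventually_ge_at_top[of 1]
      proof eventually_elim
        case (elim n)
        have "expectation (W n) = (\<Sum>k<n. expectation (\<lambda>\<omega>. (T (Z (s k) \<omega>))\<^sup>2)) / real n"
          unfolding W_def[abs_def] using yint by (simp add: Bochner_Integration.integral_sum power2_eq_square)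
        also have "\<dots> = v0" using ycov c0[OF psi0] elim by (simp add: power2_eq_square)
        finally show ?case by simp
      qed
      ultimately show ?thesis by (rule Lim_transform_eventually)
    qed
    show "0 < \<delta>" by (rule \<delta>)
    show "0 \<le> two_correlation_matrices.cv_lipschitz l L * P" by (rule lip0)
    show "\<bar>Q n \<psi> \<omega> - Q n \<psi>' \<omega>\<bar> \<le> two_correlation_matrices.cv_lipschitz l L * P * dist \<psi> \<psi>' * W n \<omega>"
      if "1 \<le> n" "\<psi> \<in> S" "\<psi>' \<in> S" "dist \<psi> \<psi>' < \<delta>" for n \<psi> \<psi>' \<omega>
      by (rule lipQ[OF that(2-4)])
    show "\<psi>CV n \<omega> \<in> S \<and> Q n (\<psi>CV n \<omega>) \<omega> \<le> Q n \<psi>0 \<omega>" if "1 \<le> n" "\<omega> \<in> space M" for n \<omega>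
    proof -
      have 1: "\<psi>CV n \<omega> \<in> S" and 2: "\<not> cv_criterion (c \<psi>0) s n (observations Y s n \<omega>) < cv_criterion (c (\<psi>CV n \<omega>)) s n (observations Y s n \<omega>)"
        using argmin[OF that] psi0 unfolding is_arg_min_def by blast+
      show ?thesis using 1 2 unfolding Q[OF psi0] Q[OF 1] by simp
    qed
    show "\<exists>A>0. \<forall>\<^sub>F n in sequentially. \<forall>\<psi>\<in>S. \<alpha> \<le> dist \<psi> \<psi>0 \<longrightarrow> A \<le> e n \<psi> - e n \<psi>0" if alpha: "0 < \<alpha>" for \<alpha>
    proof -
      let ?D = "\<lambda>n \<psi>. 1 / real n * (\<Sum>i<n. \<Sum>j<n. (c \<psi> (s i - s j) - c \<psi>0 (s i - s j))\<^sup>2)"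
      obtain y where y: "0 < ereal y" "ereal y < liminf (\<lambda>n. INF \<psi>\<in>{\<psi>\<in>S. \<alpha> \<le> norm (\<psi> - \<psi>0)}. ereal (?D n \<psi>))"
        using ereal_dense2[OF ident[OF alpha]] by blast
      have "\<forall>\<^sub>F n in sequentially. ereal y < (INF \<psi>\<in>{\<psi>\<in>S. \<alpha> \<le> norm (\<psi> - \<psi>0)}. ereal (?D n \<psi>))"
        by (rule less_LiminfD[OF y(2)])
      then have "\<forall>\<^sub>F n in sequentially. \<forall>\<psi>\<in>S. \<alpha> \<le> dist \<psi> \<psi>0 \<longrightarrow> v0 * l / q * y \<le> e n \<psi> - e n \<psi>0"
      proof eventually_elim
        case (elim n)
        show ?case
        proof (intro ballI impI)
          fix \<psi> assume psi: "\<psi> \<in> S" "\<alpha> \<le> dist \<psi> \<psi>0"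
          have "(INF \<psi>\<in>{\<psi>\<in>S. \<alpha> \<le> norm (\<psi> - \<psi>0)}. ereal (?D n \<psi>)) \<le> ereal (?D n \<psi>)"
            by (rule INF_lower) (use psi in \<open>simp add: dist_norm\<close>)
          with elim have "ereal y < ereal (?D n \<psi>)" by (rule less_le_trans)
          then have "y \<le> ?D n \<psi>" by simp
          then have "v0 * l / q * y \<le> v0 * l / q * ?D n \<psi>"
            using v0 l q by (intro mult_left_mono) auto
          also have "\<dots> \<le> e n \<psi> - e n \<psi>0" by (rule excess[OF psi(1)])
          finally show "v0 * l / q * y \<le> e n \<psi> - e n \<psi>0" .
        qed
      qed
      moreover have "0 < v0 * l / q * y" using v0 l q y(1) by simp
      ultimately show ?thesis by blast
    qed
  qed
qed

end
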